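(* Let $G$ be a compact metrizable group, $y\in G$, and $\{F_n\}_{n=1}^\infty$ a right Følner sequence of $\widehat G$. For every finite Borel measure $\mu$ on $G$, $$\lim_{n\to\infty}\frac{1}{|F_n|_w}\sum_{\alpha\in F_n}d_\alpha\sum_{1\le i,j\le d_\alpha}\mu(u^\alpha_{ij})\overline{u^\alpha_{ij}(y)}=\mu\{y\},$$ and $$\lim_{n\to\infty}\frac{1}{|F_n|_w}\sum_{\alpha\in F_n}d_\alpha\sum_{1\le i,j\le d_\alpha}|\mu(u^\alpha_{ij})|^2=\sum_{x\in G}\mu\{x\}^2.$$ Hence $\mu$ is continuous (i.e. $\mu\{x\}=0$ for all $x\in G$) if and only if $\lim_{n\to\infty}\frac{1}{|F_n|_w}\sum_{\alpha\in F_n}d_\alpha\sum_{1\le i,j\le d_\alpha}|\mu(u^\alpha_{ij})|^2=0$.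
   Context: $\widehat G$ is the (countable) set of equivalence classes of irreducible continuous unitary representations of $G$; for $\alpha\in\widehat G$, $(u^\alpha_{ij})_{1\le i,j\le d_\alpha}\in M_{d_\alpha}(C(G))$ is a unitary matrix of continuous functions representing $\alpha$, with $d_\alpha$ its dimension. $\mu(f)=\int_G f\,d\mu$. $N^\gamma_{\alpha,\beta}$ is the multiplicity of $\gamma$ in the tensor product $\alpha\otimes\beta$. For finite $S,F\subseteq\widehat G$: $\partial_S(F)=\{\alpha\in F:\exists\gamma\in S,\beta\notin F,N^\beta_{\alpha,\gamma}>0\}\cup\{\alpha\notin F:\exists\gamma\in S,\beta\in F,N^\beta_{\alpha,\gamma}>0\}$, and $|F|_w=\sum_{\alpha\in F}d_\alpha^2$. A right Følner sequence of $\widehat G$ is a sequence of finite subsets $F_n\subseteq\widehat G$ with $|\partial_S(F_n)|_w/|F_n|_w\to 0$ for every finite nonempty $S\subseteq\widehat G$. *)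

theory Defs
  imports "HOL-Analysis.Analysis"
begin

text \<open>
  The compact metrizable group G is a type of class
  topological_group_add (a possibly non-commutative group, written additively,
  with continuous operations) and metric_space (the topology is metrizable),
  with compact UNIV.

  A finite-dimensional matrix representation is a pair (d, u), where d is the
  dimension and u g i j is the (i,j) entry of the matrix of g, indices i,j < d
  (entries outside this range are zero).
\<close>

type_synonym 'g mrep = "nat \<times> ('g \<Rightarrow> nat \<Rightarrow> nat \<Rightarrow> complex)"

definition rep_dim :: "'g mrep \<Rightarrow> nat" where
  "rep_dim r = fst r"

definition rep_mat :: "'g mrep \<Rightarrow> 'g \<Rightarrow> nat \<Rightarrow> nat \<Rightarrow> complex" where
  "rep_mat r = snd r"

definition cont_unitary_rep :: "'g::{topological_group_add} mrep \<Rightarrow> bool" where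
  "cont_unitary_rep r \<longleftrightarrow>
     (let d = rep_dim r; u = rep_mat r in
       d \<ge> 1
     \<and> (\<forall>g i j. \<not> (i < d \<and> j < d) \<longrightarrow> u g i j = 0)
     \<and> (\<forall>i j. continuous_on UNIV (\<lambda>g. u g i j))
     \<and> (\<forall>g h i j. i < d \<longrightarrow> j < d \<longrightarrow> u (g + h) i j = (\<Sum>k<d. u g i k * u h k j))
     \<and> (\<forall>g i j. i < d \<longrightarrow> j < d \<longrightarrow>
            (\<Sum>k<d. u g i k * cnj (u g j k)) = (if i = j then 1 else 0))
     \<and> (\<forall>g i j. i < d \<longrightarrow> j < d \<longrightarrow>
            (\<Sum>k<d. cnj (u g k i) * u g k j) = (if i = j then 1 else 0)))"

definition cvecs :: "nat \<Rightarrow> (nat \<Rightarrow> complex) set" where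
  "cvecs d = {v. \<forall>i\<ge>d. v i = 0}"

definition mat_vec :: "nat \<Rightarrow> (nat \<Rightarrow> nat \<Rightarrow> complex) \<Rightarrow> (nat \<Rightarrow> complex) \<Rightarrow> (nat \<Rightarrow> complex)" where
  "mat_vec d A v = (\<lambda>i. if i < d then (\<Sum>k<d. A i k * v k) else 0)"

definition invariant_subspace :: "'g mrep \<Rightarrow> (nat \<Rightarrow> complex) set \<Rightarrow> bool" where
  "invariant_subspace r W \<longleftrightarrow>
     W \<subseteq> cvecs (rep_dim r) \<and> (\<lambda>_. 0) \<in> W
   \<and> (\<forall>v\<in>W. \<forall>w\<in>W. (\<lambda>i. v i + w i) \<in> W)
   \<and> (\<forall>c. \<forall>v\<in>W. (\<lambda>i. c * v i) \<in> W)
   \<and> (\<forall>g. \<forall>v\<in>W. mat_vec (rep_dim r) (rep_mat r g) v \<in> W)"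

definition irreducible_rep :: "'g::{topological_group_add} mrep \<Rightarrow> bool" where
  "irreducible_rep r \<longleftrightarrow> cont_unitary_rep r \<and>
     (\<forall>W. invariant_subspace r W \<longrightarrow> W = {\<lambda>_. 0} \<or> W = cvecs (rep_dim r))"

definition intertwiner :: "'g mrep \<Rightarrow> 'g mrep \<Rightarrow> (nat \<Rightarrow> nat \<Rightarrow> complex) \<Rightarrow> bool" where
  "intertwiner r s T \<longleftrightarrow>
     (\<forall>i j. \<not> (i < rep_dim s \<and> j < rep_dim r) \<longrightarrow> T i j = 0)
   \<and> (\<forall>g i j. i < rep_dim s \<longrightarrow> j < rep_dim r \<longrightarrow>
        (\<Sum>k<rep_dim r. T i k * rep_mat r g k j) = (\<Sum>k<rep_dim s. rep_mat s g i k * T k j))"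

definition rep_equiv :: "'g mrep \<Rightarrow> 'g mrep \<Rightarrow> bool" where
  "rep_equiv r s \<longleftrightarrow> rep_dim r = rep_dim s \<and>
     (\<exists>T B. intertwiner r s T \<and>
        (\<forall>i j. i < rep_dim r \<longrightarrow> j < rep_dim r \<longrightarrow>
           (\<Sum>k<rep_dim r. T i k * B k j) = (if i = j then 1 else 0)
         \<and> (\<Sum>k<rep_dim r. B i k * T k j) = (if i = j then 1 else 0)))"

definition dual :: "'g::{topological_group_add} mrep set set" where
  "dual = {{s. irreducible_rep s \<and> rep_equiv r s} | r. irreducible_rep r}"

definition repr :: "'g mrep set \<Rightarrow> 'g mrep" where
  "repr \<alpha> = (SOME r. r \<in> \<alpha>)"

definition ddim :: "'g mrep set \<Rightarrow> nat" where
  "ddim \<alpha> = rep_dim (repr \<alpha>)"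

definition ucoef :: "'g mrep set \<Rightarrow> nat \<Rightarrow> nat \<Rightarrow> 'g \<Rightarrow> complex" where
  "ucoef \<alpha> i j = (\<lambda>g. rep_mat (repr \<alpha>) g i j)"

definition rep_tensor :: "'g mrep \<Rightarrow> 'g mrep \<Rightarrow> 'g mrep" where
  "rep_tensor r s = (rep_dim r * rep_dim s,
     (\<lambda>g i j. if i < rep_dim r * rep_dim s \<and> j < rep_dim r * rep_dim s
        then rep_mat r g (i div rep_dim s) (j div rep_dim s)
             * rep_mat s g (i mod rep_dim s) (j mod rep_dim s)
        else 0))"

text \<open>Multiplicity of r in s: dimension of the space Hom_G(r, s) of intertwiners,
  i.e. maximal number of linearly independent intertwiners.\<close>
definition multiplicity :: "'g mrep \<Rightarrow> 'g mrep \<Rightarrow> nat" where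
  "multiplicity r s = Max {k. \<exists>T :: nat \<Rightarrow> nat \<Rightarrow> nat \<Rightarrow> complex.
       (\<forall>l<k. intertwiner r s (T l))
     \<and> (\<forall>c :: nat \<Rightarrow> complex. (\<forall>i j. (\<Sum>l<k. c l * T l i j) = 0) \<longrightarrow> (\<forall>l<k. c l = 0))}"

definition Nmult :: "'g mrep set \<Rightarrow> 'g mrep set \<Rightarrow> 'g mrep set \<Rightarrow> nat" where
  "Nmult \<gamma> \<alpha> \<beta> = multiplicity (repr \<gamma>) (rep_tensor (repr \<alpha>) (repr \<beta>))"

definition boundary :: "'g::{topological_group_add} mrep set set \<Rightarrow> 'g mrep set set \<Rightarrow> 'g mrep set set" where
  "boundary S F =
     {\<alpha>\<in>F. \<exists>\<gamma>\<in>S. \<exists>\<beta>\<in>dual - F. Nmult \<beta> \<alpha> \<gamma> > 0}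
   \<union> {\<alpha>\<in>dual - F. \<exists>\<gamma>\<in>S. \<exists>\<beta>\<in>F. Nmult \<beta> \<alpha> \<gamma> > 0}"

definition wcard :: "'g mrep set set \<Rightarrow> real" where
  "wcard F = (\<Sum>\<alpha>\<in>F. real (ddim \<alpha>) ^ 2)"

definition right_folner :: "(nat \<Rightarrow> 'g::{topological_group_add} mrep set set) \<Rightarrow> bool" where
  "right_folner F \<longleftrightarrow>
     (\<forall>n. finite (F n) \<and> F n \<noteq> {} \<and> F n \<subseteq> dual)
   \<and> (\<forall>S. finite S \<and> S \<noteq> {} \<and> S \<subseteq> dual \<longrightarrow>
        (\<lambda>n. wcard (boundary S (F n)) / wcard (F n)) \<longlonglongrightarrow> 0)"

end

theory Submission
  imports Defs "HOL-Computational_Algebra.Fundamental_Theorem_Algebra"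
begin

text \<open>
  With \<open>\<chi>\<^sub>\<alpha>\<close> the character of \<open>\<alpha>\<close> and \<open>K\<^sub>n = |F\<^sub>n|\<^sub>w\<^bsup>-1\<^esup> \<Sum>\<^bsub>\<alpha>\<in>F\<^sub>n\<^esub> d\<^sub>\<alpha> \<chi>\<^sub>\<alpha>\<close>, the first sum is the
  integral of \<open>K\<^sub>n (x - y)\<close> over \<open>x\<close>. Here \<open>|K\<^sub>n| \<le> 1\<close> and \<open>K\<^sub>n 0 = 1\<close>. For \<open>g \<noteq> 0\<close> the Peter--Weyl
  theorem provides \<open>\<gamma>\<close> with \<open>\<chi>\<^sub>\<gamma> g \<noteq> d\<^sub>\<gamma>\<close>; expanding \<open>\<chi>\<^sub>\<alpha> \<chi>\<^sub>\<gamma>\<close> into irreducible characters and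
  using Frobenius reciprocity, \<open>(\<chi>\<^sub>\<gamma> g - d\<^sub>\<gamma>) K\<^sub>n g\<close> is at most
  \<open>d\<^sub>\<gamma> |\<partial>\<^bsub>{\<gamma>}\<^esub> F\<^sub>n|\<^sub>w / |F\<^sub>n|\<^sub>w\<close> in modulus, so \<open>K\<^sub>n g\<close> tends to \<open>0\<close>. Dominated convergence
  gives the first limit. Integrating it over \<open>y\<close> gives the second one, since the integral of
  \<open>\<mu> {y}\<close> over \<open>y\<close> is the sum of the squares of the atoms.

  In place of the Haar measure, only the invariant mean of a continuous function is used: the
  constant approximated uniformly by averages of its right translates (von Neumann).
\<close>

section \<open>The invariant mean\<close>

text \<open>The weights d_\<alpha>^2 come from the fusion rules: for fixed \<gamma> the vector of
  dimensions is an eigenvector, with eigenvalue d_\<gamma>, both of the matrix of multiplicities and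
  of its transpose. One of these facts bounds the contribution of a boundary class by d_\<gamma>
  d_\<alpha>^2, the other makes the interior terms cancel. For the boundary it only matters whether
  a multiplicity vanishes, so \<open>Nmult\<close>, a maximal number of independent intertwiners, is
  never computed: means of characters supply the numbers and \<open>fmult_nonzero_iff\<close>
  matches the zeros. The main obstacle is to find, for each \<open>g \<noteq> 0\<close>, a
  finite-dimensional representation that sees \<open>g\<close>. It is left translation on an
  eigenspace of right convolution. Cauchy-Schwarz bounds a convolution uniformly by the quadratic
  means of its factors; this upgrades convergence in quadratic mean to uniform convergence, so that
  the eigenfunction is continuous and no completion of the space of continuous functions is formed.
  All functions averaged over the group are therefore continuous, which is why a mean on continuous
  functions, with a Fubini theorem for two variables, is enough.\<close>

definition avg :: "'g::group_add list \<Rightarrow> ('g \<Rightarrow> 'b::real_normed_field) \<Rightarrow> 'g \<Rightarrow> 'b" where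
  "avg as f x = (\<Sum>a\<leftarrow>as. f (x + a)) / of_nat (length as)"

definition lavg :: "'g::group_add list \<Rightarrow> ('g \<Rightarrow> 'b::real_normed_field) \<Rightarrow> 'g \<Rightarrow> 'b" where
  "lavg as f x = (\<Sum>a\<leftarrow>as. f (a + x)) / of_nat (length as)"

section \<open>Finite averages of translates\<close>

lemma sum_list_concat_map:
  "sum_list (map f (concat (map g xs))) = (\<Sum>x\<leftarrow>xs. sum_list (map f (g x)))"
  by (induction xs) auto

lemma length_concat_map_const:
  "length (concat (map (\<lambda>b. map (\<lambda>a. h b a) as) bs)) = length bs * length as"
  by (induction bs) auto

lemma sum_list_divide: "(\<Sum>x\<leftarrow>xs. f x / c) = (\<Sum>x\<leftarrow>xs. f x) / (c::'b::field)"
  by (induction xs) (auto simp: add_divide_distrib)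

text \<open>Lists of translations, unlike sets, keep multiplicities, so averages compose. The order
  \<open>b + a\<close> matters since the group may be noncommutative. The empty list gives the zero
  function, hence the conditions \<open>as \<noteq> []\<close> below.\<close>

lemma avg_avg: "avg bs (avg as f) = avg (concat (map (\<lambda>b. map (\<lambda>a. b + a) as) bs)) f"
  unfolding avg_def fun_eq_iff
  by (simp add: sum_list_concat_map length_concat_map_const sum_list_divide o_def add.assoc
      divide_divide_eq_left mult.commute)

lemma sum_list_swap:
  "(\<Sum>a\<leftarrow>as. \<Sum>b\<leftarrow>bs. f a b) = (\<Sum>b\<leftarrow>bs. \<Sum>a\<leftarrow>as. (f a b::'b::comm_monoid_add))"
  by (induction as) (auto simp: sum_list_addf)

lemma avg_lavg: "avg as (lavg bs f) x = lavg bs (avg as f) x"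
  unfolding avg_def lavg_def
  by (simp add: sum_list_divide add.assoc sum_list_swap[of _ as bs] mult.commute)

lemma norm_sum_list_diff:
  fixes e :: real
  assumes "\<And>a. norm (f a - c) \<le> e"
  shows "norm ((\<Sum>a\<leftarrow>as. f a) - of_nat (length as) * (c::'b::real_normed_field)) \<le> length as * e"
proof (induction as)
  case (Cons a as)
  have "(\<Sum>a\<leftarrow>a#as. f a) - of_nat (length (a#as)) * c
      = (f a - c) + ((\<Sum>a\<leftarrow>as. f a) - of_nat (length as) * c)"
    by (simp add: algebra_simps)
  also have "norm \<dots> \<le> e + length as * e"
    by (rule order.trans[OF norm_triangle_ineq]) (intro add_mono assms Cons.IH)
  finally show ?case by (simp add: algebra_simps)
qed auto

lemma norm_sum_list_avg_diff:
  fixes e :: real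
  assumes "as \<noteq> []" "\<And>a. norm (f a - c) \<le> e"
  shows "norm ((\<Sum>a\<leftarrow>as. f a) / of_nat (length as) - (c::'b::real_normed_field)) \<le> e"
proof -
  have "(\<Sum>a\<leftarrow>as. f a) / of_nat (length as) - c
      = ((\<Sum>a\<leftarrow>as. f a) - of_nat (length as) * c) / of_nat (length as)"
    using assms(1) by (simp add: field_simps)
  also have "norm \<dots> \<le> length as * e / length as"
    unfolding norm_divide norm_of_nat
    by (intro divide_right_mono norm_sum_list_diff assms) auto
  also have "\<dots> = e"
    using assms(1) by simp
  finally show ?thesis .
qed

lemma avg_near:
  assumes "as \<noteq> []" "\<And>x. norm (f x - c) \<le> e"
  shows "norm (avg as f x - c) \<le> e"
  unfolding avg_def by (rule norm_sum_list_avg_diff) (use assms in auto)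

lemma lavg_near:
  assumes "as \<noteq> []" "\<And>x. norm (f x - c) \<le> e"
  shows "norm (lavg as f x - c) \<le> e"
  unfolding lavg_def by (rule norm_sum_list_avg_diff) (use assms in auto)

lemma avg_diff: "avg as (\<lambda>x. f x - g x) x = avg as f x - avg as g x"
  unfolding avg_def by (simp add: sum_list_subtractf diff_divide_distrib)

lemma avg_add: "avg as (\<lambda>x. f x + g x) x = avg as f x + avg as g x"
  unfolding avg_def by (simp add: sum_list_addf add_divide_distrib)

lemma avg_cmult: "avg as (\<lambda>x. c * f x) x = c * avg as f x"
  unfolding avg_def by (simp add: sum_list_const_mult)

lemma continuous_on_sum_list:
  fixes f :: "'a \<Rightarrow> 'b::topological_space \<Rightarrow> 'c::topological_comm_monoid_add"
  assumes "\<And>a. continuous_on S (f a)"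
  shows "continuous_on S (\<lambda>x. \<Sum>a\<leftarrow>as. f a x)"
  by (induction as) (auto intro!: continuous_intros assms)

lemma continuous_on_UNIV_translate:
  fixes f :: "'g::topological_group_add \<Rightarrow> 'b::topological_space"
  assumes "continuous_on UNIV f"
  shows "continuous_on UNIV (\<lambda>x. f (x + a))" "continuous_on UNIV (\<lambda>x. f (a + x))"
    "continuous_on UNIV (\<lambda>x. f (- x))"
  by (auto intro!: continuous_on_compose2[OF assms] continuous_intros)

lemma continuous_on_avg:
  fixes f :: "'g::topological_group_add \<Rightarrow> 'b::real_normed_field"
  assumes "continuous_on UNIV f"
  shows "continuous_on UNIV (avg as f)"
proof (cases "as = []")
  case False
  then show ?thesis
    unfolding avg_def
    by (auto intro!: continuous_intros continuous_on_sum_list continuous_on_UNIV_translate assms)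
qed (simp add: avg_def)

section \<open>The constant limit of right averages\<close>

definition avg_tends :: "('g::group_add \<Rightarrow> complex) \<Rightarrow> complex \<Rightarrow> bool" where
  "avg_tends f c \<longleftrightarrow> (\<forall>\<epsilon>>0. \<exists>as. as \<noteq> [] \<and> (\<forall>x. cmod (avg as f x - c) \<le> \<epsilon>))"

text \<open>Meaningful once \<open>avg_tends_ex\<close> and \<open>avg_tends_unique\<close> apply,
  that is for continuous \<open>f\<close> on a compact group; hence the continuity hypotheses on the
  laws of the mean.\<close>

definition mean :: "('g::group_add \<Rightarrow> complex) \<Rightarrow> complex" where
  "mean f = (THE c. avg_tends f c)"

text \<open>The parameter \<open>G\<close> only serves to fix the type.\<close>

locale compact_metric_group =
  fixes G :: "'g::{topological_group_add,metric_space} itself"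
  assumes compact_UNIV: "compact (UNIV::'g set)"
begin

text \<open>The perturbation \<open>z\<close> stands on the left because right averages commute with
  left translations: every \<open>avg as f\<close> then inherits the \<open>\<delta>\<close> of
  \<open>f\<close>.\<close>

lemma uniform_translate:
  fixes f :: "'g \<Rightarrow> 'b::metric_space"
  assumes "continuous_on UNIV f" "\<epsilon> > 0"
  shows "\<exists>\<delta>>0. \<forall>z y. dist z 0 < \<delta> \<longrightarrow> dist (f (z + y)) (f y) < \<epsilon>"
proof -
  have "continuous_on (UNIV \<times> UNIV) (\<lambda>p::'g\<times>'g. f (fst p + snd p))"
    by (intro continuous_on_compose2[OF assms(1)] continuous_intros) auto
  then have "uniformly_continuous_on (UNIV \<times> UNIV) (\<lambda>p::'g\<times>'g. f (fst p + snd p))"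
    by (rule compact_uniformly_continuous) (intro compact_Times compact_UNIV)
  then obtain \<delta> where "\<delta> > 0" and
    \<delta>: "\<And>p q :: 'g\<times>'g. dist q p < \<delta> \<Longrightarrow> dist (f (fst q + snd q)) (f (fst p + snd p)) < \<epsilon>"
    using \<open>\<epsilon> > 0\<close> unfolding uniformly_continuous_on_def by (metis UNIV_I UNIV_Times_UNIV)
  have "dist (f (z + y)) (f y) < \<epsilon>" if "dist z 0 < \<delta>" for z y
    using \<delta>[of "(z, y)" "(0, y)"] that by (simp add: dist_Pair_Pair)
  then show ?thesis using \<open>\<delta> > 0\<close> by auto
qed

lemma finite_translate_cover:
  fixes U :: "'g set"
  assumes "open U" "u \<in> U"
  shows "\<exists>cs. cs \<noteq> [] \<and> (\<forall>x. \<exists>c\<in>set cs. x - c \<in> U)"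
proof -
  have op: "open ((\<lambda>x. x - c) -` U)" for c
    by (intro open_vimage assms continuous_intros)
  have cov: "UNIV \<subseteq> (\<Union>c\<in>UNIV. (\<lambda>x. x - c) -` U)"
  proof
    fix x :: 'g
    \<comment> \<open>The centre \<open>- u + x\<close> carries \<open>x\<close> exactly to
      \<open>u\<close>: \<open>x - (- u + x) = x + (- x + u) = u\<close>.\<close>
    have "x - (- u + x) \<in> U"
      using assms(2) by (simp add: diff_conv_add_uminus minus_add add.assoc[symmetric] del: add_uminus_conv_diff)
    then show "x \<in> (\<Union>c\<in>UNIV. (\<lambda>x. x - c) -` U)" by blast
  qed
  obtain C where C: "finite C" "UNIV \<subseteq> (\<Union>c\<in>C. (\<lambda>x. x - c) -` U)"
    by (rule compactE_image[OF compact_UNIV _ cov]) (use op in auto)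
  obtain cs where "set cs = C" using C(1) finite_list by blast
  then show ?thesis using C(2) by (intro exI[of _ cs]) (auto simp: subset_iff)
qed

lemma bounded_cont:
  fixes f :: "'g \<Rightarrow> 'b::real_normed_vector"
  assumes "continuous_on UNIV f"
  obtains B where "B > 0" "\<And>x. norm (f x) \<le> B"
proof -
  have "bounded (range f)"
    using compact_continuous_image[OF assms compact_UNIV] compact_imp_bounded by blast
  then show ?thesis using that unfolding bounded_pos by auto
qed

text \<open>Finitely many translates of the region where \<open>f\<close> is near its minimum cover the group, so
  averaging over them lowers the maximum by a fixed fraction of the oscillation. The number of
  translates depends only on the modulus of continuity, which averaging preserves.\<close>

lemma small_oscillation:
  fixes f :: "'g \<Rightarrow> real"
  assumes cf: "continuous_on UNIV f" and "\<epsilon> > 0"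
  shows "\<exists>as. as \<noteq> [] \<and> (\<forall>x y. avg as f x - avg as f y \<le> \<epsilon>)"
proof -
  \<comment> \<open>\<open>S\<close> collects the bounds on the oscillation of right averages of
    \<open>f\<close>. A positive infimum \<open>m\<close> is refuted by an average that undercuts
    it.\<close>
  define S where "S = {s. \<exists>as. as \<noteq> [] \<and> (\<forall>x y. avg as f x - avg as f y \<le> s)}"
  define m where "m = Inf S"
  obtain B where B: "\<And>x. \<bar>f x\<bar> \<le> B" using bounded_cont[OF cf] by auto
  have "avg [0] f x = f x" for x by (simp add: avg_def)
  moreover have "f x - f y \<le> 2 * B" for x y using B[of x] B[of y] by linarith
  ultimately have ne: "2 * B \<in> S" unfolding S_def
    by (intro CollectI exI[of _ "[0]"]) auto
  have S0: "0 \<le> s" if s: "s \<in> S" for s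
  proof -
    obtain as where "\<forall>x y. avg as f x - avg as f y \<le> s" using s unfolding S_def by blast
    from this[rule_format, of 0 0] show ?thesis by simp
  qed
  have bdd: "bdd_below S" using S0 by (intro bdd_belowI[of _ 0])
  have m0: "0 \<le> m" unfolding m_def using ne S0 by (intro cInf_greatest) auto
  have lower: "m \<le> s" if "s \<in> S" for s unfolding m_def using that bdd by (rule cInf_lower)
  have "m = 0"
  proof (rule ccontr)
    assume "m \<noteq> 0"
    then have "m > 0" using m0 by simp
    obtain \<delta> where "\<delta> > 0" and \<delta>: "\<And>z y. dist z 0 < \<delta> \<Longrightarrow> dist (f (z + y)) (f y) < m / 2"
      using uniform_translate[OF cf, of "m/2"] \<open>m > 0\<close> by auto
    obtain cs :: "'g list" where "cs \<noteq> []" and cs: "\<And>x. \<exists>c\<in>set cs. x - c \<in> ball 0 \<delta>"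
      using finite_translate_cover[of "ball 0 \<delta>" 0] \<open>\<delta> > 0\<close> by (metis centre_in_ball open_ball)
    define N where "N = real (length cs)"
    have N: "N \<ge> 1" using \<open>cs \<noteq> []\<close> unfolding N_def by (cases cs) auto
    \<comment> \<open>One further averaging will gain \<open>m / (2 * N)\<close>, so an average
      within that distance of the infimum is what is needed.\<close>
    obtain s where "s \<in> S" "s < m + m / (2 * N)"
      using cInf_lessD[of S "m + m / (2*N)"] ne \<open>m > 0\<close> N unfolding m_def[symmetric] by fastforce
    then obtain as where "as \<noteq> []" and as: "\<And>x y. avg as f x - avg as f y \<le> s"
      unfolding S_def by blast
    have "m \<le> s" using lower \<open>s \<in> S\<close> .
    define h where "h = avg as f"
    have "continuous_on UNIV h" unfolding h_def by (rule continuous_on_avg[OF cf])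
    then obtain x0 where x0: "\<And>x. h x0 \<le> h x"
      using continuous_attains_inf[OF compact_UNIV] by blast
    have near: "h (z + y) - h y \<le> m / 2" if "dist z 0 < \<delta>" for z y
    proof -
      have "norm (avg as (\<lambda>y. f (z + y) - f y) y - 0) \<le> m / 2"
        using \<delta>[OF that] by (intro avg_near \<open>as \<noteq> []\<close>) (auto simp: dist_norm less_imp_le)
      moreover have "avg as (\<lambda>y. f (z + y)) y = h (z + y)"
        unfolding h_def avg_def by (simp add: add.assoc)
      ultimately show ?thesis
        unfolding avg_diff h_def[symmetric] real_norm_def by linarith
    qed
    \<comment> \<open>Since \<open>x + (- c + x0) = (x - c) + x0\<close>, every \<open>x\<close> is
      moved by at least one of these translations close to the minimum point
      \<open>x0\<close>.\<close>
    define bs where "bs = map (\<lambda>c. - c + x0) cs"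
    have up: "avg bs h x \<le> h x0 + s - m / (2 * N)" for x
    proof -
      obtain c where c: "c \<in> set cs" "dist (x - c) 0 < \<delta>" using cs[of x] by (auto simp: dist_commute)
      have 1: "h (x + (- c + x0)) \<le> h x0 + m / 2"
        using near[OF c(2), of x0] by (simp add: diff_conv_add_uminus add.assoc del: add_uminus_conv_diff)
      have 2: "h (x + (- d + x0)) \<le> h x0 + s" for d
        using as[of "x + (- d + x0)" x0] unfolding h_def by simp
      have eq: "(\<Sum>d\<leftarrow>cs. h (x + (- d + x0))) = h (x + (- c + x0)) + (\<Sum>d\<leftarrow>remove1 c cs. h (x + (- d + x0)))"
        using c(1) by (rule sum_list_map_remove1)
      have "(\<Sum>d\<leftarrow>remove1 c cs. h (x + (- d + x0))) \<le> (\<Sum>d\<leftarrow>remove1 c cs. h x0 + s)"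
        by (intro sum_list_mono 2)
      also have "\<dots> = (N - 1) * (h x0 + s)"
        using c(1) length_pos_if_in_set[OF c(1)]
        by (cases "length cs") (auto simp: sum_list_triv length_remove1 N_def)
      finally have "(\<Sum>d\<leftarrow>cs. h (x + (- d + x0))) \<le> h x0 + m / 2 + (N - 1) * (h x0 + s)"
        using 1 eq by linarith
      \<comment> \<open>The left side is \<open>N * (h x0 + s) - (s - m / 2)\<close>, and
        \<open>m \<le> s\<close> makes the deficit at least \<open>m / 2\<close>.\<close>
      also have "\<dots> \<le> N * (h x0 + s - m / (2 * N))"
        using \<open>m \<le> s\<close> N by (simp add: field_simps)
      finally have "(\<Sum>d\<leftarrow>cs. h (x + (- d + x0))) \<le> N * (h x0 + s - m / (2 * N))" .
      then show ?thesis
        using N unfolding avg_def bs_def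
        by (simp add: o_def N_def[symmetric] pos_divide_le_eq mult.commute)
    qed
    have low: "avg bs h y \<ge> h x0" for y
    proof -
      have "N * h x0 = (\<Sum>d\<leftarrow>cs. h x0)" by (simp add: sum_list_triv N_def)
      also have "\<dots> \<le> (\<Sum>d\<leftarrow>cs. h (y + (- d + x0)))" by (intro sum_list_mono x0)
      finally show ?thesis
        using N unfolding avg_def bs_def by (simp add: o_def N_def[symmetric] pos_le_divide_eq mult.commute)
    qed
    have "s - m / (2 * N) \<in> S"
    proof -
      define cc where "cc = concat (map (\<lambda>b. map (\<lambda>a. b + a) as) bs)"
      have 1: "avg bs h = avg cc f" unfolding h_def cc_def by (rule avg_avg)
      have "length cc \<noteq> 0"
        unfolding cc_def length_concat_map_const using \<open>as \<noteq> []\<close> \<open>cs \<noteq> []\<close> by (simp add: bs_def)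
      then have "cc \<noteq> []" by auto
      moreover have "avg cc f x - avg cc f y \<le> s - m / (2 * N)" for x y
        unfolding 1[symmetric] using up[of x] low[of y] by linarith
      ultimately show ?thesis unfolding S_def by blast
    qed
    from lower[OF this] \<open>s < m + m / (2 * N)\<close> show False by linarith
  qed
  then obtain s where "s \<in> S" "s < \<epsilon>"
    using cInf_lessD[of S \<epsilon>] ne \<open>\<epsilon> > 0\<close> unfolding m_def by auto
  then obtain as where "as \<noteq> []" "\<And>x y. avg as f x - avg as f y \<le> s"
    unfolding S_def by blast
  then show ?thesis using \<open>s < \<epsilon>\<close>
    by (intro exI[of _ as]) (metis less_imp_le order.trans)
qed

lemma avg_near_ex:
  assumes cf: "continuous_on UNIV (f::'g \<Rightarrow> complex)" and "\<epsilon> > 0"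
  shows "\<exists>as c. as \<noteq> [] \<and> (\<forall>x. cmod (avg as f x - c) \<le> \<epsilon>)"
proof -
  have Re: "Re (avg as h x) = avg as (\<lambda>x. Re (h x)) x" and Im: "Im (avg as h x) = avg as (\<lambda>x. Im (h x)) x"
    for as x and h :: "'g \<Rightarrow> complex"
  proof -
    have "Re (\<Sum>a\<leftarrow>as. h (x + a)) = (\<Sum>a\<leftarrow>as. Re (h (x + a)))" by (induction as) auto
    then show "Re (avg as h x) = avg as (\<lambda>x. Re (h x)) x"
      unfolding avg_def by (simp add: Re_divide_of_nat Im_divide_of_nat)
    have "Im (\<Sum>a\<leftarrow>as. h (x + a)) = (\<Sum>a\<leftarrow>as. Im (h (x + a)))" by (induction as) auto
    then show "Im (avg as h x) = avg as (\<lambda>x. Im (h x)) x"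
      unfolding avg_def by (simp add: Re_divide_of_nat Im_divide_of_nat)
  qed
  have "continuous_on UNIV (\<lambda>x. Re (f x))" using cf by (intro continuous_intros)
  then obtain as where as: "as \<noteq> []" "\<And>x y. avg as (\<lambda>x. Re (f x)) x - avg as (\<lambda>x. Re (f x)) y \<le> \<epsilon>/2"
    using small_oscillation[of "\<lambda>x. Re (f x)" "\<epsilon>/2"] \<open>\<epsilon> > 0\<close> by auto
  define h where "h = avg as f"
  have ch: "continuous_on UNIV h" unfolding h_def by (rule continuous_on_avg[OF cf])
  have "continuous_on UNIV (\<lambda>x. Im (h x))" using ch by (intro continuous_intros)
  then obtain bs where bs: "bs \<noteq> []" "\<And>x y. avg bs (\<lambda>x. Im (h x)) x - avg bs (\<lambda>x. Im (h x)) y \<le> \<epsilon>/2"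
    using small_oscillation[of "\<lambda>x. Im (h x)" "\<epsilon>/2"] \<open>\<epsilon> > 0\<close> by auto
  \<comment> \<open>The real part is already settled before the second averaging: averaging over
    \<open>bs\<close> keeps it within \<open>\<epsilon>/2\<close> of the same constant, so
    \<open>Re (h 0)\<close> may be used unaveraged.\<close>
  define c where "c = Complex (Re (h 0)) (Im (avg bs h 0))"
  have "cmod (avg bs h x - c) \<le> \<epsilon>" for x
  proof -
    have "\<bar>Re (h x) - Re (h 0)\<bar> \<le> \<epsilon>/2" for x
      using as(2)[of x 0] as(2)[of 0 x] unfolding h_def Re by linarith
    then have "norm (avg bs (\<lambda>x. Re (h x)) x - Re (h 0)) \<le> \<epsilon>/2"
      by (intro avg_near bs) auto
    moreover have "\<bar>avg bs (\<lambda>x. Im (h x)) x - avg bs (\<lambda>x. Im (h x)) 0\<bar> \<le> \<epsilon>/2"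
      using bs(2)[of x 0] bs(2)[of 0 x] by linarith
    ultimately show ?thesis
      using cmod_le[of "avg bs h x - c"] by (simp add: c_def Re Im)
  qed
  moreover have "avg bs h = avg (concat (map (\<lambda>b. map (\<lambda>a. b + a) as) bs)) f"
    unfolding h_def by (rule avg_avg)
  moreover have "concat (map (\<lambda>b. map (\<lambda>a. b + a) as) bs) \<noteq> []"
    using as(1) bs(1) by (cases bs) auto
  ultimately show ?thesis by metis
qed

lemma lavg_near_ex:
  assumes cf: "continuous_on UNIV (f::'g \<Rightarrow> complex)" and "\<epsilon> > 0"
  shows "\<exists>as c. as \<noteq> [] \<and> (\<forall>x. cmod (lavg as f x - c) \<le> \<epsilon>)"
proof -
  have "continuous_on UNIV (\<lambda>x. f (- x))" by (rule continuous_on_UNIV_translate[OF cf])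
  from avg_near_ex[OF this \<open>\<epsilon> > 0\<close>] obtain as c where
    as: "as \<noteq> []" "\<And>x. cmod (avg as (\<lambda>x. f (- x)) x - c) \<le> \<epsilon>" by blast
  have "lavg (map uminus as) f x = avg as (\<lambda>x. f (- x)) (- x)" for x
    unfolding lavg_def avg_def by (simp add: o_def minus_add)
  then show ?thesis using as by (intro exI[of _ "map uminus as"] exI[of _ c]) auto
qed

text \<open>Left and right averages commute, so their almost constant values agree; hence the limit
  of the right averages is unique.\<close>

lemma avg_lavg_close:
  fixes f :: "'g \<Rightarrow> complex"
  assumes "as \<noteq> []" "\<And>x. cmod (avg as f x - c) \<le> \<epsilon>"
    and "bs \<noteq> []" "\<And>x. cmod (lavg bs f x - d) \<le> \<epsilon>'"
  shows "cmod (c - d) \<le> \<epsilon> + \<epsilon>'"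
proof -
  have "cmod (lavg bs (avg as f) 0 - c) \<le> \<epsilon>" by (intro lavg_near assms)
  moreover have "cmod (avg as (lavg bs f) 0 - d) \<le> \<epsilon>'" by (intro avg_near assms)
  ultimately show ?thesis
    unfolding avg_lavg using norm_triangle_ineq4[of "lavg bs (avg as f) 0 - d" "lavg bs (avg as f) 0 - c"] by simp
qed

lemma avg_tends_unique:
  fixes f :: "'g \<Rightarrow> complex"
  assumes cf: "continuous_on UNIV f" and "avg_tends f c" "avg_tends f d"
  shows "c = d"
proof -
  have "cmod (c - d) \<le> 0 + \<epsilon>" if "\<epsilon> > 0" for \<epsilon>
  proof -
    have e: "\<epsilon> / 4 > 0" using that by simp
    from lavg_near_ex[OF cf e] obtain ls l where
      l: "ls \<noteq> []" "\<And>x. cmod (lavg ls f x - l) \<le> \<epsilon>/4" by blast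
    obtain as where "as \<noteq> []" "\<And>x. cmod (avg as f x - c) \<le> \<epsilon>/4"
      using assms(2) e unfolding avg_tends_def by blast
    from avg_lavg_close[OF this l] have 1: "cmod (c - l) \<le> \<epsilon>/2" by simp
    obtain bs where "bs \<noteq> []" "\<And>x. cmod (avg bs f x - d) \<le> \<epsilon>/4"
      using assms(3) e unfolding avg_tends_def by blast
    from avg_lavg_close[OF this l] have 2: "cmod (d - l) \<le> \<epsilon>/2" by simp
    show ?thesis using 1 2 norm_triangle_ineq4[of "c - l" "d - l"] by simp
  qed
  then have "cmod (c - d) \<le> 0" by (rule field_le_epsilon)
  then show ?thesis by simp
qed

lemma avg_tends_ex:
  fixes f :: "'g \<Rightarrow> complex"
  assumes cf: "continuous_on UNIV f"
  shows "\<exists>c. avg_tends f c"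
proof -
  define e where "e n = inverse (real (Suc n))" for n
  have e: "e n > 0" for n by (simp add: e_def)
  have "\<forall>n. \<exists>p. fst p \<noteq> [] \<and> (\<forall>x. cmod (avg (fst p) f x - snd p) \<le> e n)"
    using avg_near_ex[OF cf e] by auto
  then obtain A where A: "\<And>n. fst (A n) \<noteq> []" "\<And>n x. cmod (avg (fst (A n)) f x - snd (A n)) \<le> e n"
    by metis
  \<comment> \<open>Two right averages are compared through one left average of arbitrary precision;
    its error \<open>\<epsilon>\<close> is then sent to zero.\<close>
  have close: "cmod (snd (A n) - snd (A m)) \<le> e n + e m + \<epsilon>" if "\<epsilon> > 0" for n m \<epsilon>
  proof -
    from lavg_near_ex[OF cf, of "\<epsilon>/2"] that obtain ls l where
      l: "ls \<noteq> []" "\<And>x. cmod (lavg ls f x - l) \<le> \<epsilon>/2" by auto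
    show ?thesis
      using avg_lavg_close[OF A(1) A(2)[of n] l] avg_lavg_close[OF A(1) A(2)[of m] l]
        norm_triangle_ineq4[of "snd (A n) - l" "snd (A m) - l"] by simp
  qed
  then have close: "cmod (snd (A n) - snd (A m)) \<le> e n + e m" for n m
    by (rule field_le_epsilon)
  have elim: "e \<longlonglongrightarrow> 0" unfolding e_def by (rule LIMSEQ_inverse_real_of_nat)
  have "Cauchy (\<lambda>n. snd (A n))"
  proof (rule metric_CauchyI)
    fix \<epsilon> :: real assume "\<epsilon> > 0"
    then obtain N where N: "\<And>n. n \<ge> N \<Longrightarrow> e n < \<epsilon>/2"
      using order_tendstoD(2)[OF elim, of "\<epsilon>/2"] unfolding eventually_sequentially by auto
    have "dist (snd (A m)) (snd (A n)) < \<epsilon>" if "m \<ge> N" "n \<ge> N" for m n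
      using close[of m n] N[OF that(1)] N[OF that(2)] unfolding dist_norm by linarith
    then show "\<exists>M. \<forall>m\<ge>M. \<forall>n\<ge>M. dist (snd (A m)) (snd (A n)) < \<epsilon>" by blast
  qed
  then obtain c where c: "(\<lambda>n. snd (A n)) \<longlonglongrightarrow> c"
    using Cauchy_convergent_iff convergent_def by blast
  have "avg_tends f c"
    unfolding avg_tends_def
  proof (intro allI impI)
    fix \<epsilon> :: real assume "\<epsilon> > 0"
    then have "\<forall>\<^sub>F n in sequentially. dist (snd (A n)) c < \<epsilon>/2" "\<forall>\<^sub>F n in sequentially. e n < \<epsilon>/2"
      using tendstoD[OF c, of "\<epsilon>/2"] order_tendstoD(2)[OF elim, of "\<epsilon>/2"] by auto
    then have "\<forall>\<^sub>F n in sequentially. dist (snd (A n)) c < \<epsilon>/2 \<and> e n < \<epsilon>/2"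
      by (rule eventually_conj)
    then obtain n where n: "dist (snd (A n)) c < \<epsilon>/2" "e n < \<epsilon>/2"
      using eventually_happens trivial_limit_sequentially by blast
    have "cmod (avg (fst (A n)) f x - c) \<le> \<epsilon>" for x
      using norm_triangle_ineq[of "avg (fst (A n)) f x - snd (A n)" "snd (A n) - c"] n A(2)[of n x]
      by (simp add: dist_norm)
    then show "\<exists>as. as \<noteq> [] \<and> (\<forall>x. cmod (avg as f x - c) \<le> \<epsilon>)" using A(1) by blast
  qed
  then show ?thesis ..
qed

lemma avg_tends_mean:
  assumes "continuous_on UNIV (f::'g \<Rightarrow> complex)"
  shows "avg_tends f (mean f)"
  unfolding mean_def using avg_tends_ex[OF assms] avg_tends_unique[OF assms] by (metis theI)

lemma mean_approx:
  assumes "continuous_on UNIV (f::'g \<Rightarrow> complex)" "\<epsilon> > 0"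
  obtains as where "as \<noteq> []" "\<And>x. cmod (avg as f x - mean f) \<le> \<epsilon>"
  using avg_tends_mean[OF assms(1)] assms(2) unfolding avg_tends_def by blast

lemma mean_eqI:
  assumes "continuous_on UNIV (f::'g \<Rightarrow> complex)"
    and "\<And>\<epsilon>. \<epsilon> > 0 \<Longrightarrow> \<exists>as. as \<noteq> [] \<and> (\<forall>x. cmod (avg as f x - c) \<le> \<epsilon>)"
  shows "mean f = c"
  using avg_tends_unique[OF assms(1) avg_tends_mean[OF assms(1)]] assms(2)
  unfolding avg_tends_def by blast

section \<open>Invariance, linearity and positivity of the mean\<close>

lemma mean_avg:
  assumes "continuous_on UNIV (f::'g \<Rightarrow> complex)" "as \<noteq> []"
  shows "mean (avg as f) = mean f"
proof (rule sym, rule mean_eqI[OF assms(1)])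
  fix \<epsilon> :: real assume "\<epsilon> > 0"
  then obtain bs where bs: "bs \<noteq> []" "\<And>x. cmod (avg bs (avg as f) x - mean (avg as f)) \<le> \<epsilon>"
    using mean_approx[OF continuous_on_avg[OF assms(1)], of \<epsilon>] by blast
  have "concat (map (\<lambda>b. map (\<lambda>a. b + a) as) bs) \<noteq> []"
    using assms(2) bs(1) by (cases bs) auto
  then show "\<exists>as'. as' \<noteq> [] \<and> (\<forall>x. cmod (avg as' f x - mean (avg as f)) \<le> \<epsilon>)"
    using bs(2) unfolding avg_avg by blast
qed

lemma mean_const [simp]: "mean (\<lambda>x::'g. c) = c"
  by (rule mean_eqI) (auto intro!: exI[of _ "[0]"] simp: avg_def)

lemma mean_right [simp]:
  assumes "continuous_on UNIV (f::'g \<Rightarrow> complex)"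
  shows "mean (\<lambda>x. f (x + a)) = mean f"
proof -
  have "(\<lambda>x. f (x + a)) = avg [a] f" by (auto simp: avg_def)
  then show ?thesis using mean_avg[OF assms, of "[a]"] by simp
qed

lemma mean_left:
  assumes "continuous_on UNIV (f::'g \<Rightarrow> complex)"
  shows "mean (\<lambda>x. f (a + x)) = mean f"
proof (rule mean_eqI)
  fix \<epsilon> :: real assume "\<epsilon> > 0"
  then obtain as where as: "as \<noteq> []" "\<And>x. cmod (avg as f x - mean f) \<le> \<epsilon>"
    using mean_approx[OF assms] by blast
  have "avg as (\<lambda>x. f (a + x)) x = avg as f (a + x)" for x
    by (simp add: avg_def add.assoc)
  then show "\<exists>as. as \<noteq> [] \<and> (\<forall>x. cmod (avg as (\<lambda>x. f (a + x)) x - mean f) \<le> \<epsilon>)"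
    using as by auto
qed (rule continuous_on_UNIV_translate[OF assms])

lemma mean_cmult:
  assumes "continuous_on UNIV (f::'g \<Rightarrow> complex)"
  shows "mean (\<lambda>x. c * f x) = c * mean f"
proof (rule mean_eqI)
  fix \<epsilon> :: real assume "\<epsilon> > 0"
  then have "\<epsilon> / (cmod c + 1) > 0" by (simp add: add_nonneg_pos)
  then obtain as where as: "as \<noteq> []" "\<And>x. cmod (avg as f x - mean f) \<le> \<epsilon> / (cmod c + 1)"
    using mean_approx[OF assms] by blast
  have "cmod (avg as (\<lambda>x. c * f x) x - c * mean f) \<le> \<epsilon>" for x
  proof -
    have "cmod (avg as (\<lambda>x. c * f x) x - c * mean f) = cmod c * cmod (avg as f x - mean f)"
      unfolding avg_cmult by (simp flip: right_diff_distrib add: norm_mult)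
    also have "\<dots> \<le> (cmod c + 1) * (\<epsilon> / (cmod c + 1))"
      using as(2) by (intro mult_mono) auto
    also have "\<dots> = \<epsilon>" by (simp add: add_nonneg_pos add_nonneg_eq_0_iff)
    finally show ?thesis .
  qed
  then show "\<exists>as. as \<noteq> [] \<and> (\<forall>x. cmod (avg as (\<lambda>x. c * f x) x - c * mean f) \<le> \<epsilon>)"
    using as(1) by blast
qed (use assms in \<open>intro continuous_intros\<close>)

lemma mean_add:
  assumes cf: "continuous_on UNIV (f::'g \<Rightarrow> complex)" and cg: "continuous_on UNIV g"
  shows "mean (\<lambda>x. f x + g x) = mean f + mean g"
proof (rule mean_eqI)
  fix \<epsilon> :: real assume "\<epsilon> > 0"
  then have e: "\<epsilon>/2 > 0" by simp
  obtain as where as: "as \<noteq> []" "\<And>x. cmod (avg as f x - mean f) \<le> \<epsilon>/2"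
    using mean_approx[OF cf e] by blast
  \<comment> \<open>Choosing \<open>bs\<close> for \<open>avg as g\<close> instead of
    \<open>g\<close> yields one composed list that serves both functions: averaging over
    \<open>bs\<close> does not spoil the bound already reached for \<open>f\<close>.\<close>
  obtain bs where bs: "bs \<noteq> []" "\<And>x. cmod (avg bs (avg as g) x - mean g) \<le> \<epsilon>/2"
    using mean_approx[OF continuous_on_avg[OF cg] e] mean_avg[OF cg as(1)] by metis
  have "concat (map (\<lambda>b. map (\<lambda>a. b + a) as) bs) \<noteq> []"
    using as(1) bs(1) by (cases bs) auto
  moreover have "cmod (avg bs (avg as (\<lambda>x. f x + g x)) x - (mean f + mean g)) \<le> \<epsilon>" for x
  proof -
    have "avg as (\<lambda>x. f x + g x) = (\<lambda>x. avg as f x + avg as g x)" by (simp add: avg_add fun_eq_iff)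
    then have "avg bs (avg as (\<lambda>x. f x + g x)) x - (mean f + mean g)
      = (avg bs (avg as f) x - mean f) + (avg bs (avg as g) x - mean g)"
      by (simp add: avg_add)
    also have "cmod \<dots> \<le> \<epsilon>/2 + \<epsilon>/2"
      by (rule order.trans[OF norm_triangle_ineq]) (intro add_mono avg_near as bs)
    finally show ?thesis by simp
  qed
  ultimately show "\<exists>as. as \<noteq> [] \<and> (\<forall>x. cmod (avg as (\<lambda>x. f x + g x) x - (mean f + mean g)) \<le> \<epsilon>)"
    unfolding avg_avg by blast
qed (use assms in \<open>intro continuous_intros\<close>)

text \<open>Inversion turns right averages into left averages, and these have the same almost
  constant values by \<open>avg_lavg_close\<close>.\<close>

lemma mean_neg:
  assumes cf: "continuous_on UNIV (f::'g \<Rightarrow> complex)"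
  shows "mean (\<lambda>x. f (- x)) = mean f"
proof -
  have cf': "continuous_on UNIV (\<lambda>x. f (- x))" by (rule continuous_on_UNIV_translate[OF cf])
  have "cmod (mean f - mean (\<lambda>x. f (- x))) \<le> 0 + \<epsilon>" if "\<epsilon> > 0" for \<epsilon>
  proof -
    obtain as where as: "as \<noteq> []" "\<And>x. cmod (avg as f x - mean f) \<le> \<epsilon>/2"
      using mean_approx[OF cf, of "\<epsilon>/2"] \<open>\<epsilon> > 0\<close> by auto
    obtain bs where bs: "bs \<noteq> []" "\<And>x. cmod (avg bs (\<lambda>x. f (- x)) x - mean (\<lambda>x. f (- x))) \<le> \<epsilon>/2"
      using mean_approx[OF cf', of "\<epsilon>/2"] \<open>\<epsilon> > 0\<close> by auto
    have "lavg (map uminus bs) f x = avg bs (\<lambda>x. f (- x)) (- x)" for x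
      unfolding lavg_def avg_def by (simp add: o_def minus_add)
    then show ?thesis
      using avg_lavg_close[OF as, of "map uminus bs" "mean (\<lambda>x. f (- x))" "\<epsilon>/2"] bs by simp
  qed
  then have "cmod (mean f - mean (\<lambda>x. f (- x))) \<le> 0" by (rule field_le_epsilon)
  then show ?thesis by simp
qed

lemma mean_cnj:
  assumes cf: "continuous_on UNIV (f::'g \<Rightarrow> complex)"
  shows "mean (\<lambda>x. cnj (f x)) = cnj (mean f)"
proof (rule mean_eqI)
  fix \<epsilon> :: real assume "\<epsilon> > 0"
  then obtain as where as: "as \<noteq> []" "\<And>x. cmod (avg as f x - mean f) \<le> \<epsilon>"
    using mean_approx[OF assms] by blast
  have "(\<Sum>a\<leftarrow>as. cnj (f (x + a))) = cnj (\<Sum>a\<leftarrow>as. f (x + a))" for x by (induction as) auto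
  then have "avg as (\<lambda>x. cnj (f x)) x - cnj (mean f) = cnj (avg as f x - mean f)" for x
    by (simp add: avg_def)
  then show "\<exists>as. as \<noteq> [] \<and> (\<forall>x. cmod (avg as (\<lambda>x. cnj (f x)) x - cnj (mean f)) \<le> \<epsilon>)"
    using as by (metis complex_mod_cnj)
qed (use assms in \<open>intro continuous_intros\<close>)

lemma mean_diff:
  assumes cf: "continuous_on UNIV (f::'g \<Rightarrow> complex)" and cg: "continuous_on UNIV g"
  shows "mean (\<lambda>x. f x - g x) = mean f - mean g"
  using mean_add[OF cf, of "\<lambda>x. (-1) * g x"] mean_cmult[OF cg, of "-1"] cg
  by (simp add: continuous_on_minus)

lemma mean_sum:
  assumes "\<And>i. i \<in> I \<Longrightarrow> continuous_on UNIV (f i::'g \<Rightarrow> complex)"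
  shows "mean (\<lambda>x. \<Sum>i\<in>I. f i x) = (\<Sum>i\<in>I. mean (f i))"
  using assms
proof (induction I rule: infinite_finite_induct)
  case (insert i I)
  then show ?case using mean_add[of "f i" "\<lambda>x. \<Sum>i\<in>I. f i x"]
    by (auto intro!: continuous_intros)
qed auto

lemma mean_sum_cmult:
  assumes "\<And>i. i \<in> I \<Longrightarrow> continuous_on UNIV (f i::'g \<Rightarrow> complex)"
  shows "mean (\<lambda>x. \<Sum>i\<in>I. c i * f i x) = (\<Sum>i\<in>I. c i * mean (f i))"
  by (subst mean_sum) (auto intro!: continuous_intros assms simp: mean_cmult[OF assms])

lemma mean_sum_multc:
  assumes "\<And>i. i \<in> I \<Longrightarrow> continuous_on UNIV (f i::'g \<Rightarrow> complex)"
  shows "mean (\<lambda>x. \<Sum>i\<in>I. f i x * c i) = (\<Sum>i\<in>I. mean (f i) * c i)"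
  using mean_sum_cmult[of I f c, OF assms] by (simp add: mult.commute)

lemma norm_mean_diff_le:
  assumes cf: "continuous_on UNIV (f::'g \<Rightarrow> complex)" and "\<And>x. cmod (f x - c) \<le> B"
  shows "cmod (mean f - c) \<le> B"
proof (rule field_le_epsilon)
  fix \<epsilon> :: real assume "\<epsilon> > 0"
  then obtain as where as: "as \<noteq> []" "\<And>x. cmod (avg as f x - mean f) \<le> \<epsilon>"
    using mean_approx[OF cf] by blast
  have "cmod (avg as f 0 - c) \<le> B" by (intro avg_near as assms)
  then show "cmod (mean f - c) \<le> B + \<epsilon>"
    using as(2)[of 0] norm_triangle_ineq4[of "avg as f 0 - c" "avg as f 0 - mean f"] by simp
qed

lemma norm_mean_le:
  assumes cf: "continuous_on UNIV (f::'g \<Rightarrow> complex)" and "\<And>x. cmod (f x) \<le> B"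
  shows "cmod (mean f) \<le> B"
  using norm_mean_diff_le[OF cf, of 0] assms(2) by simp

text \<open>Positivity follows from the norm bound alone: values in the interval from
  \<open>0\<close> to \<open>B\<close> lie in the disc of radius \<open>B\<close> about
  \<open>B\<close>, the mean stays in that disc, and the disc lies in the right half plane.\<close>

lemma mean_nonneg:
  assumes cf: "continuous_on UNIV (f::'g \<Rightarrow> real)" and "\<And>x. f x \<ge> 0"
  shows "Re (mean (\<lambda>x. of_real (f x))) \<ge> 0"
proof -
  obtain B where B: "\<And>x. \<bar>f x\<bar> \<le> B" using bounded_cont[OF cf] by auto
  have "\<bar>f x - B\<bar> \<le> B" for x using assms(2)[of x] B[of x] by (auto simp: abs_le_iff)
  then have "cmod (mean (\<lambda>x. of_real (f x)) - of_real B) \<le> B"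
    using cf by (intro norm_mean_diff_le continuous_intros) (auto simp flip: of_real_diff)
  then show ?thesis using abs_Re_le_cmod[of "mean (\<lambda>x. of_real (f x)) - of_real B"] by simp
qed

text \<open>If \<open>f\<close> exceeds \<open>c > 0\<close> on an open set, averaging over finitely
  many translates covering the group yields a function that is everywhere at least
  \<open>c / N\<close>, while averaging leaves the mean unchanged. This makes \<open>mean_ip\<close>
  definite.\<close>

lemma mean_zero_imp_zero:
  assumes cf: "continuous_on UNIV (f::'g \<Rightarrow> real)" and nn: "\<And>x. f x \<ge> 0"
    and m0: "mean (\<lambda>x. of_real (f x)) = 0"
  shows "f u = 0"
proof (rule ccontr)
  assume "f u \<noteq> 0"
  define c where "c = f u / 2"
  have c: "c > 0" using nn[of u] \<open>f u \<noteq> 0\<close> by (simp add: c_def)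
  have "open (f -` {c<..})" by (rule open_vimage[OF _ cf]) auto
  moreover have "u \<in> f -` {c<..}" using c by (simp add: c_def)
  ultimately obtain cs where "cs \<noteq> []" and cs: "\<And>x. \<exists>d\<in>set cs. x - d \<in> f -` {c<..}"
    using finite_translate_cover by metis
  define N where "N = real (length cs)"
  have N: "N > 0" using \<open>cs \<noteq> []\<close> by (simp add: N_def)
  define as where "as = map uminus cs"
  have ge: "avg as f x \<ge> c / N" for x
  proof -
    obtain d where d: "d \<in> set cs" "c < f (x - d)" using cs[of x] by auto
    have "(\<Sum>d\<leftarrow>cs. f (x - d)) = f (x - d) + (\<Sum>d\<leftarrow>remove1 d cs. f (x - d))"
      using d(1) by (rule sum_list_map_remove1)
    moreover have "0 \<le> (\<Sum>d\<leftarrow>remove1 d cs. f (x - d))" using nn by (intro sum_list_nonneg) auto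
    ultimately show ?thesis
      using d(2) N unfolding avg_def as_def by (simp add: o_def N_def[symmetric] divide_right_mono)
  qed
  have ca: "continuous_on UNIV (avg as f)" by (rule continuous_on_avg[OF cf])
  have avg_real: "(\<lambda>x. complex_of_real (avg as f x)) = avg as (\<lambda>x. of_real (f x))"
  proof
    fix x
    have "complex_of_real (\<Sum>a\<leftarrow>as. f (x + a)) = (\<Sum>a\<leftarrow>as. of_real (f (x + a)))"
      by (induction as) auto
    then show "complex_of_real (avg as f x) = avg as (\<lambda>x. of_real (f x)) x" by (simp add: avg_def)
  qed
  have "mean (\<lambda>x. of_real (avg as f x)) = 0"
    unfolding avg_real using mean_avg[of "\<lambda>x. of_real (f x)" as] m0 cf \<open>cs \<noteq> []\<close>
    by (auto simp: as_def intro!: continuous_intros)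
  moreover have "0 \<le> Re (mean (\<lambda>x. of_real (avg as f x - c / N)))"
    using ge by (intro mean_nonneg continuous_intros ca) auto
  moreover have "mean (\<lambda>x. of_real (avg as f x - c / N)) = mean (\<lambda>x. of_real (avg as f x)) - of_real (c / N)"
    unfolding of_real_diff
    by (subst mean_diff) (auto intro!: continuous_intros ca simp del: of_real_divide)
  ultimately show False using c N by (simp add: divide_le_0_iff del: of_real_divide)
qed

section \<open>Functions of two variables and the interchange of means\<close>

lemma uniform_param:
  fixes F :: "'g \<Rightarrow> 'g \<Rightarrow> complex"
  assumes "continuous_on UNIV (\<lambda>p. F (fst p) (snd p))" "\<epsilon> > 0"
  obtains \<delta> where "\<delta> > 0" "\<And>x x' y. dist x x' < \<delta> \<Longrightarrow> cmod (F x y - F x' y) < \<epsilon>"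
proof -
  have "compact (UNIV :: ('g \<times> 'g) set)"
    using compact_Times[OF compact_UNIV compact_UNIV] by simp
  then have "uniformly_continuous_on UNIV (\<lambda>p. F (fst p) (snd p))"
    using compact_uniformly_continuous assms(1) by blast
  then obtain \<delta> where "\<delta> > 0" and
    \<delta>: "\<And>p q. dist q p < \<delta> \<Longrightarrow> dist (F (fst q) (snd q)) (F (fst p) (snd p)) < \<epsilon>"
    using assms(2) unfolding uniformly_continuous_on_def by (metis UNIV_I)
  then show ?thesis
    using that[of \<delta>] \<delta>[of "(_, y)" "(_, y)" for y] by (simp add: dist_Pair_Pair dist_norm)
qed

lemma continuous_on_section:
  fixes F :: "'g \<Rightarrow> 'g \<Rightarrow> complex"
  assumes "continuous_on UNIV (\<lambda>p. F (fst p) (snd p))"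
  shows "continuous_on UNIV (F x)" "continuous_on UNIV (\<lambda>x. F x y)"
proof -
  have "continuous_on UNIV (\<lambda>y. F (fst (x, y)) (snd (x, y)))"
    by (rule continuous_on_compose2[OF assms, of UNIV "\<lambda>y. (x, y)"]) (intro continuous_intros subset_UNIV)+
  then show "continuous_on UNIV (F x)" by simp
  have "continuous_on UNIV (\<lambda>x. F (fst (x, y)) (snd (x, y)))"
    by (rule continuous_on_compose2[OF assms, of UNIV "\<lambda>x. (x, y)"]) (intro continuous_intros subset_UNIV)+
  then show "continuous_on UNIV (\<lambda>x. F x y)" by simp
qed

lemma continuous_on_mean:
  fixes F :: "'g \<Rightarrow> 'g \<Rightarrow> complex"
  assumes cF: "continuous_on UNIV (\<lambda>p. F (fst p) (snd p))"
  shows "continuous_on UNIV (\<lambda>x. mean (F x))"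
  unfolding continuous_on_iff
proof (intro ballI allI impI)
  fix x :: 'g and \<epsilon> :: real assume "\<epsilon> > 0"
  then obtain \<delta> where "\<delta> > 0" and \<delta>: "\<And>x x' y. dist x x' < \<delta> \<Longrightarrow> cmod (F x y - F x' y) < \<epsilon>/2"
    using uniform_param[OF cF, of "\<epsilon>/2"] by auto
  have "dist (mean (F x')) (mean (F x)) < \<epsilon>" if "dist x' x < \<delta>" for x'
  proof -
    have "cmod (mean (\<lambda>y. F x' y - F x y)) \<le> \<epsilon>/2"
      using \<delta>[OF that] by (intro norm_mean_le continuous_intros continuous_on_section[OF cF])
        (auto intro: less_imp_le)
    also have "mean (\<lambda>y. F x' y - F x y) = mean (F x') - mean (F x)"
      by (rule mean_diff; rule continuous_on_section[OF cF])
    finally show ?thesis using \<open>\<epsilon> > 0\<close> by (simp add: dist_norm)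
  qed
  then show "\<exists>d>0. \<forall>x'\<in>UNIV. dist x' x < d \<longrightarrow> dist (mean (F x')) (mean (F x)) < \<epsilon>"
    using \<open>\<delta> > 0\<close> by blast
qed

text \<open>The tents \<open>max 0 (\<delta> - dist x c)\<close> at the centres of a finite cover by
  balls have a positive sum, which normalises them.\<close>

lemma partition_of_unity:
  assumes "\<delta> > 0"
  obtains C :: "'g set" and \<phi> :: "'g \<Rightarrow> 'g \<Rightarrow> real" where "finite C"
    "\<And>c. continuous_on UNIV (\<phi> c)" "\<And>c x. \<phi> c x \<ge> 0" "\<And>c x. dist x c \<ge> \<delta> \<Longrightarrow> \<phi> c x = 0"
    "\<And>x. (\<Sum>c\<in>C. \<phi> c x) = 1"
proof -
  obtain C :: "'g set" where C: "finite C" "UNIV \<subseteq> (\<Union>c\<in>C. ball c \<delta>)"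
    by (rule compactE_image[OF compact_UNIV, of UNIV "\<lambda>c. ball c \<delta>"]) (use assms in auto)
  define \<psi> where "\<psi> c x = max 0 (\<delta> - dist x c)" for c x :: 'g
  have c\<psi>: "continuous_on UNIV (\<psi> c)" for c
    unfolding \<psi>_def by (intro continuous_intros)
  define s where "s x = (\<Sum>c\<in>C. \<psi> c x)" for x
  have "s x > 0" for x
  proof -
    obtain c where c: "c \<in> C" "dist c x < \<delta>"
      using C(2) by (metis UN_E UNIV_I mem_ball subsetD)
    then have "\<psi> c x > 0" by (simp add: \<psi>_def dist_commute)
    then show ?thesis unfolding s_def using C(1) c(1)
      by (intro sum_pos2[of C c]) (auto simp: \<psi>_def)
  qed
  note s = this
  show ?thesis
  proof (rule that[of C "\<lambda>c x. \<psi> c x / s x"])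
    show "continuous_on UNIV (\<lambda>x. \<psi> c x / s x)" for c
      using s unfolding s_def by (intro continuous_intros c\<psi>) (metis less_irrefl)
    show "\<psi> c x / s x \<ge> 0" for c x using s[of x] by (simp add: \<psi>_def less_imp_le)
    show "\<psi> c x / s x = 0" if "dist x c \<ge> \<delta>" for c x using that by (simp add: \<psi>_def)
    show "(\<Sum>c\<in>C. \<psi> c x / s x) = 1" for x
      using s[of x] by (simp flip: sum_divide_distrib add: s_def[symmetric])
  qed (use C in auto)
qed

text \<open>Both iterated means are continuous in \<open>F\<close> for the uniform norm and agree on finite sums of products.\<close>

lemma mean_swap:
  fixes F :: "'g \<Rightarrow> 'g \<Rightarrow> complex"
  assumes cF: "continuous_on UNIV (\<lambda>p. F (fst p) (snd p))"
  shows "mean (\<lambda>x. mean (\<lambda>y. F x y)) = mean (\<lambda>y. mean (\<lambda>x. F x y))"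
proof -
  have cF': "continuous_on UNIV (\<lambda>p. F (snd p) (fst p))"
    by (rule continuous_on_compose2[OF cF, of UNIV "\<lambda>p. (snd p, fst p)", simplified])
      (auto intro!: continuous_intros)
  have "cmod (mean (\<lambda>x. mean (\<lambda>y. F x y)) - mean (\<lambda>y. mean (\<lambda>x. F x y))) \<le> 0 + \<epsilon>"
    if "\<epsilon> > 0" for \<epsilon> :: real
  proof -
    obtain \<delta> where "\<delta> > 0" and \<delta>: "\<And>x x' y. dist x x' < \<delta> \<Longrightarrow> cmod (F x y - F x' y) < \<epsilon>/2"
      using uniform_param[OF cF, of "\<epsilon>/2"] \<open>\<epsilon> > 0\<close> by auto
    obtain C :: "'g set" and \<phi> :: "'g \<Rightarrow> 'g \<Rightarrow> real" where C: "finite C"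
      and c\<phi>: "\<And>c. continuous_on UNIV (\<phi> c)" and \<phi>0: "\<And>c x. \<phi> c x \<ge> 0"
      and \<phi>z: "\<And>c x. dist x c \<ge> \<delta> \<Longrightarrow> \<phi> c x = 0" and \<phi>1: "\<And>x. (\<Sum>c\<in>C. \<phi> c x) = 1"
      by (rule partition_of_unity[OF \<open>\<delta> > 0\<close>]) (rule that, assumption+)
    \<comment> \<open>The first argument of \<open>F\<close> is frozen at the centres and
      interpolated by the partition of unity. At every point the error is a convex combination of
      differences \<open>F x y - F c y\<close> with \<open>c\<close> within \<open>\<delta>\<close>
      of \<open>x\<close>.\<close>
    define H where "H x y = (\<Sum>c\<in>C. of_real (\<phi> c x) * F c y)" for x y
    have c1: "continuous_on UNIV (H x)" for x
      unfolding H_def by (intro continuous_intros continuous_on_section[OF cF])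
    have c2: "continuous_on UNIV (\<lambda>x. H x y)" for y
      unfolding H_def by (intro continuous_intros c\<phi>)
    have near: "cmod (F x y - H x y) \<le> \<epsilon>/2" for x y
    proof -
      have "F x y - H x y = (\<Sum>c\<in>C. of_real (\<phi> c x) * (F x y - F c y))"
        unfolding H_def right_diff_distrib sum_subtractf
        by (simp flip: sum_distrib_right of_real_sum add: \<phi>1)
      also have "cmod \<dots> \<le> (\<Sum>c\<in>C. \<phi> c x * (\<epsilon>/2))"
      proof (rule sum_norm_le)
        fix c assume "c \<in> C"
        show "cmod (of_real (\<phi> c x) * (F x y - F c y)) \<le> \<phi> c x * (\<epsilon>/2)"
        proof (cases "dist x c < \<delta>")
          case True
          then have "\<phi> c x * cmod (F x y - F c y) \<le> \<phi> c x * (\<epsilon>/2)"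
            using \<delta>[OF True, of y] \<phi>0[of c x] by (intro mult_left_mono) auto
          then show ?thesis using \<phi>0[of c x] by (simp add: norm_mult)
        qed (simp add: \<phi>z)
      qed
      also have "\<dots> = \<epsilon>/2" unfolding sum_distrib_right[symmetric] \<phi>1 by simp
      finally show ?thesis .
    qed
    have c\<phi>': "continuous_on UNIV (\<lambda>x. complex_of_real (\<phi> c x))" for c
      by (intro continuous_intros c\<phi>)
    note cF1 = continuous_on_section(1)[OF cF]
    have m1: "mean (H x) = (\<Sum>c\<in>C. of_real (\<phi> c x) * mean (F c))" for x
      unfolding H_def by (rule mean_sum_cmult[OF cF1])
    have m2: "mean (\<lambda>x. H x y) = (\<Sum>c\<in>C. mean (\<lambda>x. of_real (\<phi> c x)) * F c y)" for y
      unfolding H_def by (rule mean_sum_multc[OF c\<phi>'])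
    have swap: "mean (\<lambda>x. mean (H x)) = mean (\<lambda>y. mean (\<lambda>x. H x y))"
      unfolding m1 m2 by (simp only: mean_sum_multc[OF c\<phi>'] mean_sum_cmult[OF cF1])
    have "cmod (mean (\<lambda>x. mean (\<lambda>y. F x y) - mean (H x))) \<le> \<epsilon>/2"
    proof (rule norm_mean_le)
      show "continuous_on UNIV (\<lambda>x. mean (F x) - mean (H x))"
        unfolding m1 by (intro continuous_intros continuous_on_mean cF c\<phi>)
      show "cmod (mean (F x) - mean (H x)) \<le> \<epsilon>/2" for x
        using near norm_mean_le[of "\<lambda>y. F x y - H x y" "\<epsilon>/2"]
        by (simp add: mean_diff continuous_on_section[OF cF] c1 continuous_on_diff)
    qed
    moreover have "mean (\<lambda>x. mean (\<lambda>y. F x y) - mean (H x)) = mean (\<lambda>x. mean (F x)) - mean (\<lambda>x. mean (H x))"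
      by (rule mean_diff) (auto simp: m1 intro!: continuous_intros continuous_on_mean cF c\<phi>)
    moreover have "cmod (mean (\<lambda>y. mean (\<lambda>x. F x y) - mean (\<lambda>x. H x y))) \<le> \<epsilon>/2"
    proof (rule norm_mean_le)
      show "continuous_on UNIV (\<lambda>y. mean (\<lambda>x. F x y) - mean (\<lambda>x. H x y))"
        unfolding m2 by (intro continuous_intros continuous_on_mean cF' continuous_on_section[OF cF])
      show "cmod (mean (\<lambda>x. F x y) - mean (\<lambda>x. H x y)) \<le> \<epsilon>/2" for y
        using near norm_mean_le[of "\<lambda>x. F x y - H x y" "\<epsilon>/2"]
        by (simp add: mean_diff continuous_on_section[OF cF] c2 continuous_on_diff)
    qed
    moreover have "mean (\<lambda>y. mean (\<lambda>x. F x y) - mean (\<lambda>x. H x y))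
        = mean (\<lambda>y. mean (\<lambda>x. F x y)) - mean (\<lambda>y. mean (\<lambda>x. H x y))"
      by (rule mean_diff) (auto simp: m2 intro!: continuous_intros continuous_on_mean cF' continuous_on_section[OF cF])
    ultimately show ?thesis
      using swap norm_triangle_ineq4[of "mean (\<lambda>x. mean (F x)) - mean (\<lambda>x. mean (H x))"
          "mean (\<lambda>y. mean (\<lambda>x. F x y)) - mean (\<lambda>y. mean (\<lambda>x. H x y))"] by simp
  qed
  then have "cmod (mean (\<lambda>x. mean (\<lambda>y. F x y)) - mean (\<lambda>y. mean (\<lambda>x. F x y))) \<le> 0"
    by (rule field_le_epsilon)
  then show ?thesis by simp
qed

end

section \<open>Hermitian function spaces and unitary actions\<close>

text \<open>One interface for three settings: continuous functions under the mean, their eigenspaces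
  for convolution, and coordinate vectors with their invariant subspaces. Completeness is not
  assumed, so projections are taken onto finite orthonormal families.\<close>

locale herm_space =
  fixes X :: "('a \<Rightarrow> complex) set" and ip :: "('a \<Rightarrow> complex) \<Rightarrow> ('a \<Rightarrow> complex) \<Rightarrow> complex"
  assumes zero_closed: "(\<lambda>_. 0) \<in> X"
    and add_closed: "\<And>x y. x \<in> X \<Longrightarrow> y \<in> X \<Longrightarrow> (\<lambda>t. x t + y t) \<in> X"
    and scale_closed: "\<And>x c. x \<in> X \<Longrightarrow> (\<lambda>t. c * x t) \<in> X"
    and ip_add: "\<And>x y z. x \<in> X \<Longrightarrow> y \<in> X \<Longrightarrow> z \<in> X \<Longrightarrow> ip (\<lambda>t. x t + y t) z = ip x z + ip y z"
    and ip_scale: "\<And>x z c. x \<in> X \<Longrightarrow> z \<in> X \<Longrightarrow> ip (\<lambda>t. c * x t) z = c * ip x z"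
    and ip_cnj: "\<And>x y. x \<in> X \<Longrightarrow> y \<in> X \<Longrightarrow> ip y x = cnj (ip x y)"
    and ip_nonneg: "\<And>x. x \<in> X \<Longrightarrow> Re (ip x x) \<ge> 0"
    and ip_definite: "\<And>x. x \<in> X \<Longrightarrow> ip x x = 0 \<Longrightarrow> x = (\<lambda>_. 0)"
begin

lemma sum_closed:
  assumes "\<And>i. i \<in> I \<Longrightarrow> x i \<in> X"
  shows "(\<lambda>t. \<Sum>i\<in>I. x i t) \<in> X"
  using assms by (induction I rule: infinite_finite_induct) (auto intro: zero_closed add_closed)

lemma lincomb_closed:
  assumes "\<And>i. i \<in> I \<Longrightarrow> x i \<in> X"
  shows "(\<lambda>t. \<Sum>i\<in>I. c i * x i t) \<in> X"
  by (rule sum_closed) (intro scale_closed assms)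

lemma diff_closed: "x \<in> X \<Longrightarrow> y \<in> X \<Longrightarrow> (\<lambda>t. x t - y t) \<in> X"
  using add_closed[of x "\<lambda>t. (-1) * y t"] scale_closed[of y "-1"] by simp

lemma ip_zero_left: "z \<in> X \<Longrightarrow> ip (\<lambda>_. 0) z = 0"
  using ip_scale[OF zero_closed, of z 0] by simp

lemma ip_diff:
  assumes "x \<in> X" "y \<in> X" "z \<in> X"
  shows "ip (\<lambda>t. x t - y t) z = ip x z - ip y z"
  using ip_add[of x "\<lambda>t. (-1) * y t" z] ip_scale[of y z "-1"] scale_closed[of y "-1"] assms by simp

lemma ip_lincomb:
  assumes "\<And>i. i \<in> I \<Longrightarrow> x i \<in> X" "z \<in> X"
  shows "ip (\<lambda>t. \<Sum>i\<in>I. c i * x i t) z = (\<Sum>i\<in>I. c i * ip (x i) z)"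
  using assms(1)
proof (induction I rule: infinite_finite_induct)
  case (insert i I)
  have "ip (\<lambda>t. c i * x i t + (\<Sum>i\<in>I. c i * x i t)) z = ip (\<lambda>t. c i * x i t) z + ip (\<lambda>t. \<Sum>i\<in>I. c i * x i t) z"
    using insert.prems assms(2) by (intro ip_add scale_closed lincomb_closed) auto
  also have "\<dots> = c i * ip (x i) z + (\<Sum>i\<in>I. c i * ip (x i) z)"
    using insert assms(2) by (simp add: ip_scale)
  finally show ?case using insert.hyps by simp
qed (simp_all add: ip_zero_left assms(2))

lemma ip_lincomb_right:
  assumes "\<And>i. i \<in> I \<Longrightarrow> x i \<in> X" "z \<in> X"
  shows "ip z (\<lambda>t. \<Sum>i\<in>I. c i * x i t) = (\<Sum>i\<in>I. cnj (c i) * ip z (x i))"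
proof -
  have "ip z (\<lambda>t. \<Sum>i\<in>I. c i * x i t) = cnj (\<Sum>i\<in>I. c i * ip (x i) z)"
    using ip_cnj[OF lincomb_closed[of I x c] assms(2)] ip_lincomb[of I x z c] assms by simp
  also have "\<dots> = (\<Sum>i\<in>I. cnj (c i) * ip z (x i))"
    using assms by (auto intro!: sum.cong simp: ip_cnj[of "x _" z])
  finally show ?thesis .
qed

lemma ip_scale_right:
  assumes "x \<in> X" "z \<in> X"
  shows "ip z (\<lambda>t. c * x t) = cnj c * ip z x"
  using ip_lincomb_right[of "{0::nat}" "\<lambda>_. x" z "\<lambda>_. c"] assms by simp

lemma ip_diff_right:
  assumes "x \<in> X" "y \<in> X" "z \<in> X"
  shows "ip z (\<lambda>t. x t - y t) = ip z x - ip z y"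
  using ip_cnj[of "\<lambda>t. x t - y t" z] ip_diff[of x y z] diff_closed[of x y] ip_cnj[of x z] ip_cnj[of y z] assms
  by simp

lemma ip_self: "x \<in> X \<Longrightarrow> ip x x = of_real (Re (ip x x))"
  using ip_cnj[of x x] by (simp add: complex_eq_iff)

section \<open>Orthonormal families and projections\<close>

definition orthonormal :: "(nat \<Rightarrow> 'a \<Rightarrow> complex) \<Rightarrow> nat \<Rightarrow> bool" where
  "orthonormal e n \<longleftrightarrow> (\<forall>i<n. e i \<in> X) \<and> (\<forall>i<n. \<forall>j<n. ip (e i) (e j) = (if i = j then 1 else 0))"

definition proj :: "(nat \<Rightarrow> 'a \<Rightarrow> complex) \<Rightarrow> nat \<Rightarrow> ('a \<Rightarrow> complex) \<Rightarrow> 'a \<Rightarrow> complex" where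
  "proj e n x = (\<lambda>t. \<Sum>i<n. ip x (e i) * e i t)"

lemma orthonormal_closed: "orthonormal e n \<Longrightarrow> i < n \<Longrightarrow> e i \<in> X"
  by (simp add: orthonormal_def)

lemma orthonormal_ip: "orthonormal e n \<Longrightarrow> i < n \<Longrightarrow> j < n \<Longrightarrow> ip (e i) (e j) = (if i = j then 1 else 0)"
  by (simp add: orthonormal_def)

lemma proj_closed: "orthonormal e n \<Longrightarrow> proj e n x \<in> X"
  unfolding proj_def by (rule lincomb_closed) (simp add: orthonormal_def)

lemma ip_lincomb_orthonormal:
  assumes "orthonormal e n" "j < n"
  shows "ip (\<lambda>t. \<Sum>i<n. c i * e i t) (e j) = c j"
proof -
  have "ip (\<lambda>t. \<Sum>i<n. c i * e i t) (e j) = (\<Sum>i<n. c i * ip (e i) (e j))"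
    using assms by (intro ip_lincomb) (auto simp: orthonormal_def)
  also have "\<dots> = (\<Sum>i<n. if i = j then c i else 0)"
    using assms by (intro sum.cong) (auto simp: orthonormal_ip)
  finally show ?thesis using assms(2) by simp
qed

lemma ip_proj:
  assumes "orthonormal e n" "j < n"
  shows "ip (proj e n x) (e j) = ip x (e j)"
  unfolding proj_def by (rule ip_lincomb_orthonormal[OF assms])

lemma residual_orthogonal:
  assumes "orthonormal e n" "j < n" "x \<in> X"
  shows "ip (\<lambda>t. x t - proj e n x t) (e j) = 0"
  using ip_diff[OF assms(3) proj_closed[OF assms(1), of x] orthonormal_closed[OF assms(1,2)]]
    ip_proj[OF assms(1,2), of x] by simp

lemma ip_proj_self:
  assumes "orthonormal e n" "x \<in> X"
  shows "ip x (proj e n x) = of_real (\<Sum>i<n. (cmod (ip x (e i)))\<^sup>2)"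
  using assms unfolding proj_def
  by (subst ip_lincomb_right)
    (auto simp: orthonormal_def complex_norm_square mult.commute simp del: of_real_power intro!: sum.cong)

lemma bessel:
  assumes "orthonormal e n" "x \<in> X"
  shows "(\<Sum>i<n. (cmod (ip x (e i)))\<^sup>2) \<le> Re (ip x x)"
proof -
  let ?p = "proj e n x"
  have p: "?p \<in> X" using assms(1) by (rule proj_closed)
  define r where "r = (\<lambda>t. x t - ?p t)"
  have r: "r \<in> X" unfolding r_def by (rule diff_closed[OF assms(2) p])
  have "ip r ?p = (\<Sum>i<n. cnj (ip x (e i)) * ip r (e i))"
    unfolding proj_def using assms by (intro ip_lincomb_right r) (auto simp: orthonormal_def)
  also have "\<dots> = 0"
    unfolding r_def using residual_orthogonal[OF assms(1) _ assms(2)] by simp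
  finally have "ip r r = ip r x"
    using ip_diff_right[OF assms(2) p r] unfolding r_def by simp
  also have "\<dots> = ip x x - ip ?p x"
    unfolding r_def by (rule ip_diff[OF assms(2) p assms(2)])
  also have "ip ?p x = of_real (\<Sum>i<n. (cmod (ip x (e i)))\<^sup>2)"
    using ip_proj_self[OF assms] ip_cnj[OF assms(2) p] by simp
  finally show ?thesis using ip_nonneg[OF r] by simp
qed

lemma normalize:
  assumes "x \<in> X" "x \<noteq> (\<lambda>_. 0)"
  obtains b where "(cmod b)\<^sup>2 * Re (ip x x) = 1" "ip (\<lambda>t. b * x t) (\<lambda>t. b * x t) = 1"
proof -
  have "Re (ip x x) \<noteq> 0" using ip_definite[OF assms(1)] ip_self[OF assms(1)] assms(2) by force
  then have pos: "Re (ip x x) > 0" using ip_nonneg[OF assms(1)] by simp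
  define b where "b = complex_of_real (1 / sqrt (Re (ip x x)))"
  have b: "(cmod b)\<^sup>2 * Re (ip x x) = 1"
    using pos by (simp add: b_def norm_divide power_divide)
  have "ip (\<lambda>t. b * x t) (\<lambda>t. b * x t) = (b * cnj b) * ip x x"
    using assms(1) ip_scale[OF assms(1) scale_closed[OF assms(1)]] ip_scale_right[OF assms(1) assms(1)]
    by simp
  also have "\<dots> = of_real ((cmod b)\<^sup>2) * of_real (Re (ip x x))"
    using ip_self[OF assms(1)] by (simp add: complex_norm_square del: of_real_power)
  also have "\<dots> = 1" unfolding of_real_mult[symmetric] b by simp
  finally show ?thesis using b that by blast
qed

text \<open>Bessel's inequality for the one-element family made of the normalised
  \<open>y\<close>.\<close>

lemma cauchy_schwarz:
  assumes "x \<in> X" "y \<in> X"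
  shows "(cmod (ip x y))\<^sup>2 \<le> Re (ip x x) * Re (ip y y)"
proof (cases "y = (\<lambda>_. 0)")
  case True
  then show ?thesis
    using ip_zero_left[OF assms(1)] ip_cnj[OF zero_closed assms(1)] ip_zero_left[OF zero_closed] by simp
next
  case False
  then obtain b where b: "(cmod b)\<^sup>2 * Re (ip y y) = 1"
    and u: "ip (\<lambda>t. b * y t) (\<lambda>t. b * y t) = 1"
    using normalize[OF assms(2)] by blast
  have "orthonormal (\<lambda>_ t. b * y t) 1"
    unfolding orthonormal_def using u scale_closed[OF assms(2)] by auto
  from bessel[OF this assms(1)] have "(cmod (ip x (\<lambda>t. b * y t)))\<^sup>2 \<le> Re (ip x x)"
    by simp
  then have "(cmod b)\<^sup>2 * (cmod (ip x y))\<^sup>2 \<le> Re (ip x x)"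
    unfolding ip_scale_right[OF assms(2,1)] by (simp add: norm_mult power_mult_distrib)
  from mult_right_mono[OF this ip_nonneg[OF assms(2)]]
  have "((cmod b)\<^sup>2 * Re (ip y y)) * (cmod (ip x y))\<^sup>2 \<le> Re (ip x x) * Re (ip y y)"
    by (simp only: ac_simps)
  then show ?thesis unfolding b by simp
qed

text \<open>A Gram-Schmidt step: the normalised residual of \<open>x\<close> is the new
  member.\<close>

lemma orthonormal_extend:
  assumes "orthonormal e n" "x \<in> X" "x \<noteq> proj e n x"
  shows "\<exists>e'. orthonormal e' (Suc n)"
proof -
  define r where "r = (\<lambda>t. x t - proj e n x t)"
  have r: "r \<in> X" unfolding r_def by (intro diff_closed assms proj_closed)
  have "r \<noteq> (\<lambda>_. 0)" using assms(3) unfolding r_def fun_eq_iff by auto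
  then obtain b where u: "ip (\<lambda>t. b * r t) (\<lambda>t. b * r t) = 1"
    using normalize[OF r] by blast
  define f where "f = (\<lambda>t. b * r t)"
  have f: "f \<in> X" unfolding f_def by (rule scale_closed[OF r])
  have 1: "ip f (e j) = 0" if "j < n" for j
    using ip_scale[OF r orthonormal_closed[OF assms(1) that], of b] residual_orthogonal[OF assms(1) that assms(2)]
    unfolding f_def r_def by simp
  have 2: "ip (e j) f = 0" if "j < n" for j
    using 1[OF that] ip_cnj[OF f orthonormal_closed[OF assms(1) that]] by simp
  have "orthonormal (e(n := f)) (Suc n)"
    using assms(1) f 1 2 u unfolding orthonormal_def f_def[symmetric] by (auto simp: less_Suc_eq)
  then show ?thesis by blast
qed

text \<open>A bound on the length of orthonormal families plays the part of finite dimension: a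
  family of greatest length exists and, as it cannot be extended, it leaves no residual.\<close>

lemma orthonormal_basis_ex:
  assumes bound: "\<And>e n. orthonormal e n \<Longrightarrow> n \<le> N"
  obtains e n where "orthonormal e n" "\<And>x. x \<in> X \<Longrightarrow> proj e n x = x"
proof -
  define P where "P n \<longleftrightarrow> (\<exists>e. orthonormal e n)" for n
  have "P 0" unfolding P_def orthonormal_def by simp
  moreover have "\<forall>n. P n \<longrightarrow> n \<le> N" using bound unfolding P_def by blast
  ultimately have P: "P (Greatest P)" "\<And>n. P n \<Longrightarrow> n \<le> Greatest P"
    using GreatestI_nat[of P 0 N] Greatest_le_nat[of P _ N] by auto
  then obtain e where e: "orthonormal e (Greatest P)" unfolding P_def by blast
  have "proj e (Greatest P) x = x" if "x \<in> X" for x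
    using orthonormal_extend[OF e that] P(2)[of "Suc (Greatest P)"] unfolding P_def by fastforce
  then show ?thesis using that e by blast
qed

lemma subspace:
  assumes "Y \<subseteq> X" "(\<lambda>_. 0) \<in> Y" "\<And>x y. x \<in> Y \<Longrightarrow> y \<in> Y \<Longrightarrow> (\<lambda>t. x t + y t) \<in> Y"
    "\<And>x c. x \<in> Y \<Longrightarrow> (\<lambda>t. c * x t) \<in> Y"
  shows "herm_space Y ip"
proof -
  have sub: "x \<in> X" if "x \<in> Y" for x using assms(1) that by blast
  show ?thesis
    by unfold_locales
      (assumption | rule assms(2-4) ip_add ip_scale ip_cnj ip_nonneg ip_definite | rule sub)+
qed

end

section \<open>Matrices of unitary actions\<close>

definition matrix_rep :: "('a \<Rightarrow> 'a \<Rightarrow> complex) \<Rightarrow> ('g \<Rightarrow> 'a \<Rightarrow> 'a) \<Rightarrow> (nat \<Rightarrow> 'a) \<Rightarrow> nat \<Rightarrow> 'g mrep" where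
  "matrix_rep ip S e n = (n, \<lambda>g i j. if i < n \<and> j < n then ip (S g (e j)) (e i) else 0)"

lemma rep_dim_matrix_rep [simp]: "rep_dim (matrix_rep ip S e n) = n"
  by (simp add: matrix_rep_def rep_dim_def)

lemma rep_mat_matrix_rep:
  "rep_mat (matrix_rep ip S e n) g i j = (if i < n \<and> j < n then ip (S g (e j)) (e i) else 0)"
  by (simp add: matrix_rep_def rep_mat_def)

text \<open>Used twice: for left translation on an eigenspace of convolution, and for the
  restriction of a representation to an invariant subspace.\<close>

locale unitary_action = herm_space X ip
  for X :: "('a \<Rightarrow> complex) set" and ip +
  fixes S :: "'g::topological_group_add \<Rightarrow> ('a \<Rightarrow> complex) \<Rightarrow> ('a \<Rightarrow> complex)"
    and e :: "nat \<Rightarrow> 'a \<Rightarrow> complex" and n :: nat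
  assumes S_closed: "\<And>g x. x \<in> X \<Longrightarrow> S g x \<in> X"
    and S_lincomb: "\<And>g c. S g (\<lambda>t. \<Sum>i<n. c i * e i t) = (\<lambda>t. \<Sum>i<n. c i * S g (e i) t)"
    and S_add: "\<And>g h x. x \<in> X \<Longrightarrow> S (g + h) x = S g (S h x)"
    and S_zero: "\<And>x. x \<in> X \<Longrightarrow> S 0 x = x"
    and S_ip: "\<And>g x y. x \<in> X \<Longrightarrow> y \<in> X \<Longrightarrow> ip (S g x) (S g y) = ip x y"
    and S_cont: "\<And>x y. x \<in> X \<Longrightarrow> y \<in> X \<Longrightarrow> continuous_on UNIV (\<lambda>g. ip (S g x) y)"
    and basis: "orthonormal e n" "\<And>x. x \<in> X \<Longrightarrow> proj e n x = x"
begin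

lemma action_expand:
  assumes "j < n"
  shows "S g (e j) = (\<lambda>t. \<Sum>i<n. rep_mat (matrix_rep ip S e n) g i j * e i t)"
proof -
  have "S g (e j) = proj e n (S g (e j))"
    using basis(2)[OF S_closed] orthonormal_closed[OF basis(1) assms] by simp
  then show ?thesis using assms by (simp add: proj_def rep_mat_matrix_rep)
qed

lemma matrix_rep_neg:
  assumes "i < n" "j < n"
  shows "rep_mat (matrix_rep ip S e n) (- g) i j = cnj (rep_mat (matrix_rep ip S e n) g j i)"
proof -
  have e: "e i \<in> X" "e j \<in> X" using basis(1) assms by (auto simp: orthonormal_def)
  have "ip (S (- g) (e j)) (e i) = ip (S g (S (- g) (e j))) (S g (e i))"
    using e by (simp add: S_ip S_closed)
  also have "S g (S (- g) (e j)) = e j"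
    using S_add[OF e(2), of g "- g"] S_zero[OF e(2)] by simp
  also have "ip (e j) (S g (e i)) = cnj (ip (S g (e i)) (e j))"
    using e S_closed by (intro ip_cnj) auto
  finally show ?thesis using assms by (simp add: rep_mat_matrix_rep)
qed

lemma matrix_rep_add:
  assumes "i < n" "j < n"
  shows "rep_mat (matrix_rep ip S e n) (g + h) i j
    = (\<Sum>k<n. rep_mat (matrix_rep ip S e n) g i k * rep_mat (matrix_rep ip S e n) h k j)"
proof -
  let ?u = "rep_mat (matrix_rep ip S e n)"
  have e: "e k \<in> X" if "k < n" for k using basis(1) that by (auto simp: orthonormal_def)
  have "?u (g + h) i j = ip (S g (S h (e j))) (e i)"
    using assms e by (simp add: rep_mat_matrix_rep S_add)
  also have "\<dots> = ip (S g (\<lambda>t. \<Sum>k<n. ?u h k j * e k t)) (e i)"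
    unfolding action_expand[OF assms(2)] ..
  also have "\<dots> = ip (\<lambda>t. \<Sum>k<n. ?u h k j * S g (e k) t) (e i)"
    unfolding S_lincomb ..
  also have "\<dots> = (\<Sum>k<n. ?u h k j * ip (S g (e k)) (e i))"
    using assms e by (intro ip_lincomb S_closed) auto
  also have "\<dots> = (\<Sum>k<n. ?u g i k * ?u h k j)"
    using assms by (intro sum.cong) (auto simp: rep_mat_matrix_rep mult.commute)
  finally show ?thesis .
qed

lemma matrix_rep_zero: "i < n \<Longrightarrow> j < n \<Longrightarrow> rep_mat (matrix_rep ip S e n) 0 i j = (if i = j then 1 else 0)"
  using orthonormal_closed[OF basis(1)] orthonormal_ip[OF basis(1), of j i]
  by (simp add: rep_mat_matrix_rep S_zero)

lemma cont_unitary_matrix_rep: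
  assumes "n \<ge> 1"
  shows "cont_unitary_rep (matrix_rep ip S e n)"
proof -
  let ?u = "rep_mat (matrix_rep ip S e n)"
  have 1: "continuous_on UNIV (\<lambda>g. ?u g i j)" for i j
    using basis(1) by (cases "i < n \<and> j < n") (auto simp: rep_mat_matrix_rep orthonormal_def intro!: S_cont)
  \<comment> \<open>Both unitarity relations are multiplicativity at \<open>g + - g\<close> and
    \<open>- g + g\<close>, since the matrix of \<open>- g\<close> is the adjoint of that of
    \<open>g\<close>.\<close>
  have 2: "(\<Sum>k<n. ?u g i k * cnj (?u g j k)) = (if i = j then 1 else 0)" if "i < n" "j < n" for g i j
    using matrix_rep_add[of i j g "- g"] that by (simp add: matrix_rep_neg matrix_rep_zero)
  have 3: "(\<Sum>k<n. cnj (?u g k i) * ?u g k j) = (if i = j then 1 else 0)" if "i < n" "j < n" for g i j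
    using matrix_rep_add[of i j "- g" g] that by (simp add: matrix_rep_neg matrix_rep_zero)
  have 4: "?u g i j = 0" if "\<not> (i < n \<and> j < n)" for g i j
    unfolding rep_mat_matrix_rep if_not_P[OF that] ..
  show ?thesis
    unfolding cont_unitary_rep_def Let_def rep_dim_matrix_rep
    using assms 1 2 3 4 matrix_rep_add by blast
qed

end

text \<open>With \<open>\<rho>\<^sub>m = t (m + 1) / t m\<close> increasing, \<open>\<rho>\<^sub>m ^ i * t m \<le> t (m + i) \<le> t m * t i\<close>.\<close>

lemma moment_ratio:
  fixes t :: "nat \<Rightarrow> real"
  assumes pos: "\<And>n. n \<ge> 1 \<Longrightarrow> t n > 0"
    and logconv: "\<And>n. n \<ge> 1 \<Longrightarrow> (t (Suc n))\<^sup>2 \<le> t n * t (Suc (Suc n))"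
    and submult: "\<And>m n. m \<ge> 1 \<Longrightarrow> n \<ge> 1 \<Longrightarrow> t (m + n) \<le> t m * t n"
  obtains L where "L > 0" "\<And>n. n \<ge> 1 \<Longrightarrow> t (Suc n) \<le> L * t n" "\<And>n. n \<ge> 1 \<Longrightarrow> L ^ n \<le> t n"
proof -
  define \<rho> where "\<rho> n = t (Suc n) / t n" for n
  have \<rho>pos: "\<rho> n > 0" if "n \<ge> 1" for n using pos that by (simp add: \<rho>_def)
  have step: "\<rho> n \<le> \<rho> (Suc n)" if "n \<ge> 1" for n
    using logconv[OF that] pos[of n] pos[of "Suc n"] that
    by (simp add: \<rho>_def field_simps power2_eq_square)
  have mono: "\<rho> m \<le> \<rho> n" if "m \<ge> 1" "m \<le> n" for m n
    using that(2,1) by (induction rule: dec_induct) (auto intro: order.trans[OF _ step])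
  have geo: "\<rho> m ^ i * t m \<le> t (m + i)" if "m \<ge> 1" for m i
  proof (induction i)
    case (Suc i)
    have "\<rho> m ^ Suc i * t m = \<rho> m * (\<rho> m ^ i * t m)" by simp
    also have "\<dots> \<le> \<rho> (m + i) * t (m + i)"
      using Suc mono[of m "m + i"] \<rho>pos[of "m + i"] \<rho>pos[of m] pos[of m] that by (intro mult_mono) auto
    also have "\<dots> = t (m + Suc i)" using pos[of "m + i"] that by (simp add: \<rho>_def)
    finally show ?case .
  qed simp
  have key: "\<rho> m ^ i \<le> t i" if "m \<ge> 1" "i \<ge> 1" for m i
  proof -
    have "\<rho> m ^ i * t m \<le> t i * t m"
      using geo[OF that(1), of i] submult[OF that] by (simp add: mult.commute)
    then show ?thesis using pos[OF that(1)] by simp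
  qed
  \<comment> \<open>The limit of the increasing ratios. It is finite because \<open>key\<close> at
    exponent \<open>1\<close> bounds each ratio by \<open>t 1\<close>.\<close>
  define L where "L = Sup (\<rho> ` {1..})"
  have bdd: "bdd_above (\<rho> ` {1..})" using key[of _ 1] by (intro bdd_aboveI[of _ "t 1"]) auto
  have le: "\<rho> n \<le> L" if "n \<ge> 1" for n unfolding L_def using that bdd by (intro cSup_upper) auto
  have L0: "L > 0" using le[of 1] \<rho>pos[of 1] by simp
  show ?thesis
  proof (rule that[OF L0])
    fix n :: nat assume n: "n \<ge> 1"
    show "t (Suc n) \<le> L * t n" using le[OF n] pos[OF n] by (simp add: \<rho>_def pos_divide_le_eq)
    have "L \<le> root n (t n)"
      unfolding L_def
    proof (rule cSup_least)
      fix r assume "r \<in> \<rho> ` {1..}"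
      then obtain m where m: "m \<ge> 1" "r = \<rho> m" by auto
      have "r = root n (r ^ n)" using m n \<rho>pos[of m] by (simp add: real_root_power_cancel)
      also have "\<dots> \<le> root n (t n)" using key[OF m(1) n] m n by simp
      finally show "r \<le> root n (t n)" .
    qed auto
    then have "L ^ n \<le> root n (t n) ^ n" using L0 by (intro power_mono) auto
    then show "L ^ n \<le> t n" using n pos[OF n] by simp
  qed
qed

section \<open>Convolution and the Peter--Weyl theorem\<close>

definition mean_ip :: "('g::group_add \<Rightarrow> complex) \<Rightarrow> ('g \<Rightarrow> complex) \<Rightarrow> complex" where
  "mean_ip f g = mean (\<lambda>x. f x * cnj (g x))"

definition conv :: "('g::group_add \<Rightarrow> complex) \<Rightarrow> ('g \<Rightarrow> complex) \<Rightarrow> 'g \<Rightarrow> complex" where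
  "conv f g x = mean (\<lambda>y. f y * g (- y + x))"

text \<open>The involution of the convolution algebra: \<open>star k = k\<close> says that
  convolution by \<open>k\<close> is self-adjoint for \<open>mean_ip\<close>.\<close>

definition star :: "('g::group_add \<Rightarrow> complex) \<Rightarrow> 'g \<Rightarrow> complex" where
  "star f x = cnj (f (- x))"

definition chr :: "'g mrep \<Rightarrow> 'g \<Rightarrow> complex" where
  "chr r g = (\<Sum>i<rep_dim r. rep_mat r g i i)"

text \<open>\<open>convpow k n\<close> is the \<open>(n + 1)\<close>-fold convolution of
  \<open>k\<close>; the recursion starts at \<open>k\<close> because convolution has in general no
  continuous unit.\<close>

primrec convpow :: "('g::group_add \<Rightarrow> complex) \<Rightarrow> nat \<Rightarrow> 'g \<Rightarrow> complex" where
  "convpow k 0 = k"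
| "convpow k (Suc n) = conv k (convpow k n)"

context compact_metric_group
begin

lemma mean_mod_square:
  fixes f :: "'g \<Rightarrow> complex"
  shows "mean (\<lambda>x. f x * cnj (f x)) = mean (\<lambda>x. of_real ((cmod (f x))\<^sup>2))"
  unfolding complex_norm_square ..

sublocale cg: herm_space "{f::'g \<Rightarrow> complex. continuous_on UNIV f}" mean_ip
proof unfold_locales
  fix x y z :: "'g \<Rightarrow> complex" and c
  show "(\<lambda>_. 0) \<in> {f::'g \<Rightarrow> complex. continuous_on UNIV f}" by simp
  assume x: "x \<in> {f. continuous_on UNIV f}"
  then have cx: "continuous_on UNIV x" by simp
  show "(\<lambda>t. c * x t) \<in> {f. continuous_on UNIV f}"
    using cx by (auto intro!: continuous_intros)
  show "0 \<le> Re (mean_ip x x)"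
    unfolding mean_ip_def mean_mod_square
    by (rule mean_nonneg) (auto intro!: continuous_intros cx)
  show "x = (\<lambda>_. 0)" if "mean_ip x x = 0"
  proof
    fix t
    have "(cmod (x t))\<^sup>2 = 0"
      using that unfolding mean_ip_def mean_mod_square
      by (intro mean_zero_imp_zero[of "\<lambda>t. (cmod (x t))\<^sup>2"]) (auto intro!: continuous_intros cx)
    then show "x t = 0" by simp
  qed
  { assume "z \<in> {f. continuous_on UNIV f}"
    then have cz: "continuous_on UNIV z" by simp
    show "mean_ip (\<lambda>t. c * x t) z = c * mean_ip x z"
      unfolding mean_ip_def mult.assoc
      by (rule mean_cmult) (intro continuous_intros cx cz) }
  assume y: "y \<in> {f. continuous_on UNIV f}"
  then have cy: "continuous_on UNIV y" by simp
  show "(\<lambda>t. x t + y t) \<in> {f. continuous_on UNIV f}"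
    using cx cy by (auto intro!: continuous_intros)
  show "mean_ip y x = cnj (mean_ip x y)"
    unfolding mean_ip_def using mean_cnj[of "\<lambda>t. x t * cnj (y t)"] cx cy
    by (simp add: continuous_intros mult.commute)
  assume "z \<in> {f. continuous_on UNIV f}"
  then have cz: "continuous_on UNIV z" by simp
  show "mean_ip (\<lambda>t. x t + y t) z = mean_ip x z + mean_ip y z"
    unfolding mean_ip_def distrib_right
    by (rule mean_add) (intro continuous_intros cx cy cz)+
qed

section \<open>The convolution algebra of continuous functions\<close>

lemma continuous_on_conv_integrand:
  fixes f g :: "'g \<Rightarrow> complex"
  assumes "continuous_on UNIV f" "continuous_on UNIV g"
  shows "continuous_on UNIV (\<lambda>y. f y * g (- y + x))"
  by (intro continuous_intros assms continuous_on_compose2[OF assms(2)]) auto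

lemma continuous_on_conv:
  fixes f g :: "'g \<Rightarrow> complex"
  assumes "continuous_on UNIV f" "continuous_on UNIV g"
  shows "continuous_on UNIV (conv f g)"
proof -
  have "continuous_on UNIV (\<lambda>p::'g \<times> 'g. f (snd p) * g (- snd p + fst p))"
    by (intro continuous_intros continuous_on_compose2[OF assms(1)] continuous_on_compose2[OF assms(2)]) auto
  then show ?thesis unfolding conv_def by (rule continuous_on_mean)
qed

lemma continuous_on_star: "continuous_on UNIV f \<Longrightarrow> continuous_on UNIV (star (f :: 'g \<Rightarrow> complex))"
  unfolding star_def by (intro continuous_intros continuous_on_UNIV_translate(3))

text \<open>Interchange of the two means, then the left translation \<open>y \<mapsto> z + y\<close>
  in the inner one.\<close>

lemma conv_assoc:
  fixes f g h :: "'g \<Rightarrow> complex"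
  assumes f: "continuous_on UNIV f" and g: "continuous_on UNIV g" and h: "continuous_on UNIV h"
  shows "conv (conv f g) h = conv f (conv g h)"
proof
  fix x
  have gh: "continuous_on UNIV (\<lambda>y. g (- z + y) * h (- y + x))" for z
    by (intro continuous_intros continuous_on_compose2[OF g] continuous_on_compose2[OF h]) auto
  have "conv (conv f g) h x = mean (\<lambda>y. mean (\<lambda>z. h (- y + x) * (f z * g (- z + y))))"
    unfolding conv_def by (subst mean_cmult[OF continuous_on_conv_integrand[OF f g]]) (simp add: mult.commute)
  also have "\<dots> = mean (\<lambda>z. mean (\<lambda>y. h (- y + x) * (f z * g (- z + y))))"
    by (rule mean_swap, intro continuous_intros continuous_on_compose2[OF f]
        continuous_on_compose2[OF g] continuous_on_compose2[OF h]) auto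
  also have "\<dots> = mean (\<lambda>z. mean (\<lambda>y. f z * (g (- z + y) * h (- y + x))))"
    by (simp add: ac_simps)
  also have "\<dots> = mean (\<lambda>z. f z * mean (\<lambda>y. g (- z + y) * h (- y + x)))"
    by (simp add: mean_cmult[OF gh])
  also have "\<dots> = mean (\<lambda>z. f z * conv g h (- z + x))"
  proof -
    have "mean (\<lambda>y. g (- z + y) * h (- y + x)) = conv g h (- z + x)" for z
      unfolding conv_def using mean_left[OF gh, of z z]
      by (simp add: minus_add add.assoc diff_conv_add_uminus del: add_uminus_conv_diff)
    then show ?thesis by simp
  qed
  finally show "conv (conv f g) h x = conv f (conv g h) x" unfolding conv_def[of f] .
qed

lemma conv_diff_left:
  fixes f f' g :: "'g \<Rightarrow> complex"
  assumes "continuous_on UNIV f" "continuous_on UNIV f'" "continuous_on UNIV g"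
  shows "conv (\<lambda>x. f x - f' x) g x = conv f g x - conv f' g x"
  unfolding conv_def left_diff_distrib by (intro mean_diff continuous_on_conv_integrand assms)

lemma conv_diff_right:
  fixes f g g' :: "'g \<Rightarrow> complex"
  assumes "continuous_on UNIV f" "continuous_on UNIV g" "continuous_on UNIV g'"
  shows "conv f (\<lambda>x. g x - g' x) x = conv f g x - conv f g' x"
  unfolding conv_def right_diff_distrib by (intro mean_diff continuous_on_conv_integrand assms)

lemma conv_add_left:
  fixes f f' g :: "'g \<Rightarrow> complex"
  assumes "continuous_on UNIV f" "continuous_on UNIV f'" "continuous_on UNIV g"
  shows "conv (\<lambda>x. f x + f' x) g x = conv f g x + conv f' g x"
  unfolding conv_def distrib_right by (intro mean_add continuous_on_conv_integrand assms)

lemma conv_cmult_left: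
  fixes f g :: "'g \<Rightarrow> complex"
  assumes "continuous_on UNIV f" "continuous_on UNIV g"
  shows "conv (\<lambda>x. c * f x) g x = c * conv f g x"
  unfolding conv_def mult.assoc by (intro mean_cmult continuous_on_conv_integrand assms)

lemma conv_cmult_right:
  fixes f g :: "'g \<Rightarrow> complex"
  assumes "continuous_on UNIV f" "continuous_on UNIV g"
  shows "conv f (\<lambda>x. c * g x) x = c * conv f g x"
  unfolding conv_def using mean_cmult[OF continuous_on_conv_integrand[OF assms, of x], of c]
  by (simp add: ac_simps)

text \<open>Left translations commute with right convolution, so they preserve its eigenspaces; this
  is where representations will come from.\<close>

lemma conv_translate:
  fixes f g :: "'g \<Rightarrow> complex"
  assumes "continuous_on UNIV f" "continuous_on UNIV g"
  shows "conv (\<lambda>x. f (a + x)) g x = conv f g (a + x)"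
  unfolding conv_def using mean_left[OF continuous_on_conv_integrand[OF assms, of "a + x"], of a]
  by (simp add: minus_add add.assoc diff_conv_add_uminus del: add_uminus_conv_diff)

lemma star_star [simp]: "star (star f) = f"
  by (simp add: star_def fun_eq_iff)

lemma star_conv:
  fixes f g :: "'g \<Rightarrow> complex"
  assumes f: "continuous_on UNIV f" and g: "continuous_on UNIV g"
  shows "star (conv f g) = conv (star g) (star f)"
proof
  fix x
  have "star (conv f g) x = mean (\<lambda>y. cnj (f y * g (- y + - x)))"
    unfolding star_def conv_def by (rule mean_cnj[symmetric]) (rule continuous_on_conv_integrand[OF f g])
  also have "\<dots> = mean (\<lambda>y. star g (x + y) * star f (- (x + y) + x))"
    by (simp add: star_def minus_add mult.commute flip: add.assoc)
  also have "\<dots> = conv (star g) (star f) x"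
    unfolding conv_def
    by (rule mean_left[of "\<lambda>y. star g y * star f (- y + x)"])
      (intro continuous_on_conv_integrand continuous_on_star f g)
  finally show "star (conv f g) x = conv (star g) (star f) x" .
qed

lemma conv_at_zero: "conv f g (0::'g) = mean_ip f (star g)"
  by (simp add: conv_def mean_ip_def star_def)

lemma mean_ip_reflect:
  fixes g :: "'g \<Rightarrow> complex"
  assumes g: "continuous_on UNIV g"
  shows "mean_ip (\<lambda>y. cnj (g (- y + x))) (\<lambda>y. cnj (g (- y + x))) = mean_ip g g"
proof -
  have c: "continuous_on UNIV (\<lambda>y. g y * cnj (g y))" by (intro continuous_intros g)
  have "mean (\<lambda>y. g (- y + x) * cnj (g (- y + x))) = mean (\<lambda>y. g (y + x) * cnj (g (y + x)))"
    by (rule mean_neg[of "\<lambda>y. g (y + x) * cnj (g (y + x))"])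
      (rule continuous_on_UNIV_translate(1)[OF c])
  also have "\<dots> = mean_ip g g" unfolding mean_ip_def by (rule mean_right[OF c])
  finally show ?thesis by (simp add: mean_ip_def mult.commute)
qed

text \<open>Cauchy-Schwarz at each point, with the invariance of the mean under inversion and
  translation. The bound does not depend on \<open>x\<close>, which is how convergence in quadratic
  mean becomes uniform after one convolution.\<close>

lemma norm_conv_le:
  fixes f g :: "'g \<Rightarrow> complex"
  assumes f: "continuous_on UNIV f" and g: "continuous_on UNIV g"
  shows "(cmod (conv f g x))\<^sup>2 \<le> Re (mean_ip f f) * Re (mean_ip g g)"
proof -
  define h where "h y = cnj (g (- y + x))" for y
  have h: "continuous_on UNIV h"
    unfolding h_def by (intro continuous_intros continuous_on_compose2[OF g]) auto
  have "conv f g x = mean_ip f h" by (simp add: conv_def mean_ip_def h_def)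
  moreover have "mean_ip h h = mean_ip g g" unfolding h_def by (rule mean_ip_reflect[OF g])
  ultimately show ?thesis using cg.cauchy_schwarz[of f h] f h by simp
qed

lemma mean_ip_self_le:
  fixes f :: "'g \<Rightarrow> complex"
  assumes f: "continuous_on UNIV f" and "\<And>x. (cmod (f x))\<^sup>2 \<le> B"
  shows "Re (mean_ip f f) \<le> B"
proof -
  have "cmod (mean_ip f f) \<le> B"
    unfolding mean_ip_def mean_mod_square
    by (intro norm_mean_le continuous_intros f) (use assms(2) in \<open>simp add: norm_power\<close>)
  then show ?thesis using complex_Re_le_cmod order.trans by blast
qed

lemma mean_ip_conv_le:
  fixes f g :: "'g \<Rightarrow> complex"
  assumes "continuous_on UNIV f" "continuous_on UNIV g"
  shows "Re (mean_ip (conv f g) (conv f g)) \<le> Re (mean_ip f f) * Re (mean_ip g g)"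
  by (intro mean_ip_self_le continuous_on_conv norm_conv_le assms)

section \<open>Iterated convolutions and the top eigenfunction\<close>

lemma continuous_on_convpow:
  "continuous_on UNIV (k :: 'g \<Rightarrow> complex) \<Longrightarrow> continuous_on UNIV (convpow k n)"
  by (induction n) (auto intro: continuous_on_conv)

lemma conv_convpow:
  assumes k: "continuous_on UNIV (k :: 'g \<Rightarrow> complex)"
  shows "conv (convpow k m) (convpow k n) = convpow k (Suc (m + n))"
  by (induction m) (auto simp: conv_assoc k continuous_on_convpow)

lemma star_convpow:
  assumes k: "continuous_on UNIV (k :: 'g \<Rightarrow> complex)" and "star k = k"
  shows "star (convpow k n) = convpow k n"
proof (induction n)
  case (Suc n)
  then show ?case
    using conv_convpow[OF k, of n 0] assms by (simp add: star_conv continuous_on_convpow)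
qed (use assms in simp)

text \<open>For self-adjoint \<open>k\<close> inner products of powers are values at
  \<open>0\<close> of higher powers: the \<open>m + 1\<close> and \<open>n + 1\<close> factors add
  up to \<open>m + n + 2\<close>, which has index \<open>Suc (m + n)\<close>. All quadratic means of
  powers thus reduce to one sequence of moments.\<close>

lemma mean_ip_convpow:
  assumes "continuous_on UNIV (k :: 'g \<Rightarrow> complex)" "star k = k"
  shows "mean_ip (convpow k m) (convpow k n) = convpow k (Suc (m + n)) 0"
  using conv_at_zero[of "convpow k m" "convpow k n"] by (simp add: star_convpow conv_convpow assms)

text \<open>The normalised powers \<open>(k * k)\<^sup>n / L\<^sup>n\<close>, with \<open>L\<close> the growth rate of the moments
  \<open>(k * k)\<^sup>n(0)\<close>, converge to the kernel of the orthogonal projection onto the top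
  eigenspace. The limit is nonzero because the moments are submultiplicative, hence at
  least \<open>L\<^sup>n\<close>; this replaces the compactness of the convolution operator.\<close>

lemma top_eigenfunction:
  fixes k :: "'g \<Rightarrow> complex"
  assumes k: "continuous_on UNIV k" and sk: "star k = k" and k0: "k \<noteq> (\<lambda>_. 0)"
  obtains L p where "L > 0" "continuous_on UNIV p" "p 0 \<noteq> 0"
    "conv (conv k k) p = (\<lambda>x. complex_of_real L * p x)"
    "conv p (conv k k) = (\<lambda>x. complex_of_real L * p x)"
proof -
  note cp = continuous_on_convpow[OF k]
  \<comment> \<open>For \<open>n \<ge> 1\<close> this is the moment of the \<open>2 * n\<close>-fold
    convolution, that is of the \<open>n\<close>-th power of \<open>conv k k\<close>; the index is
    one lower because \<open>convpow\<close> starts at a single factor.\<close>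
  define t where "t n = Re (convpow k (2 * n - 1) 0)" for n
  have tN: "t n = Re (mean_ip (convpow k (n - 1)) (convpow k (n - 1)))" if "n \<ge> 1" for n
  proof -
    have i: "Suc ((n - 1) + (n - 1)) = 2 * n - 1" using that by simp
    show ?thesis by (simp only: mean_ip_convpow[OF k sk] t_def i)
  qed
  have tnn: "t n \<ge> 0" if "n \<ge> 1" for n
    unfolding tN[OF that] by (rule cg.ip_nonneg) (simp add: cp)
  have N0: "Re (mean_ip f f) > 0" if "continuous_on UNIV f" "f x \<noteq> 0" for f :: "'g \<Rightarrow> complex" and x
    using cg.ip_nonneg[of f] cg.ip_definite[of f] cg.ip_self[of f] that
    by (cases "Re (mean_ip f f) = 0") force+
  have logconv: "(t (Suc n))\<^sup>2 \<le> t n * t (Suc (Suc n))" if "n \<ge> 1" for n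
  proof -
    have i: "Suc ((n - 1) + (n + 1)) = 2 * Suc n - 1" using that by simp
    have "(t (Suc n))\<^sup>2 = (Re (mean_ip (convpow k (n - 1)) (convpow k (n + 1))))\<^sup>2"
      unfolding mean_ip_convpow[OF k sk] i t_def ..
    also have "\<dots> \<le> (cmod (mean_ip (convpow k (n - 1)) (convpow k (n + 1))))\<^sup>2"
      using abs_Re_le_cmod by (metis abs_le_square_iff abs_norm_cancel)
    also have "\<dots> \<le> Re (mean_ip (convpow k (n - 1)) (convpow k (n - 1)))
        * Re (mean_ip (convpow k (n + 1)) (convpow k (n + 1)))"
      by (rule cg.cauchy_schwarz) (simp_all only: mem_Collect_eq cp)
    also have "\<dots> = t n * t (Suc (Suc n))" using tN[OF that] tN[of "Suc (Suc n)"] by simp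
    finally show ?thesis .
  qed
  \<comment> \<open>Two consecutive moments are carried along because log-convexity gives the
    positivity of \<open>t (Suc (Suc n))\<close> from that of \<open>t n\<close> and
    \<open>t (Suc n)\<close>. The start uses
    \<open>convpow k 1 0 = conv k k 0 \<noteq> 0\<close>.\<close>
  have pos2: "t n > 0 \<and> t (Suc n) > 0" if "n \<ge> 1" for n
    using that
  proof (induction n rule: dec_induct)
    case base
    obtain x where x: "k x \<noteq> 0" using k0 by auto
    have 1: "t 1 > 0" using tN[of 1] N0[OF k x] by simp
    have "convpow k 1 0 \<noteq> 0" using 1 unfolding t_def by auto
    then have "t 2 > 0" using tN[of 2] N0[OF cp, of 1 0] by simp
    with 1 show ?case by (simp add: numeral_2_eq_2)
  next
    case (step n)
    then have "0 < (t (Suc n))\<^sup>2" by simp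
    also have "\<dots> \<le> t n * t (Suc (Suc n))" using step by (intro logconv) simp
    finally show ?case using step by (simp add: zero_less_mult_iff)
  qed
  then have pos: "t n > 0" if "n \<ge> 1" for n using that by blast
  have submult: "t (m + n) \<le> t m * t n" if "m \<ge> 1" "n \<ge> 1" for m n
  proof -
    have i: "Suc ((m - 1) + (n - 1)) = m + n - 1" using that by simp
    then have "convpow k (m + n - 1) = conv (convpow k (m - 1)) (convpow k (n - 1))"
      by (simp only: conv_convpow[OF k] i)
    then show ?thesis
      using mean_ip_conv_le[OF cp cp, of "m - 1" "n - 1"] tN that by simp
  qed
  obtain L where L: "L > 0" "\<And>n. n \<ge> 1 \<Longrightarrow> t (Suc n) \<le> L * t n" "\<And>n. n \<ge> 1 \<Longrightarrow> L ^ n \<le> t n"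
    using moment_ratio[of t] pos logconv submult by blast
  \<comment> \<open>The normalised moments decrease, since \<open>L\<close> bounds all ratios, and
    stay above \<open>1\<close>, since \<open>L ^ n \<le> t n\<close>. Hence they converge, and not
    to zero.\<close>
  define b where "b n = t n / L ^ n" for n
  have b1: "b n \<ge> 1" if "n \<ge> 1" for n using L(1,3) that by (simp add: b_def)
  have bdec: "b (Suc (Suc n)) \<le> b (Suc n)" for n
    using L(1) L(2)[of "Suc n"] by (simp add: b_def field_simps)
  have "decseq (\<lambda>n. b (Suc n))" by (intro decseq_SucI bdec)
  then obtain \<beta> where b_lim: "(\<lambda>n. b (Suc n)) \<longlonglongrightarrow> \<beta>" and b_ge: "\<And>n. \<beta> \<le> b (Suc n)"
    using decseq_convergent[of "\<lambda>n. b (Suc n)" 1] b1 by auto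
  \<comment> \<open>The power \<open>n + 1\<close> of \<open>conv k k\<close>, divided by
    \<open>L ^ Suc n\<close>; it has \<open>2 * n + 2\<close> factors, hence the index
    \<open>2 * n + 1\<close>.\<close>
  define q where "q n x = complex_of_real (1 / L ^ Suc n) * convpow k (2 * n + 1) x" for n x
  have cq: "continuous_on UNIV (q n)" for n
    unfolding q_def by (intro continuous_intros cp)
  have real0: "convpow k (2 * n + 1) 0 = of_real (t (Suc n))" for n
    using mean_ip_convpow[OF k sk, of n n] cg.ip_self[of "convpow k n"] cp
    unfolding t_def by (simp add: mult_2)
  have ipq: "mean_ip (q m) (q n) = of_real (b (Suc (Suc (m + n))))" for m n
  proof -
    have "mean_ip (q m) (q n) = of_real (1 / L ^ Suc m) * (of_real (1 / L ^ Suc n) *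
        mean_ip (convpow k (2 * m + 1)) (convpow k (2 * n + 1)))"
      unfolding q_def using cp cg.ip_scale[of "convpow k (2 * m + 1)" "\<lambda>x. complex_of_real (1 / L ^ Suc n) * convpow k (2 * n + 1) x"]
        cg.ip_scale_right[of "convpow k (2 * n + 1)" "convpow k (2 * m + 1)"] cg.scale_closed
      by (simp only: mem_Collect_eq complex_cnj_complex_of_real)
    also have "mean_ip (convpow k (2 * m + 1)) (convpow k (2 * n + 1)) = convpow k (2 * (m + n + 1) + 1) 0"
      unfolding mean_ip_convpow[OF k sk] by (simp add: algebra_simps)
    also have "\<dots> = of_real (t (Suc (Suc (m + n))))" unfolding real0 by simp
    also have "of_real (1 / L ^ Suc m) * (of_real (1 / L ^ Suc n) * complex_of_real (t (Suc (Suc (m + n)))))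
        = of_real (b (Suc (Suc (m + n))))"
      unfolding of_real_mult[symmetric] b_def by (simp add: power_add)
    finally show ?thesis .
  qed
  \<comment> \<open>Inner products of the \<open>q\<close> depend only on the sum of the indices, so
    convergence of \<open>b\<close> alone makes \<open>q\<close> Cauchy in quadratic mean: the three
    limits cancel as \<open>1 + 1 - 2\<close>.\<close>
  have ipq_diff: "Re (mean_ip (\<lambda>x. q m x - q n x) (\<lambda>x. q m x - q n x))
      = b (Suc (Suc (m + m))) + b (Suc (Suc (n + n))) - 2 * b (Suc (Suc (m + n)))" for m n
  proof -
    have "mean_ip (\<lambda>x. q m x - q n x) (\<lambda>x. q m x - q n x)
       = (mean_ip (q m) (q m) - mean_ip (q m) (q n)) - (mean_ip (q n) (q m) - mean_ip (q n) (q n))"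
      using cq cg.diff_closed[of "q m" "q n"]
      by (simp add: cg.ip_diff cg.ip_diff_right)
    then show ?thesis by (simp add: ipq add.commute[of n m])
  qed
  define kk where "kk = conv k k"
  have kk_pow: "kk = convpow k 1" by (simp add: kk_def)
  have ckk: "continuous_on UNIV kk" unfolding kk_pow by (rule cp)
  have kkq: "conv kk (q n) = (\<lambda>x. complex_of_real L * q (Suc n) x)"
    and qkk: "conv (q n) kk = (\<lambda>x. complex_of_real L * q (Suc n) x)" for n
    unfolding q_def fun_eq_iff kk_pow using L(1)
    by (simp_all only: conv_cmult_left conv_cmult_right conv_convpow[OF k] cp) (simp_all add: eval_nat_numeral)
  define M where "M = Re (mean_ip kk kk)"
  have M: "M \<ge> 0" unfolding M_def by (rule cg.ip_nonneg) (simp add: ckk)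
  have "uniformly_Cauchy_on UNIV (\<lambda>n. q (Suc n))"
    unfolding uniformly_Cauchy_on_def
  proof (intro allI impI)
    fix \<epsilon> :: real assume "\<epsilon> > 0"
    \<comment> \<open>Chosen so that
      \<open>(M + 1) * (2 * \<eta>) = (L * \<epsilon>)\<^sup>2\<close>; the summand \<open>1\<close>
      keeps the denominator positive and makes the final inequality strict.\<close>
    define \<eta> where "\<eta> = (L * \<epsilon>)\<^sup>2 / (2 * (M + 1))"
    have \<eta>: "\<eta> > 0" using M L(1) \<open>\<epsilon> > 0\<close> by (simp add: \<eta>_def)
    obtain N where N: "\<And>n. n \<ge> N \<Longrightarrow> b (Suc n) < \<beta> + \<eta>"
      using order_tendstoD(2)[OF b_lim, of "\<beta> + \<eta>"] \<eta> unfolding eventually_sequentially by auto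
    have "dist (q (Suc m) x) (q (Suc n) x) < \<epsilon>" if "m \<ge> N" "n \<ge> N" for m n x
    proof -
      have "(L * cmod (q (Suc m) x - q (Suc n) x))\<^sup>2 = (cmod (complex_of_real L * q (Suc m) x - complex_of_real L * q (Suc n) x))\<^sup>2"
        using L(1) by (simp flip: right_diff_distrib add: norm_mult)
      also have "complex_of_real L * q (Suc m) x - complex_of_real L * q (Suc n) x = conv kk (\<lambda>x. q m x - q n x) x"
        by (simp add: conv_diff_right ckk cq kkq)
      also have "(cmod \<dots>)\<^sup>2 \<le> M * Re (mean_ip (\<lambda>x. q m x - q n x) (\<lambda>x. q m x - q n x))"
        unfolding M_def by (intro norm_conv_le ckk continuous_intros cq)
      also have "\<dots> \<le> M * (2 * \<eta>)"
        unfolding ipq_diff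
        using N[of "Suc (m + m)"] N[of "Suc (n + n)"] b_ge[of "Suc (m + n)"] that M
        by (intro mult_left_mono) auto
      also have "\<dots> < (M + 1) * (2 * \<eta>)" using \<eta> by simp
      also have "\<dots> = (L * \<epsilon>)\<^sup>2"
        using M unfolding \<eta>_def by (metis (no_types) add_nonneg_eq_0_iff mult.assoc mult.commute
          mult_eq_0_iff nonzero_eq_divide_eq zero_le_one zero_neq_numeral zero_neq_one)
      finally have "L * cmod (q (Suc m) x - q (Suc n) x) < L * \<epsilon>"
        by (rule power2_less_imp_less) (use L(1) \<open>\<epsilon> > 0\<close> in simp)
      then show ?thesis using L(1) by (simp add: dist_norm)
    qed
    then show "\<exists>M. \<forall>x\<in>UNIV. \<forall>m\<ge>M. \<forall>n\<ge>M. dist (q (Suc m) x) (q (Suc n) x) < \<epsilon>" by blast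
  qed
  then obtain p where p: "uniform_limit UNIV (\<lambda>n. q (Suc n)) p sequentially"
    using Cauchy_uniformly_convergent unfolding uniformly_convergent_on_def by blast
  have cont_p: "continuous_on UNIV p"
    by (rule uniform_limit_theorem[OF _ p]) (use cq in auto)
  have p_lim: "(\<lambda>n. q (Suc n) x) \<longlonglongrightarrow> p x" for x
    using tendsto_uniform_limitI[OF p] by simp
  then have p_lim2: "(\<lambda>n. q (Suc (Suc n)) x) \<longlonglongrightarrow> p x" for x
    using LIMSEQ_Suc[of "\<lambda>n. q (Suc n) x"] by blast
  have L2: "(\<lambda>n. Re (mean_ip (\<lambda>x. q (Suc n) x - p x) (\<lambda>x. q (Suc n) x - p x))) \<longlonglongrightarrow> 0"
  proof (rule LIMSEQ_I)
    fix \<epsilon> :: real assume "\<epsilon> > 0"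
    then have "\<forall>\<^sub>F n in sequentially. \<forall>x\<in>UNIV. dist (q (Suc n) x) (p x) < sqrt (\<epsilon> / 2)"
      using p unfolding uniform_limit_iff by simp
    then obtain N where N: "\<And>n x. n \<ge> N \<Longrightarrow> dist (q (Suc n) x) (p x) < sqrt (\<epsilon> / 2)"
      unfolding eventually_sequentially by auto
    have "norm (Re (mean_ip (\<lambda>x. q (Suc n) x - p x) (\<lambda>x. q (Suc n) x - p x)) - 0) < \<epsilon>" if "n \<ge> N" for n
    proof -
      have c: "continuous_on UNIV (\<lambda>x. q (Suc n) x - p x)" by (intro continuous_intros cq cont_p)
      have "(cmod (q (Suc n) x - p x))\<^sup>2 \<le> \<epsilon> / 2" for x
        using N[OF that, of x] \<open>\<epsilon> > 0\<close> real_less_rsqrt[of "cmod (q (Suc n) x - p x)" "\<epsilon>/2"]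
        by (metis dist_norm less_imp_le norm_ge_zero power2_le_imp_le power_mono real_sqrt_pow2 half_gt_zero)
      then have "Re (mean_ip (\<lambda>x. q (Suc n) x - p x) (\<lambda>x. q (Suc n) x - p x)) \<le> \<epsilon> / 2"
        by (intro mean_ip_self_le c)
      then show ?thesis using cg.ip_nonneg[of "\<lambda>x. q (Suc n) x - p x"] c \<open>\<epsilon> > 0\<close> by simp
    qed
    then show "\<exists>N. \<forall>n\<ge>N. norm (Re (mean_ip (\<lambda>x. q (Suc n) x - p x) (\<lambda>x. q (Suc n) x - p x)) - 0) < \<epsilon>" by blast
  qed
  \<comment> \<open>Transfers convergence in quadratic mean of \<open>q\<close> to the pointwise
    values of its convolutions with \<open>kk\<close>, where \<open>norm_conv_le\<close> supplies
    the premise with \<open>B = M\<close>.\<close>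
  have sq_null: "(\<lambda>n. f n) \<longlonglongrightarrow> c"
    if "\<And>n. (cmod (f n - c))\<^sup>2 \<le> B * Re (mean_ip (\<lambda>x. q (Suc n) x - p x) (\<lambda>x. q (Suc n) x - p x))" for f c B
  proof -
    have "(\<lambda>n. B * Re (mean_ip (\<lambda>x. q (Suc n) x - p x) (\<lambda>x. q (Suc n) x - p x))) \<longlonglongrightarrow> 0"
      using tendsto_mult_left[OF L2, of B] by simp
    then have "(\<lambda>n. (cmod (f n - c))\<^sup>2) \<longlonglongrightarrow> 0"
      by (rule tendsto_sandwich[rotated 3]) (use that in auto)
    then have "(\<lambda>n. sqrt ((cmod (f n - c))\<^sup>2)) \<longlonglongrightarrow> sqrt 0" by (rule tendsto_real_sqrt)
    then show ?thesis by (simp add: tendsto_norm_zero_iff LIM_zero_iff)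
  qed
  have kp: "conv kk p x = complex_of_real L * p x" for x
  proof (rule LIMSEQ_unique)
    show "(\<lambda>n. conv kk (q (Suc n)) x) \<longlonglongrightarrow> conv kk p x"
    proof (rule sq_null)
      show "(cmod (conv kk (q (Suc n)) x - conv kk p x))\<^sup>2
        \<le> M * Re (mean_ip (\<lambda>x. q (Suc n) x - p x) (\<lambda>x. q (Suc n) x - p x))" for n
        using norm_conv_le[OF ckk, of "\<lambda>x. q (Suc n) x - p x" x]
        by (simp add: conv_diff_right ckk cq cont_p continuous_on_diff M_def)
    qed
    show "(\<lambda>n. conv kk (q (Suc n)) x) \<longlonglongrightarrow> complex_of_real L * p x"
      unfolding kkq by (intro tendsto_intros p_lim2)
  qed
  have pk: "conv p kk x = complex_of_real L * p x" for x
  proof (rule LIMSEQ_unique)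
    show "(\<lambda>n. conv (q (Suc n)) kk x) \<longlonglongrightarrow> conv p kk x"
    proof (rule sq_null)
      show "(cmod (conv (q (Suc n)) kk x - conv p kk x))\<^sup>2
        \<le> M * Re (mean_ip (\<lambda>x. q (Suc n) x - p x) (\<lambda>x. q (Suc n) x - p x))" for n
        using norm_conv_le[OF _ ckk, of "\<lambda>x. q (Suc n) x - p x" x]
        by (simp add: conv_diff_left ckk cq cont_p continuous_on_diff M_def mult.commute)
    qed
    show "(\<lambda>n. conv (q (Suc n)) kk x) \<longlonglongrightarrow> complex_of_real L * p x"
      unfolding qkk by (intro tendsto_intros p_lim2)
  qed
  \<comment> \<open>At \<open>0\<close> the functions \<open>q\<close> take the values of
    \<open>b\<close>, so the lower bound \<open>1\<close> survives in the limit and \<open>p\<close>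
    cannot vanish there.\<close>
  have "1 \<le> Re (q (Suc n) 0)" for n
  proof -
    have "q (Suc n) 0 = complex_of_real (1 / L ^ Suc (Suc n)) * of_real (t (Suc (Suc n)))"
      unfolding q_def real0 ..
    also have "\<dots> = of_real (b (Suc (Suc n)))"
      unfolding of_real_mult[symmetric] b_def by simp
    finally show ?thesis using b1 by simp
  qed
  then have "1 \<le> Re (p 0)"
    by (intro LIMSEQ_le_const[OF tendsto_Re[OF p_lim]]) blast
  then have "p 0 \<noteq> 0" by auto
  then show ?thesis using that[OF L(1) cont_p] kp pk unfolding kk_def fun_eq_iff by blast
qed

text \<open>Bessel's inequality for the functions \<open>y \<mapsto> cnj (k (- y + x))\<close>, averaged over \<open>x\<close>.\<close>

lemma eigenspace_orthonormal_bound: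
  fixes k :: "'g \<Rightarrow> complex"
  assumes k: "continuous_on UNIV k" and "L > 0"
    and e: "cg.orthonormal e n" "\<And>i. i < n \<Longrightarrow> conv (e i) k = (\<lambda>x. complex_of_real L * e i x)"
  shows "real n \<le> Re (mean_ip k k) / L\<^sup>2"
proof -
  have ce: "continuous_on UNIV (e i)" if "i < n" for i using cg.orthonormal_closed[OF e(1) that] by simp
  have pw: "(\<Sum>i<n. (cmod (complex_of_real L * e i x))\<^sup>2) \<le> Re (mean_ip k k)" for x
  proof -
    define h where "h y = cnj (k (- y + x))" for y
    have h: "continuous_on UNIV h"
      unfolding h_def by (intro continuous_intros continuous_on_compose2[OF k]) auto
    have "mean_ip h h = mean_ip k k" unfolding h_def by (rule mean_ip_reflect[OF k])
    moreover have "cmod (complex_of_real L * e i x) = cmod (mean_ip h (e i))" if "i < n" for i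
    proof -
      have "complex_of_real L * e i x = mean_ip (e i) h"
        using fun_cong[OF e(2)[OF that], of x] by (simp add: conv_def mean_ip_def h_def)
      also have "\<dots> = cnj (mean_ip h (e i))"
        using h ce[OF that] by (intro cg.ip_cnj) auto
      finally show ?thesis by simp
    qed
    ultimately show ?thesis using cg.bessel[OF e(1), of h] h by simp
  qed
  have "of_real (L\<^sup>2 * real n) = (\<Sum>i<n. complex_of_real (L\<^sup>2) * mean_ip (e i) (e i))"
    using cg.orthonormal_ip[OF e(1)] by (simp add: mult.commute)
  also have "\<dots> = mean (\<lambda>x. \<Sum>i<n. of_real (L\<^sup>2) * (e i x * cnj (e i x)))"
    unfolding mean_ip_def by (rule mean_sum_cmult[symmetric]) (auto intro!: continuous_intros ce)
  also have "\<dots> = mean (\<lambda>x. of_real (\<Sum>i<n. (cmod (complex_of_real L * e i x))\<^sup>2))"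
    by (simp add: norm_mult power_mult_distrib complex_norm_square del: of_real_power)
  finally have eq: "complex_of_real (L\<^sup>2 * real n) = mean (\<lambda>x. of_real (\<Sum>i<n. (cmod (complex_of_real L * e i x))\<^sup>2))" .
  have "cmod (complex_of_real (L\<^sup>2 * real n)) \<le> Re (mean_ip k k)"
    unfolding eq
  proof (rule norm_mean_le)
    show "continuous_on UNIV (\<lambda>x. complex_of_real (\<Sum>i<n. (cmod (complex_of_real L * e i x))\<^sup>2))"
      by (intro continuous_intros ce) auto
    show "cmod (of_real (\<Sum>i<n. (cmod (complex_of_real L * e i x))\<^sup>2)) \<le> Re (mean_ip k k)" for x
      unfolding norm_of_real using pw[of x] by (simp add: sum_nonneg)
  qed
  then have "L\<^sup>2 * real n \<le> Re (mean_ip k k)" unfolding norm_of_real by simp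
  then show ?thesis using \<open>L > 0\<close> by (simp add: pos_le_divide_eq mult.commute)
qed

text \<open>Peter--Weyl: for \<open>h = dist \<cdot> 0\<close> and \<open>v = h - h(-g + \<cdot>)\<close>, an eigenfunction \<open>p\<close> of
  convolution with \<open>(v\<^sup>* * v) * (v\<^sup>* * v)\<close> satisfies \<open>v * p \<noteq> 0\<close>, so translation by \<open>g\<close>
  moves \<open>h * p\<close>, which lies in the finite-dimensional eigenspace.\<close>

lemma exists_nontrivial_rep:
  fixes g :: 'g
  assumes "g \<noteq> 0"
  obtains r :: "'g mrep" where "cont_unitary_rep r" "chr r g \<noteq> of_nat (rep_dim r)"
proof -
  define h where "h x = complex_of_real (dist x 0)" for x :: 'g
  have h: "continuous_on UNIV h" unfolding h_def by (intro continuous_intros)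
  define v where "v x = h x - h (- g + x)" for x
  have v: "continuous_on UNIV v"
    unfolding v_def by (intro continuous_intros h continuous_on_UNIV_translate)
  have v0: "v 0 \<noteq> 0" using assms by (simp add: v_def h_def)
  \<comment> \<open>This makes \<open>k\<close> self-adjoint, and nonzero because \<open>k 0\<close>
    is the squared quadratic mean of \<open>star v\<close>.\<close>
  define k where "k = conv (star v) v"
  have k: "continuous_on UNIV k" unfolding k_def by (intro continuous_on_conv continuous_on_star v)
  have sk: "star k = k" unfolding k_def by (simp add: star_conv continuous_on_star v)
  have "k \<noteq> (\<lambda>_. 0)"
  proof
    assume "k = (\<lambda>_. 0)"
    then have "mean_ip (star v) (star v) = 0" unfolding k_def using conv_at_zero[of "star v" v] by simp
    then have "star v = (\<lambda>_. 0)" using v by (intro cg.ip_definite) (auto intro: continuous_on_star)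
    then have "star v 0 = 0" by simp
    then show False using v0 by (simp add: star_def)
  qed
  then obtain L p where L: "L > 0" and p: "continuous_on UNIV p" and p0: "p 0 \<noteq> 0"
    and kp: "conv (conv k k) p = (\<lambda>x. complex_of_real L * p x)"
    and pk: "conv p (conv k k) = (\<lambda>x. complex_of_real L * p x)"
    using top_eigenfunction[OF k sk] by blast
  define kk where "kk = conv k k"
  have kk: "continuous_on UNIV kk" unfolding kk_def by (intro continuous_on_conv k)
  \<comment> \<open>The innermost factor of \<open>conv (conv k k) p\<close> is
    \<open>conv v p\<close>; were it zero, \<open>p\<close> would be an eigenfunction for
    \<open>0\<close> and not for \<open>L\<close>.\<close>
  have vp: "conv v p \<noteq> (\<lambda>_. 0)"
  proof
    assume 0: "conv v p = (\<lambda>_. 0)"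
    have "conv (conv k k) p = conv k (conv (star v) (conv v p))"
      unfolding k_def by (simp only: conv_assoc v p continuous_on_star continuous_on_conv)
    then have "conv (conv k k) p 0 = 0" unfolding 0 by (simp add: conv_def)
    then show False using kp L p0 by simp
  qed
  \<comment> \<open>The eigenspace of convolution on the right, which left translation preserves.
    Finite dimension comes from \<open>eigenspace_orthonormal_bound\<close>.\<close>
  define V where "V = {f. continuous_on UNIV f \<and> conv f kk = (\<lambda>x. complex_of_real L * f x)}"
  define S where "S a f x = f (- a + x)" for a :: 'g and f :: "'g \<Rightarrow> complex" and x
  have V: "continuous_on UNIV f" if "f \<in> V" for f using that by (simp add: V_def)
  interpret V: herm_space V mean_ip
  proof (rule cg.subspace)
    show "V \<subseteq> {f. continuous_on UNIV f}" unfolding V_def by auto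
    show "(\<lambda>_. 0) \<in> V" unfolding V_def by (simp add: conv_def fun_eq_iff)
    show "(\<lambda>t. x t + y t) \<in> V" if "x \<in> V" "y \<in> V" for x y
      using that unfolding V_def
      by (auto simp: conv_add_left kk fun_eq_iff distrib_left intro!: continuous_intros)
    show "(\<lambda>t. c * x t) \<in> V" if "x \<in> V" for x c
      using that unfolding V_def
      by (auto simp: conv_cmult_left kk fun_eq_iff intro!: continuous_intros)
  qed
  have bound: "n \<le> nat \<lceil>Re (mean_ip kk kk) / L\<^sup>2\<rceil>" if "V.orthonormal e n" for e n
  proof -
    have eV: "e i \<in> V" if "i < n" for i using V.orthonormal_closed[OF \<open>V.orthonormal e n\<close> that] .
    have "cg.orthonormal e n"
      using that V unfolding V.orthonormal_def cg.orthonormal_def by auto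
    then have "real n \<le> Re (mean_ip kk kk) / L\<^sup>2"
      using eV by (intro eigenspace_orthonormal_bound[OF kk L]) (auto simp: V_def)
    then show ?thesis by linarith
  qed
  obtain e n where e: "V.orthonormal e n" and basis: "\<And>x. x \<in> V \<Longrightarrow> V.proj e n x = x"
    by (rule V.orthonormal_basis_ex[of "nat \<lceil>Re (mean_ip kk kk) / L\<^sup>2\<rceil>"]) (erule bound, rule that)
  interpret A: unitary_action V mean_ip S e n
  proof unfold_locales
    show "S a x \<in> V" if "x \<in> V" for a x
      using that unfolding V_def S_def
      by (auto simp: conv_translate kk fun_eq_iff intro: continuous_on_UNIV_translate)
    show "S a (\<lambda>t. \<Sum>i<n. c i * e i t) = (\<lambda>t. \<Sum>i<n. c i * S a (e i) t)" for a c
      by (simp add: S_def fun_eq_iff)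
    show "S (a + b) x = S a (S b x)" for a b x
      by (simp add: fun_eq_iff S_def minus_add add.assoc diff_conv_add_uminus del: add_uminus_conv_diff)
    show "S 0 x = x" for x by (simp add: S_def fun_eq_iff)
    show "mean_ip (S a x) (S a y) = mean_ip x y" if "x \<in> V" "y \<in> V" for a x y
      unfolding mean_ip_def S_def using V[OF that(1)] V[OF that(2)]
      by (intro mean_left[of "\<lambda>t. x t * cnj (y t)"] continuous_intros)
    show "continuous_on UNIV (\<lambda>a. mean_ip (S a x) y)" if "x \<in> V" "y \<in> V" for x y
      unfolding mean_ip_def S_def
      by (intro continuous_on_mean continuous_intros continuous_on_compose2[OF V[OF that(1)]]
          continuous_on_compose2[OF V[OF that(2)]]) auto
  qed (use e basis in auto)
  define f where "f = conv h p"
  have fV: "f \<in> V"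
    unfolding V_def f_def kk_def using pk
    by (simp add: continuous_on_conv h p conv_assoc k)
      (simp add: fun_eq_iff conv_cmult_right h p)
  have fne: "S g f \<noteq> f"
  proof
    assume "S g f = f"
    have "conv v p x = f x - S g f x" for x
      unfolding v_def f_def S_def
      by (simp add: conv_diff_left h p continuous_on_UNIV_translate conv_translate)
    then show False using vp \<open>S g f = f\<close> by auto
  qed
  have n: "n \<ge> 1"
  proof (rule ccontr)
    assume "\<not> n \<ge> 1"
    then have "n = 0" by simp
    then have "f = (\<lambda>_. 0)" using basis[OF fV] by (simp add: V.proj_def)
    then have "S g f = f" by (simp add: S_def fun_eq_iff)
    with fne show False ..
  qed
  define r where "r = matrix_rep mean_ip S e n"
  \<comment> \<open>A trace equal to the dimension forces every diagonal entry, of modulus at most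
    \<open>1\<close>, to have real part \<open>1\<close>. Then each \<open>e i\<close>, and hence
    \<open>f\<close>, is fixed by \<open>S g\<close>, contrary to \<open>fne\<close>.\<close>
  have "chr r g \<noteq> of_nat n"
  proof
    assume tr: "chr r g = of_nat n"
    have eV: "e i \<in> V" if "i < n" for i using V.orthonormal_closed[OF e that] .
    have u: "rep_mat r g i i = mean_ip (S g (e i)) (e i)" if "i < n" for i
      using that by (simp add: r_def rep_mat_matrix_rep)
    have le: "Re (rep_mat r g i i) \<le> 1" if "i < n" for i
    proof -
      have "(cmod (rep_mat r g i i))\<^sup>2 \<le> 1"
        using V.cauchy_schwarz[OF A.S_closed[OF eV[OF that], of g] eV[OF that]] A.S_ip[OF eV[OF that] eV[OF that]]
          V.orthonormal_ip[OF e that that] u[OF that] by simp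
      then have "cmod (rep_mat r g i i) \<le> 1" by (simp add: abs_square_le_1)
      then show ?thesis using complex_Re_le_cmod order.trans by blast
    qed
    have "(\<Sum>i<n. 1 - Re (rep_mat r g i i)) = 0"
      using arg_cong[OF tr, of Re] by (simp add: sum_subtractf chr_def r_def)
    then have z: "\<forall>i\<in>{..<n}. 1 - Re (rep_mat r g i i) = 0"
      using le by (subst (asm) sum_nonneg_eq_0_iff) auto
    have one: "Re (mean_ip (S g (e i)) (e i)) = 1" if "i < n" for i
      using bspec[OF z, of i] that unfolding u[OF that] by simp
    have Se: "S g (e i) = e i" if "i < n" for i
    proof -
      note ei = eV[OF that] and Se = A.S_closed[OF eV[OF that], of g]
      note d = V.diff_closed[OF Se ei]
      have "mean_ip (\<lambda>t. S g (e i) t - e i t) (\<lambda>t. S g (e i) t - e i t)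
        = (mean_ip (S g (e i)) (S g (e i)) - mean_ip (S g (e i)) (e i)) - (mean_ip (e i) (S g (e i)) - mean_ip (e i) (e i))"
        using V.ip_diff[OF Se ei d] V.ip_diff_right[OF Se ei Se] V.ip_diff_right[OF Se ei ei] by simp
      also have "mean_ip (e i) (S g (e i)) = cnj (mean_ip (S g (e i)) (e i))"
        by (rule V.ip_cnj[OF Se ei])
      also have "mean_ip (S g (e i)) (S g (e i)) = 1"
        using A.S_ip[OF ei ei] V.orthonormal_ip[OF e that that] by simp
      also have "mean_ip (e i) (e i) = 1" using V.orthonormal_ip[OF e that that] by simp
      finally have "mean_ip (\<lambda>t. S g (e i) t - e i t) (\<lambda>t. S g (e i) t - e i t) = 0"
        using one[OF that] by (simp add: complex_eq_iff)
      from V.ip_definite[OF d this] show ?thesis by (metis eq_iff_diff_eq_0 ext)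
    qed
    have "S g f = S g (V.proj e n f)" using basis[OF fV] by simp
    also have "\<dots> = V.proj e n f"
      unfolding V.proj_def A.S_lincomb using Se by simp
    finally show False using fne basis[OF fV] by simp
  qed
  then show ?thesis
    using that[of r] A.cont_unitary_matrix_rep[OF n] by (simp add: r_def)
qed

end

section \<open>Schur orthogonality\<close>

text \<open>Gaussian elimination by induction on the number \<open>m\<close> of equations: a pivot
  \<open>p\<close> with nonzero last coordinate clears that coordinate from the other
  vectors.\<close>

lemma linear_dependence:
  fixes x :: "'i \<Rightarrow> nat \<Rightarrow> 'k::field"
  assumes "finite I" "m < card I"
  shows "\<exists>c. (\<exists>l\<in>I. c l \<noteq> 0) \<and> (\<forall>i<m. (\<Sum>l\<in>I. c l * x l i) = 0)"
  using assms
proof (induction m arbitrary: I x)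
  case 0
  then have "I \<noteq> {}" by auto
  then show ?case by (intro exI[of _ "\<lambda>_. 1"]) auto
next
  case (Suc m)
  show ?case
  proof (cases "\<forall>l\<in>I. x l m = 0")
    case True
    obtain c where "\<exists>l\<in>I. c l \<noteq> 0" "\<forall>i<m. (\<Sum>l\<in>I. c l * x l i) = 0"
      using Suc.IH[OF Suc.prems(1), of x] Suc.prems(2) by auto
    then show ?thesis using True by (intro exI[of _ c]) (auto simp: less_Suc_eq)
  next
    case False
    then obtain p where p: "p \<in> I" "x p m \<noteq> 0" by blast
    define J where "J = I - {p}"
    have J: "finite J" "m < card J" "p \<notin> J" "I = insert p J"
      using Suc.prems p by (auto simp: J_def)
    obtain c where c: "\<exists>l\<in>J. c l \<noteq> 0"
      "\<forall>i<m. (\<Sum>l\<in>J. c l * (x l i - x l m / x p m * x p i)) = 0"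
      using Suc.IH[OF J(1,2), of "\<lambda>l i. x l i - x l m / x p m * x p i"] by blast
    \<comment> \<open>The coefficient \<open>- s\<close> of the pivot undoes the subtracted
      multiples of \<open>x p\<close>, so the relation among the reduced vectors becomes one among
      the original vectors.\<close>
    define s where "s = (\<Sum>l\<in>J. c l * (x l m / x p m))"
    define c' where "c' = c(p := - s)"
    have sum: "(\<Sum>l\<in>I. c' l * x l i) = (\<Sum>l\<in>J. c l * (x l i - x l m / x p m * x p i))" for i
    proof -
      have "(\<Sum>l\<in>I. c' l * x l i) = - s * x p i + (\<Sum>l\<in>J. c' l * x l i)"
        unfolding J(4) using J(1,3) by (simp add: c'_def)
      also have "(\<Sum>l\<in>J. c' l * x l i) = (\<Sum>l\<in>J. c l * x l i)"
        using J(3) by (intro sum.cong) (auto simp: c'_def)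
      finally show ?thesis
        by (simp add: s_def right_diff_distrib sum_subtractf sum_distrib_right mult.assoc)
    qed
    have "(\<Sum>l\<in>I. c' l * x l m) = 0" unfolding sum using p(2) by simp
    then have "\<forall>i<Suc m. (\<Sum>l\<in>I. c' l * x l i) = 0"
      using c(2) sum by (auto simp: less_Suc_eq)
    moreover have "\<exists>l\<in>I. c' l \<noteq> 0" using c(1) J(3,4) by (auto simp: c'_def)
    ultimately show ?thesis by blast
  qed
qed

section \<open>Eigenvectors of complex matrices\<close>

lemma mat_vec_lincomb:
  "mat_vec d T (\<lambda>i. \<Sum>l\<in>I. c l * v l i) = (\<lambda>i. \<Sum>l\<in>I. c l * mat_vec d T (v l) i)"
proof
  fix i
  show "mat_vec d T (\<lambda>i. \<Sum>l\<in>I. c l * v l i) i = (\<Sum>l\<in>I. c l * mat_vec d T (v l) i)"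
    unfolding mat_vec_def
    by (simp add: sum_distrib_left sum_distrib_right sum.swap[of _ I] ac_simps)
qed

lemma mat_vec_closed: "mat_vec d T v \<in> cvecs d"
  by (simp add: mat_vec_def cvecs_def)

text \<open>A root \<open>z\<close> of \<open>q\<close> splits off a linear factor. With
  \<open>w\<close> the cofactor evaluated at \<open>T\<close> and applied to \<open>v\<close>,
  either \<open>w\<close> is an eigenvector for \<open>z\<close>, or \<open>w = 0\<close> and the
  cofactor, of smaller degree, annihilates \<open>v\<close> too.\<close>

lemma eigenvector_of_annihilating_poly:
  fixes q :: "complex poly"
  assumes "q \<noteq> 0" "v \<in> cvecs d" "v \<noteq> (\<lambda>_. 0)"
    and "(\<lambda>i. \<Sum>l\<le>degree q. coeff q l * (mat_vec d T ^^ l) v i) = (\<lambda>_. 0)"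
  shows "\<exists>c w. w \<in> cvecs d \<and> w \<noteq> (\<lambda>_. 0) \<and> mat_vec d T w = (\<lambda>i. c * w i)"
  using assms(1,4)
proof (induction "degree q" arbitrary: q)
  case 0
  then obtain a where "q = [:a:]" "a \<noteq> 0" by (metis degree_0_id pCons_0_0 of_nat_0 degree_eq_zeroE)
  then show ?case using 0 assms(3) by (auto simp: fun_eq_iff)
next
  case (Suc n)
  then obtain z where "poly q z = 0"
    using fundamental_theorem_of_algebra_alt[of q] by (metis degree_pCons_0 nat.distinct(1))
  then obtain p where q: "q = [:- z, 1:] * p" by (metis dvdE poly_eq_0_iff_dvd)
  have p0: "p \<noteq> 0" using Suc.prems(1) q by auto
  have dq: "degree q = Suc (degree p)" unfolding q using p0 by (subst degree_mult_eq) auto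
  define x where "x l = (mat_vec d T ^^ l) v" for l
  have x_in: "x l \<in> cvecs d" for l
    unfolding x_def using assms(2) by (cases l) (auto simp: mat_vec_closed)
  define w where "w = (\<lambda>i. \<Sum>l\<le>degree p. coeff p l * x l i)"
  have w_in: "w \<in> cvecs d" using x_in unfolding w_def cvecs_def by simp
  have "(\<Sum>l\<le>degree q. coeff q l * x l i) = mat_vec d T w i - z * w i" for i
  proof -
    have "coeff q l = coeff (pCons 0 p) l - z * coeff p l" for l unfolding q by simp
    then have "(\<Sum>l\<le>degree q. coeff q l * x l i)
      = (\<Sum>l\<le>Suc (degree p). coeff (pCons 0 p) l * x l i) - (\<Sum>l\<le>Suc (degree p). z * (coeff p l * x l i))"
      unfolding dq by (simp only: left_diff_distrib sum_subtractf mult.assoc)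
    also have "(\<Sum>l\<le>Suc (degree p). coeff (pCons 0 p) l * x l i) = (\<Sum>l\<le>degree p. coeff p l * x (Suc l) i)"
      by (subst sum.atMost_Suc_shift) simp
    also have "\<dots> = mat_vec d T w i" unfolding w_def mat_vec_lincomb by (simp add: x_def)
    also have "(\<Sum>l\<le>Suc (degree p). z * (coeff p l * x l i)) = z * w i"
      by (simp add: coeff_eq_0 w_def sum_distrib_left)
    finally show ?thesis .
  qed
  then have eig: "mat_vec d T w i = z * w i" for i
    using fun_cong[OF Suc.prems(2), of i] by (simp add: x_def)
  show ?case
  proof (cases "w = (\<lambda>_. 0)")
    case True
    then show ?thesis using Suc.hyps(1)[of p] Suc.hyps(2) dq p0 unfolding w_def x_def by simp
  next
    case False
    then show ?thesis using w_in eig by blast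
  qed
qed

lemma eigenvector_ex:
  assumes "d \<ge> 1"
  shows "\<exists>c w. w \<in> cvecs d \<and> w \<noteq> (\<lambda>_. 0) \<and> mat_vec d T w = (\<lambda>i. c * w i)"
proof -
  define v :: "nat \<Rightarrow> complex" where "v i = (if i = 0 then 1 else 0)" for i
  have v: "v \<in> cvecs d" "v \<noteq> (\<lambda>_. 0)" using assms by (auto simp: v_def cvecs_def fun_eq_iff)
  have x_in: "(mat_vec d T ^^ l) v \<in> cvecs d" for l
    using v(1) by (cases l) (auto simp: mat_vec_closed)
  \<comment> \<open>The \<open>d + 1\<close> vectors from \<open>v\<close> to the
    \<open>d\<close>-th iterate are dependent; their relation gives the annihilating
    polynomial.\<close>
  obtain c where c: "\<exists>l\<in>{..d}. c l \<noteq> 0" "\<forall>i<d. (\<Sum>l\<le>d. c l * (mat_vec d T ^^ l) v i) = 0"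
    using linear_dependence[of "{..d}" d "\<lambda>l. (mat_vec d T ^^ l) v"] by auto
  define q where "q = (\<Sum>l\<le>d. monom (c l) l)"
  have cq: "coeff q l = (if l \<le> d then c l else 0)" for l
    by (simp add: q_def coeff_sum if_distrib[of "\<lambda>t. t = _"] cong: if_cong)
  have "q \<noteq> 0" using c(1) cq by (metis atMost_iff coeff_0)
  moreover have "degree q \<le> d" using cq by (intro degree_le) auto
  moreover have "(\<Sum>l\<le>degree q. coeff q l * (mat_vec d T ^^ l) v i) = 0" for i
  proof -
    have "(\<Sum>l\<le>degree q. coeff q l * (mat_vec d T ^^ l) v i) = (\<Sum>l\<le>d. coeff q l * (mat_vec d T ^^ l) v i)"
      using \<open>degree q \<le> d\<close> by (intro sum.mono_neutral_left) (auto simp: coeff_eq_0)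
    also have "\<dots> = (\<Sum>l\<le>d. c l * (mat_vec d T ^^ l) v i)" by (intro sum.cong) (auto simp: cq)
    also have "\<dots> = 0"
      using c(2) x_in unfolding cvecs_def by (cases "i < d") auto
    finally show ?thesis .
  qed
  ultimately show ?thesis using eigenvector_of_annihilating_poly[OF _ v] by blast
qed

section \<open>Elementary properties of matrix representations\<close>

lemma cont_unitary_repD:
  assumes "cont_unitary_rep r"
  shows "rep_dim r \<ge> 1"
    and "\<not> (i < rep_dim r \<and> j < rep_dim r) \<Longrightarrow> rep_mat r g i j = 0"
    and "continuous_on UNIV (\<lambda>g. rep_mat r g i j)"
    and "i < rep_dim r \<Longrightarrow> j < rep_dim r \<Longrightarrow>
      rep_mat r (g + h) i j = (\<Sum>k<rep_dim r. rep_mat r g i k * rep_mat r h k j)"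
    and "i < rep_dim r \<Longrightarrow> j < rep_dim r \<Longrightarrow>
      (\<Sum>k<rep_dim r. rep_mat r g i k * cnj (rep_mat r g j k)) = (if i = j then 1 else 0)"
    and "i < rep_dim r \<Longrightarrow> j < rep_dim r \<Longrightarrow>
      (\<Sum>k<rep_dim r. cnj (rep_mat r g k i) * rep_mat r g k j) = (if i = j then 1 else 0)"
  using assms unfolding cont_unitary_rep_def Let_def by blast+

lemma sum_delta_mult_right:
  fixes f :: "nat \<Rightarrow> 'b::semiring_1"
  assumes "j < n"
  shows "(\<Sum>k<n. f k * (if k = j then 1 else 0)) = f j" "(\<Sum>k<n. f k * (if j = k then 1 else 0)) = f j"
    "(\<Sum>k<n. (if k = j then 1 else 0) * f k) = f j" "(\<Sum>k<n. (if j = k then 1 else 0) * f k) = f j"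
  using assms by (simp_all add: if_distrib[of "\<lambda>t. _ * t"] if_distrib[of "\<lambda>t. t * _"] cong: if_cong)

text \<open>Cancels the matrix of \<open>h\<close> against its adjoint. The values at
  \<open>0\<close> and at \<open>- g\<close>, and the kernel formula \<open>chr_diff\<close>, are
  instances.\<close>

lemma rep_mat_neg_mult:
  assumes r: "cont_unitary_rep r" and ij: "i < rep_dim r" "j < rep_dim r"
  shows "(\<Sum>k<rep_dim r. rep_mat r (g + h) i k * cnj (rep_mat r h j k)) = rep_mat r g i j"
proof -
  let ?d = "rep_dim r" and ?u = "rep_mat r"
  have "(\<Sum>k<?d. ?u (g + h) i k * cnj (?u h j k)) = (\<Sum>k<?d. (\<Sum>l<?d. ?u g i l * ?u h l k) * cnj (?u h j k))"
    using ij by (intro sum.cong) (auto simp: cont_unitary_repD(4)[OF r])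
  also have "\<dots> = (\<Sum>l<?d. ?u g i l * (\<Sum>k<?d. ?u h l k * cnj (?u h j k)))"
    by (simp add: sum_distrib_left sum_distrib_right mult.assoc) (rule sum.swap)
  also have "\<dots> = (\<Sum>l<?d. ?u g i l * (if l = j then 1 else 0))"
    using ij by (intro sum.cong) (auto simp: cont_unitary_repD(5)[OF r])
  also have "\<dots> = ?u g i j" using ij by (simp add: sum_delta_mult_right)
  finally show ?thesis .
qed

lemma rep_mat_zero:
  assumes r: "cont_unitary_rep r" and "i < rep_dim r" "j < rep_dim r"
  shows "rep_mat r 0 i j = (if i = j then 1 else 0)"
  using rep_mat_neg_mult[OF assms, of 0 0] cont_unitary_repD(5)[OF assms, of 0] by simp

lemma rep_mat_neg:
  assumes r: "cont_unitary_rep r" and ij: "i < rep_dim r" "j < rep_dim r"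
  shows "rep_mat r (- g) i j = cnj (rep_mat r g j i)"
proof -
  have "rep_mat r (- g) i j = (\<Sum>k<rep_dim r. rep_mat r (- g + g) i k * cnj (rep_mat r g j k))"
    by (rule rep_mat_neg_mult[OF assms, symmetric])
  also have "\<dots> = (\<Sum>k<rep_dim r. (if i = k then 1 else 0) * cnj (rep_mat r g j k))"
    using ij by (intro sum.cong) (auto simp: rep_mat_zero[OF r])
  also have "\<dots> = cnj (rep_mat r g j i)" using ij by (simp add: sum_delta_mult_right)
  finally show ?thesis .
qed

lemma chr_zero: "cont_unitary_rep r \<Longrightarrow> chr r 0 = of_nat (rep_dim r)"
  by (simp add: chr_def rep_mat_zero)

lemma continuous_on_chr: "cont_unitary_rep r \<Longrightarrow> continuous_on UNIV (chr r)"
  unfolding chr_def by (intro continuous_intros cont_unitary_repD(3))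

lemma cmod_rep_mat_le:
  assumes r: "cont_unitary_rep r"
  shows "cmod (rep_mat r g i j) \<le> 1"
proof (cases "i < rep_dim r \<and> j < rep_dim r")
  case True
  have "complex_of_real (\<Sum>k<rep_dim r. (cmod (rep_mat r g i k))\<^sup>2) = 1"
    using cont_unitary_repD(5)[OF r, of i i g] True
    by (simp add: complex_norm_square del: of_real_power)
  then have eq: "(\<Sum>k<rep_dim r. (cmod (rep_mat r g i k))\<^sup>2) = 1" using of_real_eq_1_iff by blast
  have "(cmod (rep_mat r g i j))\<^sup>2 \<le> (\<Sum>k<rep_dim r. (cmod (rep_mat r g i k))\<^sup>2)"
    using True by (intro member_le_sum) auto
  then show ?thesis unfolding eq by (simp add: abs_square_le_1)
qed (simp add: cont_unitary_repD(2)[OF r])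

lemma cmod_chr_le:
  assumes "cont_unitary_rep r"
  shows "cmod (chr r g) \<le> rep_dim r"
proof -
  have "cmod (chr r g) \<le> (\<Sum>i<rep_dim r. 1)"
    unfolding chr_def by (intro sum_norm_le cmod_rep_mat_le[OF assms])
  then show ?thesis by simp
qed

lemma irreducible_cont_unitary: "irreducible_rep r \<Longrightarrow> cont_unitary_rep r"
  by (simp add: irreducible_rep_def)

section \<open>Intertwiners and Schur's lemma\<close>

lemma intertwiner_outside: "intertwiner r s T \<Longrightarrow> \<not> (i < rep_dim s \<and> j < rep_dim r) \<Longrightarrow> T i j = 0"
  unfolding intertwiner_def by blast

lemma intertwinerD:
  "intertwiner r s T \<Longrightarrow> i < rep_dim s \<Longrightarrow> j < rep_dim r \<Longrightarrow>
    (\<Sum>k<rep_dim r. T i k * rep_mat r g k j) = (\<Sum>k<rep_dim s. rep_mat s g i k * T k j)"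
  unfolding intertwiner_def by blast

definition mat_comp :: "nat \<Rightarrow> (nat \<Rightarrow> nat \<Rightarrow> complex) \<Rightarrow> (nat \<Rightarrow> nat \<Rightarrow> complex) \<Rightarrow> nat \<Rightarrow> nat \<Rightarrow> complex" where
  "mat_comp n A B i j = (\<Sum>k<n. A i k * B k j)"

lemma mat_comp_assoc: "mat_comp n A (mat_comp m B C) = mat_comp m (mat_comp n A B) C"
  unfolding mat_comp_def fun_eq_iff
  by (simp add: sum_distrib_left sum_distrib_right mult.assoc sum.swap[of _ "{..<m}"])

lemma intertwiner_comp:
  assumes T: "intertwiner r s T" and Q: "intertwiner s t Q"
  shows "intertwiner r t (mat_comp (rep_dim s) Q T)"
  unfolding intertwiner_def
proof (intro conjI allI impI)
  fix i j assume "\<not> (i < rep_dim t \<and> j < rep_dim r)"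
  then show "mat_comp (rep_dim s) Q T i j = 0"
    using intertwiner_outside[OF T, of _ j] intertwiner_outside[OF Q, of i] unfolding mat_comp_def by auto
next
  fix g i j assume ij: "i < rep_dim t" "j < rep_dim r"
  let ?n = "rep_dim s"
  have "(\<Sum>k<rep_dim r. mat_comp ?n Q T i k * rep_mat r g k j)
      = mat_comp ?n Q (mat_comp (rep_dim r) T (rep_mat r g)) i j"
    unfolding mat_comp_assoc by (simp add: mat_comp_def)
  also have "\<dots> = mat_comp ?n Q (mat_comp ?n (rep_mat s g) T) i j"
    using ij(2) unfolding mat_comp_def[of ?n Q] by (intro sum.cong) (auto simp: mat_comp_def intertwinerD[OF T])
  also have "\<dots> = mat_comp ?n (mat_comp ?n Q (rep_mat s g)) T i j" unfolding mat_comp_assoc ..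
  also have "\<dots> = mat_comp ?n (mat_comp (rep_dim t) (rep_mat t g) Q) T i j"
    using ij(1) unfolding mat_comp_def[of ?n _ T] by (intro sum.cong) (auto simp: mat_comp_def intertwinerD[OF Q])
  also have "\<dots> = (\<Sum>k<rep_dim t. rep_mat t g i k * mat_comp ?n Q T k j)"
    unfolding mat_comp_assoc[symmetric] by (simp add: mat_comp_def)
  finally show "(\<Sum>k<rep_dim r. mat_comp ?n Q T i k * rep_mat r g k j)
      = (\<Sum>k<rep_dim t. rep_mat t g i k * mat_comp ?n Q T k j)" .
qed

text \<open>An eigenspace of \<open>T\<close> is invariant because \<open>T\<close> commutes with
  the representation; being nonzero, it is the whole space by irreducibility.\<close>

lemma schur_scalar:
  assumes r: "irreducible_rep r" and T: "intertwiner r r T"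
  shows "\<exists>c. \<forall>i<rep_dim r. \<forall>j<rep_dim r. T i j = (if i = j then c else 0)"
proof -
  let ?d = "rep_dim r"
  have ru: "cont_unitary_rep r" using r by (rule irreducible_cont_unitary)
  obtain c w where w: "w \<in> cvecs ?d" "w \<noteq> (\<lambda>_. 0)" "mat_vec ?d T w = (\<lambda>i. c * w i)"
    using eigenvector_ex[OF cont_unitary_repD(1)[OF ru], of T] by blast
  define W where "W = {v \<in> cvecs ?d. mat_vec ?d T v = (\<lambda>i. c * v i)}"
  have comm: "mat_vec ?d T (mat_vec ?d (rep_mat r g) v) = mat_vec ?d (rep_mat r g) (mat_vec ?d T v)" for g v
  proof
    fix i
    show "mat_vec ?d T (mat_vec ?d (rep_mat r g) v) i = mat_vec ?d (rep_mat r g) (mat_vec ?d T v) i"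
    proof (cases "i < ?d")
      case True
      have "mat_vec ?d T (mat_vec ?d (rep_mat r g) v) i = (\<Sum>j<?d. (\<Sum>k<?d. T i k * rep_mat r g k j) * v j)"
        using True unfolding mat_vec_def
        by (simp add: sum_distrib_left sum_distrib_right mult.assoc) (rule sum.swap)
      also have "\<dots> = (\<Sum>j<?d. (\<Sum>k<?d. rep_mat r g i k * T k j) * v j)"
        using True by (intro sum.cong) (auto simp: intertwinerD[OF T])
      also have "\<dots> = mat_vec ?d (rep_mat r g) (mat_vec ?d T v) i"
        using True unfolding mat_vec_def
        by (simp add: sum_distrib_left sum_distrib_right mult.assoc) (rule sum.swap)
      finally show ?thesis .
    qed (simp add: mat_vec_def)
  qed
  have "invariant_subspace r W"
    unfolding invariant_subspace_def
  proof (intro conjI ballI allI)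
    show "W \<subseteq> cvecs ?d" by (auto simp: W_def)
    show "(\<lambda>_. 0) \<in> W" by (auto simp: W_def cvecs_def mat_vec_def)
    show "(\<lambda>i. v i + u i) \<in> W" if "v \<in> W" "u \<in> W" for v u
      using that unfolding W_def
      by (auto simp: cvecs_def mat_vec_def fun_eq_iff distrib_left sum.distrib split: if_splits)
    show "(\<lambda>i. a * v i) \<in> W" if "v \<in> W" for a v
    proof -
      have "mat_vec ?d T (\<lambda>i. a * v i) = (\<lambda>i. a * mat_vec ?d T v i)"
        using mat_vec_lincomb[where d = ?d and T = T and I = "{0::nat}" and c = "\<lambda>_. a" and v = "\<lambda>_. v"] by simp
      then show ?thesis using that by (auto simp: W_def cvecs_def)
    qed
    show "mat_vec ?d (rep_mat r g) v \<in> W" if "v \<in> W" for g v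
    proof -
      have "mat_vec ?d (rep_mat r g) (\<lambda>i. c * v i) = (\<lambda>i. c * mat_vec ?d (rep_mat r g) v i)"
        using mat_vec_lincomb[where d = ?d and T = "rep_mat r g" and I = "{0::nat}" and c = "\<lambda>_. c" and v = "\<lambda>_. v"] by simp
      then show ?thesis using that comm[of g v] by (simp add: W_def mat_vec_closed)
    qed
  qed
  moreover have "w \<in> W" using w by (simp add: W_def)
  ultimately have W: "W = cvecs ?d" using r w(2) unfolding irreducible_rep_def by blast
  have "T i j = (if i = j then c else 0)" if "i < ?d" "j < ?d" for i j
  proof -
    define v :: "nat \<Rightarrow> complex" where "v k = (if k = j then 1 else 0)" for k
    have "v \<in> W" unfolding W using that by (auto simp: cvecs_def v_def)
    then have "mat_vec ?d T v i = c * v i" by (simp add: W_def)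
    then show ?thesis using that by (simp add: mat_vec_def v_def sum_delta_mult_right)
  qed
  then show ?thesis by blast
qed

lemma rep_equiv_refl: "rep_equiv r r"
  unfolding rep_equiv_def
proof (intro conjI exI allI impI)
  let ?T = "\<lambda>i j. if i = j \<and> i < rep_dim r then 1 else (0::complex)"
  have left: "(\<Sum>k<rep_dim r. ?T i k * f k) = f i" if "i < rep_dim r" for i and f :: "nat \<Rightarrow> complex"
  proof -
    have "(\<Sum>k<rep_dim r. ?T i k * f k) = (\<Sum>k<rep_dim r. if i = k then f k else 0)"
      using that by (intro sum.cong) auto
    then show ?thesis using that by simp
  qed
  have right: "(\<Sum>k<rep_dim r. f k * ?T k i) = f i" if "i < rep_dim r" for i and f :: "nat \<Rightarrow> complex"
  proof -
    have "(\<Sum>k<rep_dim r. f k * ?T k i) = (\<Sum>k<rep_dim r. if i = k then f k else 0)"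
      using that by (intro sum.cong) auto
    then show ?thesis using that by simp
  qed
  show "intertwiner r r ?T"
    unfolding intertwiner_def by (intro conjI allI impI) (simp_all only: left right, auto simp: sum_delta_mult_right)
  fix i j assume "i < rep_dim r" "j < rep_dim r"
  then show "(\<Sum>k<rep_dim r. ?T i k * ?T k j) = (if i = j then 1 else 0)"
    "(\<Sum>k<rep_dim r. ?T i k * ?T k j) = (if i = j then 1 else 0)"
    by (auto simp: sum_delta_mult_right)
qed simp

text \<open>Cyclicity of the trace, after inserting \<open>T B = 1\<close> and moving
  \<open>T\<close> across the representation.\<close>

lemma rep_equiv_chr:
  assumes "rep_equiv r s"
  shows "chr r g = chr s g"
proof -
  define d where "d = rep_dim r"
  obtain T B where ds: "rep_dim s = d" and T: "intertwiner r s T"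
    and TB: "\<And>i j. i < d \<Longrightarrow> j < d \<Longrightarrow> (\<Sum>k<d. T i k * B k j) = (if i = j then 1 else 0)"
    and BT: "\<And>i j. i < d \<Longrightarrow> j < d \<Longrightarrow> (\<Sum>k<d. B i k * T k j) = (if i = j then 1 else 0)"
    using assms unfolding rep_equiv_def d_def[symmetric] by blast
  let ?u = "rep_mat r g" and ?v = "rep_mat s g"
  have "chr s g = (\<Sum>i<d. \<Sum>k<d. ?v i k * (if k = i then 1 else 0))"
    unfolding chr_def ds by (intro sum.cong) (auto simp: sum_delta_mult_right)
  also have "\<dots> = (\<Sum>i<d. mat_comp d ?v (mat_comp d T B) i i)"
    unfolding mat_comp_def by (intro sum.cong refl) (auto simp: TB)
  also have "\<dots> = (\<Sum>i<d. mat_comp d (mat_comp d T ?u) B i i)"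
    unfolding mat_comp_assoc using intertwinerD[OF T, of _ _ g]
    by (intro sum.cong refl) (auto simp: mat_comp_def ds d_def intro!: sum.cong)
  also have "\<dots> = (\<Sum>i<d. mat_comp d T (mat_comp d ?u B) i i)" unfolding mat_comp_assoc ..
  also have "\<dots> = (\<Sum>i<d. mat_comp d (mat_comp d ?u B) T i i)"
    unfolding mat_comp_def[of d T] mat_comp_def[of d _ T] by (subst sum.swap) (simp add: mult.commute)
  also have "\<dots> = (\<Sum>i<d. mat_comp d ?u (mat_comp d B T) i i)" unfolding mat_comp_assoc ..
  also have "\<dots> = (\<Sum>i<d. \<Sum>k<d. ?u i k * (if k = i then 1 else 0))"
    unfolding mat_comp_def by (intro sum.cong refl) (auto simp: BT)
  also have "\<dots> = chr r g"
    unfolding chr_def d_def by (intro sum.cong) (auto simp: sum_delta_mult_right)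
  finally show ?thesis ..
qed

section \<open>Orthogonality of matrix coefficients and characters\<close>

context compact_metric_group
begin

text \<open>As a matrix in \<open>i\<close> and \<open>j\<close>, this is the mean of the matrix of
  \<open>s\<close>, times the matrix unit at \<open>a\<close>, \<open>b\<close>, times the adjoint
  of the matrix of \<open>r\<close>: the averaging that turns an arbitrary linear map into an
  intertwiner.\<close>

definition coeff_mean :: "'g mrep \<Rightarrow> nat \<Rightarrow> 'g mrep \<Rightarrow> nat \<Rightarrow> nat \<Rightarrow> nat \<Rightarrow> complex" where
  "coeff_mean s a r b i j = mean (\<lambda>g. rep_mat s g i a * cnj (rep_mat r g j b))"

lemma coeff_mean_cnj:
  fixes r s :: "'g mrep"
  assumes "cont_unitary_rep r" "cont_unitary_rep s"
  shows "cnj (coeff_mean s a r b i j) = coeff_mean r b s a j i"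
  unfolding coeff_mean_def using assms
  by (subst mean_cnj[symmetric]) (auto intro!: continuous_intros cont_unitary_repD(3) simp: mult.commute)

lemma coeff_mean_intertwiner:
  fixes r s :: "'g mrep"
  assumes r: "cont_unitary_rep r" and s: "cont_unitary_rep s" and ab: "a < rep_dim s" "b < rep_dim r"
  shows "intertwiner r s (coeff_mean s a r b)"
  unfolding intertwiner_def
proof (intro conjI allI impI)
  fix i j assume "\<not> (i < rep_dim s \<and> j < rep_dim r)"
  then show "coeff_mean s a r b i j = 0"
    unfolding coeff_mean_def using cont_unitary_repD(2)[OF r] cont_unitary_repD(2)[OF s] by auto
next
  fix h i j assume ij: "i < rep_dim s" "j < rep_dim r"
  have c: "continuous_on UNIV (\<lambda>g. rep_mat s g i' a * cnj (rep_mat r g j' b))" for i' j'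
    by (intro continuous_intros cont_unitary_repD(3) r s)
  have cs: "continuous_on UNIV (\<lambda>g. rep_mat s g i' a)" for i' by (rule cont_unitary_repD(3)[OF s])
  have cr: "continuous_on UNIV (\<lambda>g. rep_mat r g j' b)" for j' by (rule cont_unitary_repD(3)[OF r])
  have "(\<Sum>k<rep_dim s. rep_mat s h i k * coeff_mean s a r b k j)
    = mean (\<lambda>g. \<Sum>k<rep_dim s. rep_mat s h i k * (rep_mat s g k a * cnj (rep_mat r g j b)))"
    unfolding coeff_mean_def by (rule mean_sum_cmult[symmetric]) (rule c)
  also have "\<dots> = mean (\<lambda>g. rep_mat s (h + g) i a * cnj (rep_mat r (- h + (h + g)) j b))"
    using ij ab by (simp add: cont_unitary_repD(4)[OF s] sum_distrib_right mult.assoc flip: add.assoc)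
  also have "\<dots> = mean (\<lambda>g. rep_mat s g i a * cnj (rep_mat r (- h + g) j b))"
    by (rule mean_left[of "\<lambda>g. rep_mat s g i a * cnj (rep_mat r (- h + g) j b)"])
      (intro continuous_intros cs continuous_on_compose2[OF cr] subset_UNIV)
  also have "\<dots> = mean (\<lambda>g. \<Sum>k<rep_dim r. rep_mat r h k j * (rep_mat s g i a * cnj (rep_mat r g k b)))"
    using ij ab by (simp add: cont_unitary_repD(4)[OF r] rep_mat_neg[OF r] sum_distrib_left mult.left_commute)
  also have "\<dots> = (\<Sum>k<rep_dim r. rep_mat r h k j * coeff_mean s a r b i k)"
    unfolding coeff_mean_def by (rule mean_sum_cmult) (rule c)
  finally show "(\<Sum>k<rep_dim r. coeff_mean s a r b i k * rep_mat r h k j)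
      = (\<Sum>k<rep_dim s. rep_mat s h i k * coeff_mean s a r b k j)"
    by (simp add: mult.commute)
qed

text \<open>A nonzero averaged matrix \<open>T\<close> has the intertwiner \<open>Q\<close> as its
  adjoint. Both products are scalar by Schur's lemma, with a common nonzero scalar, so
  \<open>T\<close> would be an equivalence.\<close>

lemma schur_orthogonality_inequivalent:
  fixes r s :: "'g mrep"
  assumes r: "irreducible_rep r" and s: "irreducible_rep s" and ne: "\<not> rep_equiv r s"
  shows "mean (\<lambda>g. rep_mat s g i a * cnj (rep_mat r g j b)) = 0"
proof (rule ccontr)
  note ru = irreducible_cont_unitary[OF r] and su = irreducible_cont_unitary[OF s]
  let ?m = "rep_dim r" and ?n = "rep_dim s"
  define T where "T = coeff_mean s a r b"
  define Q where "Q = coeff_mean r b s a"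
  assume "mean (\<lambda>g. rep_mat s g i a * cnj (rep_mat r g j b)) \<noteq> 0"
  then have Tij: "T i j \<noteq> 0" unfolding T_def coeff_mean_def .
  then have range: "i < ?n" "a < ?n" "j < ?m" "b < ?m"
    using cont_unitary_repD(2)[OF ru] cont_unitary_repD(2)[OF su]
    unfolding T_def coeff_mean_def by (auto simp: not_less intro: ccontr)
  have T: "intertwiner r s T" and Q: "intertwiner s r Q"
    unfolding T_def Q_def using range by (auto intro!: coeff_mean_intertwiner ru su)
  have QT_cnj: "Q k l = cnj (T l k)" for k l
    unfolding Q_def T_def using coeff_mean_cnj[OF ru su] by simp
  obtain c where c: "\<And>i j. i < ?m \<Longrightarrow> j < ?m \<Longrightarrow> mat_comp ?n Q T i j = (if i = j then c else 0)"
    using schur_scalar[OF r intertwiner_comp[OF T Q]] by blast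
  obtain c' where c': "\<And>i j. i < ?n \<Longrightarrow> j < ?n \<Longrightarrow> mat_comp ?m T Q i j = (if i = j then c' else 0)"
    using schur_scalar[OF s intertwiner_comp[OF Q T]] by blast
  have "c = of_real (\<Sum>k<?n. (cmod (T k j))\<^sup>2)"
    using c[OF range(3) range(3)] unfolding mat_comp_def QT_cnj
    by (simp add: complex_norm_square mult.commute del: of_real_power)
  moreover have "(\<Sum>k<?n. (cmod (T k j))\<^sup>2) > 0"
    using range Tij by (intro sum_pos2[of _ i]) auto
  ultimately have c0: "c \<noteq> 0" by (metis of_real_eq_0_iff less_irrefl)
  have "c' * T i j = (\<Sum>k<?n. mat_comp ?m T Q i k * T k j)"
    using range by (simp add: c' if_distrib[of "\<lambda>t. t * _"] cong: if_cong)
  also have "\<dots> = (\<Sum>k<?m. T i k * mat_comp ?n Q T k j)"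
    using fun_cong[OF fun_cong[OF mat_comp_assoc[of ?m T ?n Q T]], of i j] by (simp add: mat_comp_def)
  also have "\<dots> = c * T i j"
    using range by (simp add: c if_distrib[of "\<lambda>t. _ * t"] cong: if_cong)
  finally have cc: "c' = c" using Tij by simp
  \<comment> \<open>\<open>rep_equiv\<close> requires equal dimensions; they follow from the
    equality of the traces of \<open>Q T\<close> and \<open>T Q\<close>.\<close>
  have "of_nat ?m * c = (\<Sum>i<?m. mat_comp ?n Q T i i)" by (simp add: c)
  also have "\<dots> = (\<Sum>i<?n. mat_comp ?m T Q i i)"
    unfolding mat_comp_def by (subst sum.swap) (simp add: mult.commute)
  also have "\<dots> = of_nat ?n * c" by (simp add: c' cc)
  finally have d: "?m = ?n" using c0 by simp
  have "rep_equiv r s"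
    unfolding rep_equiv_def
  proof (rule conjI[OF d], rule exI[of _ T], rule exI[of _ "\<lambda>i j. Q i j / c"], intro conjI allI impI)
    fix i j assume ij: "i < ?m" "j < ?m"
    show "(\<Sum>k<?m. T i k * (Q k j / c)) = (if i = j then 1 else 0)"
      using c'[of i j] ij d cc c0 by (simp add: mat_comp_def flip: sum_divide_distrib)
    show "(\<Sum>k<?m. Q i k / c * T k j) = (if i = j then 1 else 0)"
      using c[of i j] ij d c0 by (simp add: mat_comp_def flip: sum_divide_distrib)
  qed (rule T)
  with ne show False ..
qed

text \<open>The averaged matrix is a scalar \<open>c\<close>, and its trace, computed by unitarity
  inside the mean, determines \<open>c\<close>.\<close>

lemma schur_orthogonality:
  fixes r :: "'g mrep"
  assumes r: "irreducible_rep r" and range: "i < rep_dim r" "j < rep_dim r" "a < rep_dim r" "b < rep_dim r"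
  shows "mean (\<lambda>g. rep_mat r g i a * cnj (rep_mat r g j b)) = (if i = j \<and> a = b then 1 / of_nat (rep_dim r) else 0)"
proof -
  note ru = irreducible_cont_unitary[OF r]
  let ?d = "rep_dim r"
  have "intertwiner r r (coeff_mean r a r b)" using range by (intro coeff_mean_intertwiner ru)
  then obtain c where c: "\<And>i j. i < ?d \<Longrightarrow> j < ?d \<Longrightarrow> coeff_mean r a r b i j = (if i = j then c else 0)"
    using schur_scalar[OF r] by blast
  have "of_nat ?d * c = (\<Sum>i<?d. coeff_mean r a r b i i)" by (simp add: c)
  also have "\<dots> = mean (\<lambda>g. \<Sum>i<?d. rep_mat r g i a * cnj (rep_mat r g i b))"
    unfolding coeff_mean_def by (rule mean_sum[symmetric]) (intro continuous_intros cont_unitary_repD(3) ru)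
  also have "\<dots> = mean (\<lambda>g::'g. if a = b then 1 else 0)"
    unfolding mult.commute[of "rep_mat r _ _ a"] cont_unitary_repD(6)[OF ru range(4,3)]
    by (simp add: eq_commute[of b])
  also have "\<dots> = (if a = b then 1 else 0)" by simp
  finally have "c = (if a = b then 1 else 0) / of_nat ?d"
    using cont_unitary_repD(1)[OF ru] by (simp add: field_simps split: if_splits)
  then show ?thesis using c[OF range(1,2)] unfolding coeff_mean_def by auto
qed

lemma chr_orthogonality:
  fixes r s :: "'g mrep"
  assumes r: "irreducible_rep r" and s: "irreducible_rep s"
  shows "mean (\<lambda>g. chr s g * cnj (chr r g)) = (if rep_equiv r s then 1 else 0)"
proof -
  note ru = irreducible_cont_unitary[OF r] and su = irreducible_cont_unitary[OF s]
  have expand: "mean (\<lambda>g. chr t g * cnj (chr r g))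
      = (\<Sum>i<rep_dim t. \<Sum>j<rep_dim r. mean (\<lambda>g. rep_mat t g i i * cnj (rep_mat r g j j)))"
    if "cont_unitary_rep t" for t
  proof -
    have c: "continuous_on UNIV (\<lambda>g. rep_mat t g i i * cnj (rep_mat r g j j))" for i j
      by (intro continuous_intros cont_unitary_repD(3) ru that)
    then have c': "continuous_on UNIV (\<lambda>g. \<Sum>j<rep_dim r. rep_mat t g i i * cnj (rep_mat r g j j))" for i
      by (intro continuous_on_sum)
    show ?thesis
      unfolding chr_def cnj_sum sum_product by (simp only: mean_sum[OF c'] mean_sum[OF c])
  qed
  show ?thesis
  proof (cases "rep_equiv r s")
    case True
    have "mean (\<lambda>g. chr s g * cnj (chr r g)) = mean (\<lambda>g. chr r g * cnj (chr r g))"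
      using rep_equiv_chr[OF True] by simp
    also have "\<dots> = (\<Sum>i<rep_dim r. \<Sum>j<rep_dim r. if i = j then 1 / of_nat (rep_dim r) else 0)"
      unfolding expand[OF ru] by (intro sum.cong refl) (simp add: schur_orthogonality[OF r])
    also have "\<dots> = 1" using cont_unitary_repD(1)[OF ru] by simp
    finally show ?thesis using True by simp
  next
    case False
    then show ?thesis unfolding expand[OF su] by (simp add: schur_orthogonality_inequivalent[OF r s])
  qed
qed

text \<open>Turns equivalence into an equality of functions, so its symmetry and transitivity on
  irreducibles come for free.\<close>

lemma rep_equiv_iff_chr:
  fixes r s :: "'g mrep"
  assumes r: "irreducible_rep r" and s: "irreducible_rep s"
  shows "rep_equiv r s \<longleftrightarrow> chr r = chr s"
proof
  assume "chr r = chr s"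
  then show "rep_equiv r s"
    using chr_orthogonality[OF r s] chr_orthogonality[OF r r] rep_equiv_refl[of r]
    by (simp split: if_splits)
qed (auto simp: rep_equiv_chr)

end

section \<open>Decomposition into irreducible representations\<close>

definition cip :: "nat \<Rightarrow> (nat \<Rightarrow> complex) \<Rightarrow> (nat \<Rightarrow> complex) \<Rightarrow> complex" where
  "cip d v w = (\<Sum>i<d. v i * cnj (w i))"

lemma cvecs_outside: "v \<in> cvecs d \<Longrightarrow> \<not> i < d \<Longrightarrow> v i = 0"
  by (simp add: cvecs_def)

interpretation cvecs: herm_space "cvecs d" "cip d" for d
proof
  fix x y z :: "nat \<Rightarrow> complex" and c
  show "cip d (\<lambda>t. x t + y t) z = cip d x z + cip d y z"
    by (simp add: cip_def distrib_right sum.distrib)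
  show "cip d (\<lambda>t. c * x t) z = c * cip d x z"
    by (simp add: cip_def sum_distrib_left mult.assoc)
  show "cip d y x = cnj (cip d x y)" by (simp add: cip_def mult.commute)
  have sq: "cip d x x = of_real (\<Sum>i<d. (cmod (x i))\<^sup>2)"
    by (simp add: cip_def complex_norm_square del: of_real_power)
  show "0 \<le> Re (cip d x x)" unfolding sq by (simp add: sum_nonneg)
  show "x = (\<lambda>_. 0)" if x: "x \<in> cvecs d" "cip d x x = 0"
  proof
    fix i
    have "(\<Sum>i<d. (cmod (x i))\<^sup>2) = 0" using x(2) unfolding sq of_real_eq_0_iff .
    then have "\<forall>i\<in>{..<d}. (cmod (x i))\<^sup>2 = 0" by (subst (asm) sum_nonneg_eq_0_iff) auto
    then show "x i = 0" using cvecs_outside[OF x(1), of i] by (cases "i < d") auto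
  qed
qed (auto simp: cvecs_def)

definition unit_vec :: "nat \<Rightarrow> nat \<Rightarrow> complex" where
  "unit_vec j = (\<lambda>i. if i = j then 1 else 0)"

lemma unit_vec_closed: "j < d \<Longrightarrow> unit_vec j \<in> cvecs d"
  by (auto simp: unit_vec_def cvecs_def)

lemma cip_unit_vec: "j < d \<Longrightarrow> cip d (unit_vec j) v = cnj (v j)"
  by (simp add: cip_def unit_vec_def sum_delta_mult_right)

lemma mat_vec_unit_vec: "i < d \<Longrightarrow> j < d \<Longrightarrow> mat_vec d A (unit_vec j) i = A i j"
  by (simp add: mat_vec_def unit_vec_def sum_delta_mult_right)

text \<open>The sum of the squared norms of the \<open>n\<close> vectors, taken coordinate by
  coordinate, is at most \<open>d\<close> by Bessel's inequality for the unit vectors.\<close>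

lemma cvecs_orthonormal_bound:
  assumes "cvecs.orthonormal d e n"
  shows "n \<le> d"
proof -
  have e: "cip d (e i) (e i) = 1" if "i < n" for i using cvecs.orthonormal_ip[OF assms that that] by simp
  have "complex_of_real (real n) = (\<Sum>i<n. cip d (e i) (e i))" by (simp add: e)
  also have "\<dots> = of_real (\<Sum>j<d. \<Sum>i<n. (cmod (e i j))\<^sup>2)"
    unfolding cip_def by (subst sum.swap) (simp add: complex_norm_square del: of_real_power)
  finally have "real n = (\<Sum>j<d. \<Sum>i<n. (cmod (e i j))\<^sup>2)" unfolding of_real_eq_iff .
  also have "\<dots> \<le> (\<Sum>j<d. 1)"
  proof (rule sum_mono)
    fix j assume "j \<in> {..<d}"
    then have j: "j < d" by simp
    have "(\<Sum>i<n. (cmod (cip d (unit_vec j) (e i)))\<^sup>2) \<le> Re (cip d (unit_vec j) (unit_vec j))"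
      by (rule cvecs.bessel[OF assms unit_vec_closed[OF j]])
    then show "(\<Sum>i<n. (cmod (e i j))\<^sup>2) \<le> 1"
      by (simp add: cip_unit_vec[OF j]) (simp add: unit_vec_def)
  qed
  finally show ?thesis by simp
qed

section \<open>Subrepresentations and complete reducibility\<close>

lemma mat_vec_add: "mat_vec d A (\<lambda>i. v i + w i) = (\<lambda>i. mat_vec d A v i + mat_vec d A w i)"
  by (auto simp: mat_vec_def distrib_left sum.distrib)

lemma rep_action:
  assumes s: "cont_unitary_rep s"
  defines "S \<equiv> \<lambda>g. mat_vec (rep_dim s) (rep_mat s g)"
  shows "S (g + h) v = S g (S h v)"
    and "v \<in> cvecs (rep_dim s) \<Longrightarrow> S 0 v = v"
    and "cip (rep_dim s) (S g v) (S g w) = cip (rep_dim s) v w"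
    and "continuous_on UNIV (\<lambda>g. cip (rep_dim s) (S g v) w)"
proof -
  let ?d = "rep_dim s" and ?u = "rep_mat s"
  show "S (g + h) v = S g (S h v)"
  proof
    fix i
    show "S (g + h) v i = S g (S h v) i"
    proof (cases "i < ?d")
      case True
      then have "S (g + h) v i = (\<Sum>j<?d. (\<Sum>k<?d. ?u g i k * ?u h k j) * v j)"
        by (simp add: S_def mat_vec_def cont_unitary_repD(4)[OF s])
      also have "\<dots> = S g (S h v) i"
        using True unfolding S_def mat_vec_def
        by (simp add: sum_distrib_left sum_distrib_right mult.assoc) (rule sum.swap)
      finally show ?thesis .
    qed (simp add: S_def mat_vec_def)
  qed
  show "S 0 v = v" if "v \<in> cvecs ?d"
    using cvecs_outside[OF that]
    by (auto simp: S_def mat_vec_def rep_mat_zero[OF s] sum_delta_mult_right fun_eq_iff)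
  have "cip ?d (S g v) (S g w) = (\<Sum>i<?d. \<Sum>j<?d. \<Sum>k<?d. (v j * cnj (w k)) * (cnj (?u g i k) * ?u g i j))"
    unfolding cip_def S_def by (intro sum.cong refl) (simp add: mat_vec_def sum_product ac_simps)
  also have "\<dots> = (\<Sum>j<?d. \<Sum>k<?d. (v j * cnj (w k)) * (\<Sum>i<?d. cnj (?u g i k) * ?u g i j))"
    unfolding sum_distrib_left by (subst sum.swap) (intro sum.cong refl sum.swap)
  also have "\<dots> = (\<Sum>j<?d. \<Sum>k<?d. (v j * cnj (w k)) * (if k = j then 1 else 0))"
    by (intro sum.cong refl) (simp add: cont_unitary_repD(6)[OF s])
  also have "\<dots> = cip ?d v w" unfolding cip_def
    by (intro sum.cong refl) (simp add: sum_delta_mult_right)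
  finally show "cip ?d (S g v) (S g w) = cip ?d v w" .
  show "continuous_on UNIV (\<lambda>g. cip ?d (S g v) w)"
    unfolding cip_def
  proof (intro continuous_intros)
    fix i
    show "continuous_on UNIV (\<lambda>g. S g v i)"
      unfolding S_def mat_vec_def
      by (cases "i < ?d") (auto intro!: continuous_intros cont_unitary_repD(3)[OF s])
  qed
qed

text \<open>Restricts the action to an orthonormal basis of \<open>W\<close>. The zero subspace has
  \<open>n = 0\<close>, while a representation must have positive dimension, hence the condition
  \<open>n \<ge> 1\<close>.\<close>

lemma subrepresentation:
  fixes s :: "'g::topological_group_add mrep"
  assumes s: "cont_unitary_rep s" and W: "invariant_subspace s W"
  obtains e n and r :: "'g mrep" where "cvecs.orthonormal (rep_dim s) e n" "\<And>i. i < n \<Longrightarrow> e i \<in> W"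
    "\<And>v. v \<in> W \<Longrightarrow> cvecs.proj (rep_dim s) e n v = v"
    "rep_dim r = n" "n \<ge> 1 \<Longrightarrow> cont_unitary_rep r"
    "\<And>g j. j < n \<Longrightarrow> mat_vec (rep_dim s) (rep_mat s g) (e j) = (\<lambda>t. \<Sum>i<n. rep_mat r g i j * e i t)"
proof -
  let ?d = "rep_dim s"
  interpret W: herm_space W "cip ?d"
    by (rule cvecs.subspace) (use W in \<open>auto simp: invariant_subspace_def\<close>)
  have Wsub: "W \<subseteq> cvecs ?d" using W by (simp add: invariant_subspace_def)
  have orth: "cvecs.orthonormal ?d e n" if "W.orthonormal e n" for e n
    using that Wsub unfolding W.orthonormal_def cvecs.orthonormal_def by auto
  have "n \<le> ?d" if "W.orthonormal e n" for e n
    using cvecs_orthonormal_bound[OF orth[OF that]] .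
  then obtain e n where e: "W.orthonormal e n" and basis: "\<And>x. x \<in> W \<Longrightarrow> W.proj e n x = x"
    by (rule W.orthonormal_basis_ex) blast+
  interpret A: unitary_action W "cip ?d" "\<lambda>g. mat_vec ?d (rep_mat s g)" e n
  proof unfold_locales
    show "mat_vec ?d (rep_mat s g) x \<in> W" if "x \<in> W" for g x
      using that W by (simp add: invariant_subspace_def)
  qed (use e basis Wsub in \<open>auto simp: rep_action[OF s] mat_vec_lincomb\<close>)
  show ?thesis
  proof (rule that[of e n "matrix_rep (cip ?d) (\<lambda>g. mat_vec ?d (rep_mat s g)) e n"])
    show "cvecs.proj ?d e n v = v" if "v \<in> W" for v
      using basis[OF that] by (simp add: W.proj_def cvecs.proj_def)
  qed (use orth[OF e] W.orthonormal_closed[OF e] A.cont_unitary_matrix_rep A.action_expand in auto)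
qed

text \<open>The orthogonal complement \<open>P\<close> of a proper invariant subspace is invariant
  by unitarity. The expansion of the matrix entries is recorded besides the character, since
  \<open>decomposition\<close> must also control single coefficients.\<close>

lemma reducible_split:
  fixes s :: "'g::topological_group_add mrep"
  assumes s: "cont_unitary_rep s" and red: "\<not> irreducible_rep s"
  obtains r1 r2 :: "'g mrep" and C1 C2 where
    "cont_unitary_rep r1" "cont_unitary_rep r2" "rep_dim r1 < rep_dim s" "rep_dim r2 < rep_dim s"
    "\<And>g. chr s g = chr r1 g + chr r2 g"
    "\<And>g i j. i < rep_dim s \<Longrightarrow> j < rep_dim s \<Longrightarrow> rep_mat s g i j =
       (\<Sum>b<rep_dim r1. \<Sum>a<rep_dim r1. C1 i j a b * rep_mat r1 g a b) +
       (\<Sum>b<rep_dim r2. \<Sum>a<rep_dim r2. C2 i j a b * rep_mat r2 g a b)"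
proof -
  let ?d = "rep_dim s"
  define S where "S g = mat_vec ?d (rep_mat s g)" for g
  obtain W where W: "invariant_subspace s W" and W0: "W \<noteq> {\<lambda>_. 0}" and W1: "W \<noteq> cvecs ?d"
    using s red unfolding irreducible_rep_def by blast
  have Wsub: "W \<subseteq> cvecs ?d" using W by (simp add: invariant_subspace_def)
  define P where "P = {v \<in> cvecs ?d. \<forall>w\<in>W. cip ?d v w = 0}"
  have P: "invariant_subspace s P"
    unfolding invariant_subspace_def
  proof (intro conjI ballI allI)
    show "P \<subseteq> cvecs ?d" by (auto simp: P_def)
    show "(\<lambda>_. 0) \<in> P" by (auto simp: P_def cvecs_def cip_def)
    show "(\<lambda>i. v i + w i) \<in> P" if "v \<in> P" "w \<in> P" for v w
      using that Wsub unfolding P_def by (auto simp: cvecs.add_closed cvecs.ip_add subset_iff)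
    show "(\<lambda>i. c * v i) \<in> P" if "v \<in> P" for c v
      using that Wsub unfolding P_def by (auto simp: cvecs.scale_closed cvecs.ip_scale subset_iff)
    show "mat_vec ?d (rep_mat s g) v \<in> P" if "v \<in> P" for g v
    proof -
      have "cip ?d (S g v) w = 0" if "w \<in> W" for w
      proof -
        have "cip ?d (S g v) w = cip ?d (S (- g) (S g v)) (S (- g) w)"
          unfolding S_def rep_action(3)[OF s] ..
        also have "S (- g) (S g v) = v"
          using rep_action(1)[OF s, of "- g" g v] rep_action(2)[OF s, of v] \<open>v \<in> P\<close>
          by (simp add: S_def P_def)
        also have "cip ?d v (S (- g) w) = 0"
          using \<open>v \<in> P\<close> W \<open>w \<in> W\<close> by (simp add: P_def S_def invariant_subspace_def)
        finally show ?thesis .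
      qed
      then show ?thesis by (simp add: P_def mat_vec_closed S_def)
    qed
  qed
  obtain e n and r1 :: "'g mrep" where e: "cvecs.orthonormal ?d e n" "\<And>i. i < n \<Longrightarrow> e i \<in> W"
    and eb: "\<And>v. v \<in> W \<Longrightarrow> cvecs.proj ?d e n v = v"
    and r1: "rep_dim r1 = n" "n \<ge> 1 \<Longrightarrow> cont_unitary_rep r1"
    and Se: "\<And>g j. j < n \<Longrightarrow> mat_vec ?d (rep_mat s g) (e j) = (\<lambda>t. \<Sum>i<n. rep_mat r1 g i j * e i t)"
    by (rule subrepresentation[OF s W]) (rule that, assumption+)
  obtain f m and r2 :: "'g mrep" where f: "cvecs.orthonormal ?d f m" "\<And>i. i < m \<Longrightarrow> f i \<in> P"
    and fb: "\<And>v. v \<in> P \<Longrightarrow> cvecs.proj ?d f m v = v"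
    and r2: "rep_dim r2 = m" "m \<ge> 1 \<Longrightarrow> cont_unitary_rep r2"
    and Sf: "\<And>g j. j < m \<Longrightarrow> mat_vec ?d (rep_mat s g) (f j) = (\<lambda>t. \<Sum>i<m. rep_mat r2 g i j * f i t)"
    by (rule subrepresentation[OF s P]) (rule that, assumption+)
  have eC: "e i \<in> cvecs ?d" if "i < n" for i using e(2)[OF that] Wsub by blast
  have fC: "f i \<in> cvecs ?d" if "i < m" for i using f(2)[OF that] by (simp add: P_def)
  have fe: "cip ?d (f j) (e i) = 0" if "j < m" "i < n" for i j
    using f(2)[OF that(1)] e(2)[OF that(2)] by (simp add: P_def)
  have ef: "cip ?d (e i) (f j) = 0" if "j < m" "i < n" for i j
    using fe[OF that] cvecs.ip_cnj[OF fC[OF that(1)] eC[OF that(2)]] by simp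
  have res: "(\<lambda>t. v t - cvecs.proj ?d e n v t) \<in> P" if v: "v \<in> cvecs ?d" for v
  proof -
    let ?r = "\<lambda>t. v t - cvecs.proj ?d e n v t"
    have r: "?r \<in> cvecs ?d" by (intro cvecs.diff_closed v cvecs.proj_closed e)
    have "cip ?d ?r w = 0" if "w \<in> W" for w
    proof -
      have "cip ?d ?r w = cip ?d ?r (cvecs.proj ?d e n w)" using eb[OF that] by simp
      also have "\<dots> = (\<Sum>i<n. cnj (cip ?d w (e i)) * cip ?d ?r (e i))"
        unfolding cvecs.proj_def[of ?d e n w] using r eC by (intro cvecs.ip_lincomb_right) auto
      also have "\<dots> = 0" using cvecs.residual_orthogonal[OF e(1) _ v] by simp
      finally show ?thesis .
    qed
    then show ?thesis using r by (simp add: P_def)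
  qed
  have decomp: "v = (\<lambda>t. (\<Sum>i<n. cip ?d v (e i) * e i t) + (\<Sum>i<m. cip ?d v (f i) * f i t))"
    if v: "v \<in> cvecs ?d" for v
  proof -
    let ?p = "cvecs.proj ?d e n v"
    have p: "?p \<in> cvecs ?d" by (rule cvecs.proj_closed[OF e(1)])
    have "cip ?d ?p (f j) = 0" if "j < m" for j
      unfolding cvecs.proj_def using eC fC[OF that] ef[OF that] by (subst cvecs.ip_lincomb) auto
    then have "cip ?d (\<lambda>t. v t - ?p t) (f j) = cip ?d v (f j)" if "j < m" for j
      using cvecs.ip_diff[OF v p fC[OF that]] that by simp
    then have "(\<lambda>t. v t - ?p t) = (\<lambda>t. \<Sum>i<m. cip ?d v (f i) * f i t)"
      using fb[OF res[OF v]] by (simp add: cvecs.proj_def)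
    then show ?thesis unfolding fun_eq_iff cvecs.proj_def by (simp add: diff_eq_eq add.commute)
  qed
  have n1: "n \<ge> 1"
  proof (rule ccontr)
    assume "\<not> n \<ge> 1"
    then have "n = 0" by simp
    then have "v = (\<lambda>_. 0)" if "v \<in> W" for v using eb[OF that] by (simp add: cvecs.proj_def)
    then show False using W0 W by (auto simp: invariant_subspace_def)
  qed
  have m1: "m \<ge> 1"
  proof (rule ccontr)
    assume "\<not> m \<ge> 1"
    then have "m = 0" by simp
    then have "v t - cvecs.proj ?d e n v t = 0" if "v \<in> cvecs ?d" for v t
      using fun_cong[OF fb[OF res[OF that]], of t] by (simp add: cvecs.proj_def)
    then have pv: "cvecs.proj ?d e n v = v" if "v \<in> cvecs ?d" for v using that by fastforce
    have "cvecs.proj ?d e n v \<in> W" for v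
    proof -
      interpret W: herm_space W "cip ?d"
        by (rule cvecs.subspace) (use W in \<open>auto simp: invariant_subspace_def\<close>)
      show ?thesis unfolding cvecs.proj_def using e(2) by (intro W.lincomb_closed) auto
    qed
    then show False using pv W1 Wsub by (metis subset_antisym subsetI)
  qed
  \<comment> \<open>Together the two bases form one orthonormal family; with \<open>n1\<close> and
    \<open>m1\<close> this makes both dimensions strictly smaller than
    \<open>rep_dim s\<close>.\<close>
  have nm: "n + m \<le> ?d"
  proof (rule cvecs_orthonormal_bound)
    show "cvecs.orthonormal ?d (\<lambda>i. if i < n then e i else f (i - n)) (n + m)"
      using e(1) f(1) fe ef unfolding cvecs.orthonormal_def by auto
  qed
  \<comment> \<open>The coefficients arise from expanding \<open>unit_vec j\<close> in the joint
    basis, acting by \<open>g\<close> and reading off coordinate \<open>i\<close>.\<close>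
  define C1 where "C1 i j a b = cnj (e b j) * e a i" for i j a b
  define C2 where "C2 i j a b = cnj (f b j) * f a i" for i j a b
  have coeff: "rep_mat s g i j = (\<Sum>b<n. \<Sum>a<n. C1 i j a b * rep_mat r1 g a b) +
       (\<Sum>b<m. \<Sum>a<m. C2 i j a b * rep_mat r2 g a b)" if ij: "i < ?d" "j < ?d" for g i j
  proof -
    have "rep_mat s g i j = S g (unit_vec j) i" using ij by (simp add: S_def mat_vec_unit_vec)
    also have "unit_vec j = (\<lambda>t. (\<Sum>b<n. cnj (e b j) * e b t) + (\<Sum>b<m. cnj (f b j) * f b t))"
      using decomp[OF unit_vec_closed[OF ij(2)]] by (simp only: cip_unit_vec[OF ij(2)])
    also have "S g \<dots> i = (\<Sum>b<n. cnj (e b j) * S g (e b) i) + (\<Sum>b<m. cnj (f b j) * S g (f b) i)"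
      unfolding S_def mat_vec_add mat_vec_lincomb ..
    finally show ?thesis
      by (simp add: S_def Se Sf C1_def C2_def sum_distrib_left ac_simps)
  qed
  have trace: "(\<Sum>i<?d. \<Sum>b<k. \<Sum>a<k. (cnj (x b i) * x a i) * u a b) = (\<Sum>a<k. u a a)"
    if "cvecs.orthonormal ?d x k" for x k and u :: "nat \<Rightarrow> nat \<Rightarrow> complex"
  proof -
    have "(\<Sum>i<?d. \<Sum>b<k. \<Sum>a<k. (cnj (x b i) * x a i) * u a b)
      = (\<Sum>b<k. \<Sum>a<k. \<Sum>i<?d. (cnj (x b i) * x a i) * u a b)"
      by (subst sum.swap) (intro sum.cong refl sum.swap)
    also have "\<dots> = (\<Sum>b<k. \<Sum>a<k. cip ?d (x a) (x b) * u a b)"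
      unfolding cip_def sum_distrib_right by (simp add: mult.commute[of "cnj _"])
    also have "\<dots> = (\<Sum>b<k. \<Sum>a<k. (if a = b then 1 else 0) * u a b)"
      by (intro sum.cong refl) (simp add: cvecs.orthonormal_ip[OF that])
    also have "\<dots> = (\<Sum>b<k. u b b)" by (intro sum.cong refl) (simp add: sum_delta_mult_right)
    finally show ?thesis .
  qed
  show ?thesis
  proof (rule that[of r1 r2 C1 C2])
    show "chr s g = chr r1 g + chr r2 g" for g
    proof -
      have "chr s g = (\<Sum>i<?d. (\<Sum>b<n. \<Sum>a<n. (cnj (e b i) * e a i) * rep_mat r1 g a b) +
         (\<Sum>b<m. \<Sum>a<m. (cnj (f b i) * f a i) * rep_mat r2 g a b))"
        unfolding chr_def by (intro sum.cong refl) (simp add: coeff C1_def C2_def)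
      also have "\<dots> = chr r1 g + chr r2 g"
        unfolding sum.distrib trace[OF e(1)] trace[OF f(1)] chr_def r1(1) r2(1) ..
      finally show ?thesis .
    qed
  qed (use r1 r2 n1 m1 nm coeff in auto)
qed

context compact_metric_group
begin

text \<open>Induction on the dimension. In place of an isomorphism with a direct sum, the last
  clause keeps what \<open>fmult_nonzero_iff\<close> will use: a coefficient orthogonal to all
  coefficients of the constituents is orthogonal to those of \<open>s\<close>.\<close>

lemma decomposition:
  fixes s :: "'g mrep"
  assumes "cont_unitary_rep s"
  shows "\<exists>rs :: 'g mrep list. (\<forall>r\<in>set rs. irreducible_rep r) \<and> (\<forall>g. chr s g = (\<Sum>r\<leftarrow>rs. chr r g)) \<and>
    (\<forall>t k l. cont_unitary_rep t \<longrightarrow> (\<forall>r\<in>set rs. \<forall>a b. mean (\<lambda>g. rep_mat r g a b * cnj (rep_mat t g k l)) = 0)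
      \<longrightarrow> (\<forall>i j. mean (\<lambda>g. rep_mat s g i j * cnj (rep_mat t g k l)) = 0))"
  using assms
proof (induction "rep_dim s" arbitrary: s rule: less_induct)
  case less
  show ?case
  proof (cases "irreducible_rep s")
    case True
    then show ?thesis by (intro exI[of _ "[s]"]) auto
  next
    case False
    obtain r1 r2 :: "'g mrep" and C1 C2 where r: "cont_unitary_rep r1" "cont_unitary_rep r2"
      and dims: "rep_dim r1 < rep_dim s" "rep_dim r2 < rep_dim s"
      and chr: "\<And>g. chr s g = chr r1 g + chr r2 g"
      and coeff: "\<And>g i j. i < rep_dim s \<Longrightarrow> j < rep_dim s \<Longrightarrow> rep_mat s g i j =
       (\<Sum>b<rep_dim r1. \<Sum>a<rep_dim r1. C1 i j a b * rep_mat r1 g a b) +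
       (\<Sum>b<rep_dim r2. \<Sum>a<rep_dim r2. C2 i j a b * rep_mat r2 g a b)"
      by (rule reducible_split[OF less.prems False]) (rule that, assumption+)
    obtain rs1 :: "'g mrep list" where rs1: "\<forall>r\<in>set rs1. irreducible_rep r" "\<And>g. chr r1 g = (\<Sum>r\<leftarrow>rs1. chr r g)"
      "\<And>t k l i j. cont_unitary_rep t \<Longrightarrow> (\<forall>r\<in>set rs1. \<forall>a b. mean (\<lambda>g. rep_mat r g a b * cnj (rep_mat t g k l)) = 0)
       \<Longrightarrow> mean (\<lambda>g. rep_mat r1 g i j * cnj (rep_mat t g k l)) = 0"
      using less.hyps[OF dims(1) r(1)] by blast
    obtain rs2 :: "'g mrep list" where rs2: "\<forall>r\<in>set rs2. irreducible_rep r" "\<And>g. chr r2 g = (\<Sum>r\<leftarrow>rs2. chr r g)"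
      "\<And>t k l i j. cont_unitary_rep t \<Longrightarrow> (\<forall>r\<in>set rs2. \<forall>a b. mean (\<lambda>g. rep_mat r g a b * cnj (rep_mat t g k l)) = 0)
       \<Longrightarrow> mean (\<lambda>g. rep_mat r2 g i j * cnj (rep_mat t g k l)) = 0"
      using less.hyps[OF dims(2) r(2)] by blast
    have "mean (\<lambda>g. rep_mat s g i j * cnj (rep_mat t g k l)) = 0"
      if t: "cont_unitary_rep t"
        and 0: "\<forall>r\<in>set (rs1 @ rs2). \<forall>a b. mean (\<lambda>g. rep_mat r g a b * cnj (rep_mat t g k l)) = 0"
      for t k l i j
    proof (cases "i < rep_dim s \<and> j < rep_dim s")
      case True
      have z1: "mean (\<lambda>g. rep_mat r1 g a b * cnj (rep_mat t g k l)) = 0" for a b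
        using 0 by (intro rs1(3)[OF t]) auto
      have z2: "mean (\<lambda>g. rep_mat r2 g a b * cnj (rep_mat t g k l)) = 0" for a b
        using 0 by (intro rs2(3)[OF t]) auto
      have c: "continuous_on UNIV (\<lambda>g. rep_mat q g a b * cnj (rep_mat t g k l))"
        if "cont_unitary_rep q" for q a b
        by (intro continuous_intros cont_unitary_repD(3) that t)
      have c': "continuous_on UNIV (\<lambda>g. \<Sum>a<n. D a * (rep_mat q g a b * cnj (rep_mat t g k l)))"
        if "cont_unitary_rep q" for q b D and n :: nat
        by (intro continuous_intros cont_unitary_repD(3) that t)
      have lin: "mean (\<lambda>g. \<Sum>b<n. \<Sum>a<n. D a b * (rep_mat q g a b * cnj (rep_mat t g k l)))
         = (\<Sum>b<n. \<Sum>a<n. D a b * mean (\<lambda>g. rep_mat q g a b * cnj (rep_mat t g k l)))"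
        if "cont_unitary_rep q" for q D and n :: nat
        by (simp only: mean_sum[OF c'[OF that]] mean_sum_cmult[OF c[OF that]])
      have "mean (\<lambda>g. rep_mat s g i j * cnj (rep_mat t g k l)) =
        mean (\<lambda>g. (\<Sum>b<rep_dim r1. \<Sum>a<rep_dim r1. C1 i j a b * (rep_mat r1 g a b * cnj (rep_mat t g k l))) +
          (\<Sum>b<rep_dim r2. \<Sum>a<rep_dim r2. C2 i j a b * (rep_mat r2 g a b * cnj (rep_mat t g k l))))"
        using True by (simp add: coeff distrib_right sum_distrib_right mult.assoc)
      also have "\<dots> = mean (\<lambda>g. \<Sum>b<rep_dim r1. \<Sum>a<rep_dim r1. C1 i j a b * (rep_mat r1 g a b * cnj (rep_mat t g k l)))
         + mean (\<lambda>g. \<Sum>b<rep_dim r2. \<Sum>a<rep_dim r2. C2 i j a b * (rep_mat r2 g a b * cnj (rep_mat t g k l)))"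
        by (rule mean_add; intro continuous_on_sum c' r)
      also have "\<dots> = 0" unfolding lin[OF r(1)] lin[OF r(2)] z1 z2 by simp
      finally show ?thesis .
    qed (simp add: cont_unitary_repD(2)[OF less.prems])
    then show ?thesis
      using rs1(1,2) rs2(1,2) chr by (intro exI[of _ "rs1 @ rs2"]) auto
  qed
qed

end

section \<open>Multiplicities\<close>

text \<open>Decodes the index of a tensor product: \<open>k\<close> stands for the pair of its
  quotient and remainder modulo \<open>n\<close>.\<close>

lemma sum_div_mod:
  fixes f :: "nat \<Rightarrow> nat \<Rightarrow> 'b::comm_monoid_add"
  shows "(\<Sum>k<m * n. f (k div n) (k mod n)) = (\<Sum>i<m. \<Sum>j<n. f i j)"
proof -
  have "(\<Sum>k<m * n. f (k div n) (k mod n)) = (\<Sum>i<m. \<Sum>k\<in>{i * n..<i * n + n}. f (k div n) (k mod n))"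
    by (rule sum.nat_group[symmetric])
  also have "\<dots> = (\<Sum>i<m. \<Sum>j<n. f i j)"
  proof (rule sum.cong[OF refl])
    fix i
    have "(\<Sum>k\<in>{i * n..<i * n + n}. f (k div n) (k mod n)) = (\<Sum>j\<in>{0..<n}. f ((j + i * n) div n) ((j + i * n) mod n))"
      using sum.shift_bounds_nat_ivl[of "\<lambda>k. f (k div n) (k mod n)" 0 "i * n" n] by (simp add: add.commute)
    also have "\<dots> = (\<Sum>j<n. f i j)" unfolding atLeast0LessThan by (intro sum.cong) auto
    finally show "(\<Sum>k\<in>{i * n..<i * n + n}. f (k div n) (k mod n)) = (\<Sum>j<n. f i j)" .
  qed
  finally show ?thesis .
qed

section \<open>Tensor products, conjugates and multiplicities\<close>

lemma rep_dim_tensor [simp]: "rep_dim (rep_tensor r s) = rep_dim r * rep_dim s"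
  by (simp add: rep_tensor_def rep_dim_def)

lemma rep_mat_tensor:
  "rep_mat (rep_tensor r s) g i j = (if i < rep_dim r * rep_dim s \<and> j < rep_dim r * rep_dim s
      then rep_mat r g (i div rep_dim s) (j div rep_dim s) * rep_mat s g (i mod rep_dim s) (j mod rep_dim s)
      else 0)"
  unfolding rep_tensor_def rep_mat_def[of "(_, _)"] by simp

lemma sum_tensor_product:
  fixes f f' :: "nat \<Rightarrow> complex"
  shows "(\<Sum>k<m * n. f (k div n) * f' (k mod n)) = (\<Sum>i<m. f i) * (\<Sum>j<n. f' j)"
  using sum_div_mod[where f = "\<lambda>i j. f i * f' j"] by (simp add: sum_product)

lemma cont_unitary_tensor:
  assumes r: "cont_unitary_rep r" and s: "cont_unitary_rep s"
  shows "cont_unitary_rep (rep_tensor r s)"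
proof -
  let ?m = "rep_dim r" and ?n = "rep_dim s" and ?u = "rep_mat (rep_tensor r s)"
  have n: "?n > 0" using cont_unitary_repD(1)[OF s] by simp
  have dm: "i div ?n < ?m" "i mod ?n < ?n" if "i < ?m * ?n" for i
    using that n by (simp_all add: less_mult_imp_div_less)
  have eq: "(i div ?n = j div ?n \<and> i mod ?n = j mod ?n) = (i = j)" for i j
    by (metis mult_div_mod_eq)
  have 1: "1 \<le> ?m * ?n" using cont_unitary_repD(1)[OF r] n by simp
  have 2: "\<forall>g i j. \<not> (i < ?m * ?n \<and> j < ?m * ?n) \<longrightarrow> ?u g i j = 0"
    unfolding rep_mat_tensor by auto
  have 3: "continuous_on UNIV (\<lambda>g. ?u g i j)" for i j
    unfolding rep_mat_tensor
    by (cases "i < ?m * ?n \<and> j < ?m * ?n")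
      (auto intro!: continuous_intros cont_unitary_repD(3)[OF r] cont_unitary_repD(3)[OF s])
  have 4: "?u (g + h) i j = (\<Sum>k<?m * ?n. ?u g i k * ?u h k j)" if ij: "i < ?m * ?n" "j < ?m * ?n" for g h i j
  proof -
    have "(\<Sum>k<?m * ?n. ?u g i k * ?u h k j) =
      (\<Sum>k<?m * ?n. (rep_mat r g (i div ?n) (k div ?n) * rep_mat r h (k div ?n) (j div ?n)) *
        (rep_mat s g (i mod ?n) (k mod ?n) * rep_mat s h (k mod ?n) (j mod ?n)))"
      using ij by (intro sum.cong) (auto simp: rep_mat_tensor)
    also have "\<dots> = rep_mat r (g + h) (i div ?n) (j div ?n) * rep_mat s (g + h) (i mod ?n) (j mod ?n)"
      unfolding sum_tensor_product[of "\<lambda>k. rep_mat r g (i div ?n) k * rep_mat r h k (j div ?n)" ?n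
          "\<lambda>k. rep_mat s g (i mod ?n) k * rep_mat s h k (j mod ?n)"]
      using ij by (simp add: cont_unitary_repD(4)[OF r] cont_unitary_repD(4)[OF s] dm)
    finally show ?thesis using ij by (simp add: rep_mat_tensor)
  qed
  have 5: "(\<Sum>k<?m * ?n. ?u g i k * cnj (?u g j k)) = (if i = j then 1 else 0)"
    if ij: "i < ?m * ?n" "j < ?m * ?n" for g i j
  proof -
    have "(\<Sum>k<?m * ?n. ?u g i k * cnj (?u g j k)) =
      (\<Sum>k<?m * ?n. (rep_mat r g (i div ?n) (k div ?n) * cnj (rep_mat r g (j div ?n) (k div ?n))) *
        (rep_mat s g (i mod ?n) (k mod ?n) * cnj (rep_mat s g (j mod ?n) (k mod ?n))))"
      using ij by (intro sum.cong) (auto simp: rep_mat_tensor)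
    also have "\<dots> = (if i = j then 1 else 0)"
      unfolding sum_tensor_product[of "\<lambda>k. rep_mat r g (i div ?n) k * cnj (rep_mat r g (j div ?n) k)" ?n
          "\<lambda>k. rep_mat s g (i mod ?n) k * cnj (rep_mat s g (j mod ?n) k)"]
      using ij eq[of i j] by (auto simp: cont_unitary_repD(5)[OF r] cont_unitary_repD(5)[OF s] dm)
    finally show ?thesis .
  qed
  have 6: "(\<Sum>k<?m * ?n. cnj (?u g k i) * ?u g k j) = (if i = j then 1 else 0)"
    if ij: "i < ?m * ?n" "j < ?m * ?n" for g i j
  proof -
    have "(\<Sum>k<?m * ?n. cnj (?u g k i) * ?u g k j) =
      (\<Sum>k<?m * ?n. (cnj (rep_mat r g (k div ?n) (i div ?n)) * rep_mat r g (k div ?n) (j div ?n)) *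
        (cnj (rep_mat s g (k mod ?n) (i mod ?n)) * rep_mat s g (k mod ?n) (j mod ?n)))"
      using ij by (intro sum.cong) (auto simp: rep_mat_tensor)
    also have "\<dots> = (if i = j then 1 else 0)"
      unfolding sum_tensor_product[of "\<lambda>k. cnj (rep_mat r g k (i div ?n)) * rep_mat r g k (j div ?n)" ?n
          "\<lambda>k. cnj (rep_mat s g k (i mod ?n)) * rep_mat s g k (j mod ?n)"]
      using ij eq[of i j] by (auto simp: cont_unitary_repD(6)[OF r] cont_unitary_repD(6)[OF s] dm)
    finally show ?thesis .
  qed
  show ?thesis
    unfolding cont_unitary_rep_def Let_def rep_dim_tensor using 1 2 3 4 5 6 by blast
qed

lemma chr_tensor: "chr (rep_tensor r s) g = chr r g * chr s g"
  using sum_tensor_product[of "\<lambda>i. rep_mat r g i i" "rep_dim s" "\<lambda>i. rep_mat s g i i" "rep_dim r"]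
  by (simp add: chr_def rep_mat_tensor)

text \<open>The contragredient of a unitary representation; tensoring with it moves a factor to the
  other side in Frobenius reciprocity.\<close>

definition rep_conj :: "'g mrep \<Rightarrow> 'g mrep" where
  "rep_conj r = (rep_dim r, \<lambda>g i j. cnj (rep_mat r g i j))"

lemma rep_conj_simps [simp]:
  "rep_dim (rep_conj r) = rep_dim r" "rep_mat (rep_conj r) g i j = cnj (rep_mat r g i j)"
  unfolding rep_conj_def rep_dim_def[of "(_, _)"] rep_mat_def[of "(_, _)"] by simp_all

lemma cont_unitary_conj:
  assumes r: "cont_unitary_rep r"
  shows "cont_unitary_rep (rep_conj r)"
proof -
  have 5: "(\<Sum>k<rep_dim r. cnj (rep_mat r g i k) * rep_mat r g j k) = (if i = j then 1 else 0)"
    if "i < rep_dim r" "j < rep_dim r" for g i j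
    using cont_unitary_repD(5)[OF r that(2,1), of g] by (simp add: mult.commute eq_commute[of j])
  have 6: "(\<Sum>k<rep_dim r. rep_mat r g k i * cnj (rep_mat r g k j)) = (if i = j then 1 else 0)"
    if "i < rep_dim r" "j < rep_dim r" for g i j
    using cont_unitary_repD(6)[OF r that(2,1), of g] by (simp add: mult.commute eq_commute[of j])
  show ?thesis
    unfolding cont_unitary_rep_def Let_def rep_conj_simps
    using cont_unitary_repD[OF r] 5 6 by (auto intro!: continuous_intros)
qed

lemma chr_conj: "chr (rep_conj r) g = cnj (chr r g)"
  by (simp add: chr_def)

text \<open>The maximum is meaningful because independent intertwiners, read as vectors of length
  \<open>?n * ?m\<close>, number at most that many. Positivity is all that \<open>boundary\<close>
  asks of a multiplicity.\<close>

lemma multiplicity_pos_iff: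
  "multiplicity r s > 0 \<longleftrightarrow> (\<exists>T. intertwiner r s T \<and> T \<noteq> (\<lambda>_ _. 0))"
proof -
  define K where "K = {k. \<exists>T :: nat \<Rightarrow> nat \<Rightarrow> nat \<Rightarrow> complex.
       (\<forall>l<k. intertwiner r s (T l))
     \<and> (\<forall>c :: nat \<Rightarrow> complex. (\<forall>i j. (\<Sum>l<k. c l * T l i j) = 0) \<longrightarrow> (\<forall>l<k. c l = 0))}"
  let ?m = "rep_dim r" and ?n = "rep_dim s"
  have mult: "multiplicity r s = Max K" unfolding multiplicity_def K_def ..
  have "0 \<in> K" unfolding K_def by simp
  have "k \<le> ?n * ?m" if "k \<in> K" for k
  proof (rule ccontr)
    assume "\<not> k \<le> ?n * ?m"
    then have lt: "?n * ?m < card {..<k}" by simp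
    obtain T where T: "\<And>l. l < k \<Longrightarrow> intertwiner r s (T l)"
      and ind: "\<And>c. (\<forall>i j. (\<Sum>l<k. c l * T l i j) = 0) \<Longrightarrow> \<forall>l<k. c l = 0"
      using \<open>k \<in> K\<close> unfolding K_def by blast
    obtain c where c: "\<exists>l\<in>{..<k}. c l \<noteq> 0"
      "\<forall>i<?n * ?m. (\<Sum>l<k. c l * T l (i div ?m) (i mod ?m)) = 0"
      using linear_dependence[OF finite_lessThan lt, of "\<lambda>l i. T l (i div ?m) (i mod ?m)"] by blast
    have "(\<Sum>l<k. c l * T l i j) = 0" for i j
    proof (cases "i < ?n \<and> j < ?m")
      case True
      then have "i * ?m + j < Suc i * ?m" by simp
      also have "\<dots> \<le> ?n * ?m" using True by (intro mult_le_mono1) simp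
      finally have "i * ?m + j < ?n * ?m" .
      then have "(\<Sum>l<k. c l * T l ((i * ?m + j) div ?m) ((i * ?m + j) mod ?m)) = 0" using c(2) by blast
      then show ?thesis using True by simp
    next
      case False
      then show ?thesis using intertwiner_outside[OF T] by (auto intro!: sum.neutral)
    qed
    then have "\<forall>l<k. c l = 0" by (intro ind) blast
    then show False using c(1) by auto
  qed
  then have fin: "finite K" using finite_nat_set_iff_bounded_le by blast
  show ?thesis
  proof
    assume "multiplicity r s > 0"
    moreover have "Max K \<in> K" using fin \<open>0 \<in> K\<close> Max_in by blast
    ultimately have K: "Max K \<in> K" and pos: "Max K > 0" unfolding mult by blast+
    obtain T where T: "\<forall>l<Max K. intertwiner r s (T l)"
      "\<forall>c :: nat \<Rightarrow> complex. (\<forall>i j. (\<Sum>l<Max K. c l * T l i j) = 0) \<longrightarrow> (\<forall>l<Max K. c l = 0)"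
      using K unfolding K_def mem_Collect_eq by blast
    have "T 0 \<noteq> (\<lambda>_ _. 0)"
    proof
      assume "T 0 = (\<lambda>_ _. 0)"
      then have "(\<Sum>l<Max K. (if l = 0 then 1 else 0) * T l i j) = 0" for i j
        by (intro sum.neutral) auto
      then show False using spec[OF T(2), of "\<lambda>l. if l = 0 then 1 else 0"] pos by auto
    qed
    then show "\<exists>T. intertwiner r s T \<and> T \<noteq> (\<lambda>_ _. 0)" using T(1) pos by blast
  next
    assume "\<exists>T. intertwiner r s T \<and> T \<noteq> (\<lambda>_ _. 0)"
    then obtain T i j where T: "intertwiner r s T" "T i j \<noteq> 0" by (auto simp: fun_eq_iff)
    have "1 \<in> K"
      unfolding K_def using T by (intro CollectI exI[of _ "\<lambda>_. T"]) auto
    then have "1 \<le> Max K" using fin by (intro Max_ge)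
    then show "multiplicity r s > 0" unfolding mult by simp
  qed
qed

section \<open>Classes, characters and fusion coefficients\<close>

context compact_metric_group
begin

text \<open>Equivalence being equality of characters, a class consists of all irreducibles with one
  character, whichever representative \<open>repr\<close> picks.\<close>

lemma dual_cases:
  fixes \<alpha> :: "'g mrep set"
  assumes "\<alpha> \<in> dual"
  shows "irreducible_rep (repr \<alpha>)" "\<alpha> = {s. irreducible_rep s \<and> chr s = chr (repr \<alpha>)}"
proof -
  obtain r where r: "irreducible_rep r" "\<alpha> = {s. irreducible_rep s \<and> rep_equiv r s}"
    using assms unfolding dual_def by blast
  then have \<alpha>: "\<alpha> = {s. irreducible_rep s \<and> chr r = chr s}" using rep_equiv_iff_chr by blast
  have "r \<in> \<alpha>" unfolding \<alpha> using r by simp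
  then have "repr \<alpha> \<in> \<alpha>" unfolding repr_def by (rule someI)
  then have 1: "irreducible_rep (repr \<alpha>)" "chr r = chr (repr \<alpha>)" unfolding \<alpha> by auto
  then show "irreducible_rep (repr \<alpha>)" by blast
  show "\<alpha> = {s. irreducible_rep s \<and> chr s = chr (repr \<alpha>)}"
    by (subst \<alpha>) (use 1 in auto)
qed

lemma dual_cont_unitary: "\<alpha> \<in> dual \<Longrightarrow> cont_unitary_rep (repr (\<alpha> :: 'g mrep set))"
  by (intro irreducible_cont_unitary dual_cases)

lemma dual_eqI:
  fixes \<alpha> \<beta> :: "'g mrep set"
  assumes "\<alpha> \<in> dual" "\<beta> \<in> dual" "chr (repr \<alpha>) = chr (repr \<beta>)"
  shows "\<alpha> = \<beta>"
  using dual_cases(2)[OF assms(1)] dual_cases(2)[OF assms(2)] assms(3) by simp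

lemma dual_class:
  fixes r :: "'g mrep"
  assumes "irreducible_rep r"
  obtains \<alpha> where "\<alpha> \<in> dual" "chr (repr \<alpha>) = chr r"
proof -
  define \<alpha> where "\<alpha> = {s. irreducible_rep s \<and> rep_equiv r s}"
  have \<alpha>: "\<alpha> \<in> dual" unfolding dual_def \<alpha>_def using assms by blast
  have "r \<in> \<alpha>" unfolding \<alpha>_def using assms rep_equiv_refl by blast
  then have "chr r = chr (repr \<alpha>)" using dual_cases(2)[OF \<alpha>] by auto
  then show ?thesis using that \<alpha> by simp
qed

text \<open>The multiplicity of \<beta> in \<open>s\<close> as an inner product of characters. It is
  complex-valued by construction; \<open>chr_expansion\<close> shows that it is real and
  nonnegative.\<close>

definition fmult :: "'g mrep \<Rightarrow> 'g mrep set \<Rightarrow> complex" where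
  "fmult s \<beta> = mean (\<lambda>g. chr s g * cnj (chr (repr \<beta>) g))"

lemma dual_chr_orthogonality:
  fixes r :: "'g mrep"
  assumes "irreducible_rep r" "\<beta> \<in> dual"
  shows "fmult r \<beta> = (if chr (repr \<beta>) = chr r then 1 else 0)"
  unfolding fmult_def using chr_orthogonality[OF dual_cases(1)[OF assms(2)] assms(1)]
    rep_equiv_iff_chr[OF dual_cases(1)[OF assms(2)] assms(1)] by simp

lemma fmult_sum_list:
  assumes "\<forall>r\<in>set rs. irreducible_rep r" "\<And>g. chr s g = (\<Sum>r\<leftarrow>rs. chr r g)" "\<beta> \<in> dual"
  shows "fmult s \<beta> = (\<Sum>r\<leftarrow>rs. if chr (repr \<beta>) = chr r then 1 else 0)"
proof -
  have c: "continuous_on UNIV (\<lambda>g. chr r g * cnj (chr (repr \<beta>) g))" if "irreducible_rep r" for r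
    by (intro continuous_intros continuous_on_chr dual_cont_unitary assms irreducible_cont_unitary that)
  have "mean (\<lambda>g. (\<Sum>r\<leftarrow>rs. chr r g) * cnj (chr (repr \<beta>) g)) = (\<Sum>r\<leftarrow>rs. fmult r \<beta>)"
    using assms(1)
  proof (induction rs)
    case (Cons r rs)
    have "continuous_on UNIV (\<lambda>g. (\<Sum>r\<leftarrow>rs. chr r g) * cnj (chr (repr \<beta>) g))"
      using Cons.prems
      by (intro continuous_intros continuous_on_chr dual_cont_unitary assms)
        (induction rs, auto intro!: continuous_intros continuous_on_chr irreducible_cont_unitary)
    then show ?case
      using Cons mean_add[OF c[of r]] by (simp add: distrib_right fmult_def)
  qed simp
  also have "\<dots> = (\<Sum>r\<leftarrow>rs. if chr (repr \<beta>) = chr r then 1 else 0)"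
    using assms(1,3) by (induction rs) (auto simp: dual_chr_orthogonality)
  finally show ?thesis unfolding fmult_def assms(2) .
qed

text \<open>The constituents from \<open>decomposition\<close> are grouped by class, and
  \<open>fmult\<close> counts those in each class. \<open>B\<close> is finite since each of its
  classes shares its character with a constituent.\<close>

lemma chr_expansion:
  fixes s :: "'g mrep"
  assumes "cont_unitary_rep s"
  obtains B where "finite B" "B \<subseteq> dual" "\<And>\<beta>. \<beta> \<in> dual - B \<Longrightarrow> fmult s \<beta> = 0"
    "\<And>\<beta>. \<beta> \<in> dual \<Longrightarrow> fmult s \<beta> = of_real (Re (fmult s \<beta>)) \<and> Re (fmult s \<beta>) \<ge> 0"
    "\<And>g. chr s g = (\<Sum>\<beta>\<in>B. fmult s \<beta> * chr (repr \<beta>) g)"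
proof -
  obtain rs :: "'g mrep list" where rs: "\<forall>r\<in>set rs. irreducible_rep r" "\<And>g. chr s g = (\<Sum>r\<leftarrow>rs. chr r g)"
    using decomposition[OF assms] by blast
  note fm = fmult_sum_list[OF rs]
  define B where "B = {\<beta> \<in> dual. \<exists>r\<in>set rs. chr (repr \<beta>) = chr r}"
  have "inj_on (\<lambda>\<beta>. chr (repr \<beta>)) B" unfolding B_def by (intro inj_onI dual_eqI) auto
  moreover have "(\<lambda>\<beta>. chr (repr \<beta>)) ` B \<subseteq> chr ` set rs" unfolding B_def by auto
  ultimately have fin: "finite B" by (meson finite_imageD finite_set finite_imageI finite_subset)
  show ?thesis
  proof (rule that[OF fin])
    show "B \<subseteq> dual" unfolding B_def by auto
    show "fmult s \<beta> = 0" if "\<beta> \<in> dual - B" for \<beta>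
    proof -
      have "chr (repr \<beta>) \<noteq> chr r" if "r \<in> set rs" for r
        using \<open>\<beta> \<in> dual - B\<close> that unfolding B_def by blast
      then have "(\<Sum>r\<leftarrow>rs. if chr (repr \<beta>) = chr r then 1 else 0) = (0::complex)"
        by (induction rs) auto
      then show ?thesis using fm[of \<beta>] that by simp
    qed
    show "fmult s \<beta> = of_real (Re (fmult s \<beta>)) \<and> Re (fmult s \<beta>) \<ge> 0" if "\<beta> \<in> dual" for \<beta>
    proof -
      have "(\<Sum>r\<leftarrow>rs. if P r then 1 else 0) = (of_nat (length (filter P rs)) :: complex)" for P
        by (induction rs) auto
      then show ?thesis unfolding fm[OF that] by simp
    qed
    show "chr s g = (\<Sum>\<beta>\<in>B. fmult s \<beta> * chr (repr \<beta>) g)" for g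
    proof -
      have one: "(\<Sum>\<beta>\<in>B. (if chr (repr \<beta>) = chr r then 1 else 0) * chr (repr \<beta>) g) = chr r g"
        if "r \<in> set rs" for r
      proof -
        have "irreducible_rep r" using rs(1) that by blast
        then obtain \<alpha> where \<alpha>: "\<alpha> \<in> dual" "chr (repr \<alpha>) = chr r"
          by (rule dual_class)
        have "\<alpha> \<in> B" unfolding B_def using \<alpha> that by blast
        have "(\<Sum>\<beta>\<in>B. (if chr (repr \<beta>) = chr r then 1 else 0) * chr (repr \<beta>) g)
          = (\<Sum>\<beta>\<in>B. if \<beta> = \<alpha> then chr r g else 0)"
          using \<alpha> by (intro sum.cong) (auto simp: B_def dest: dual_eqI)
        then show ?thesis using fin \<open>\<alpha> \<in> B\<close> by simp
      qed
      have "(\<Sum>\<beta>\<in>B. fmult s \<beta> * chr (repr \<beta>) g)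
        = (\<Sum>\<beta>\<in>B. \<Sum>r\<leftarrow>rs. (if chr (repr \<beta>) = chr r then 1 else 0) * chr (repr \<beta>) g)"
        by (intro sum.cong refl) (simp add: fm B_def sum_list_mult_const)
      also have "\<dots> = (\<Sum>r\<leftarrow>rs. \<Sum>\<beta>\<in>B. (if chr (repr \<beta>) = chr r then 1 else 0) * chr (repr \<beta>) g)"
        by (induction rs) (simp_all add: sum.distrib)
      also have "\<dots> = (\<Sum>r\<leftarrow>rs. chr r g)"
        using one by (intro arg_cong[where f = sum_list] map_cong) auto
      finally show ?thesis using rs(2) by simp
    qed
  qed
qed

text \<open>A nonzero inner product of characters has a nonzero \<open>coeff_mean\<close> among its
  terms, and that is an intertwiner. Conversely, if no constituent is of class \<beta>, all
  coefficients of \<open>s\<close> are orthogonal to those of \<beta>, which kills every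
  intertwiner.\<close>

lemma fmult_nonzero_iff:
  fixes s :: "'g mrep"
  assumes s: "cont_unitary_rep s" and \<beta>: "\<beta> \<in> dual"
  shows "fmult s \<beta> \<noteq> 0 \<longleftrightarrow> multiplicity (repr \<beta>) s > 0"
  unfolding multiplicity_pos_iff
proof
  let ?r = "repr \<beta>"
  note r = dual_cases(1)[OF \<beta>] and ru = dual_cont_unitary[OF \<beta>]
  assume ne: "fmult s \<beta> \<noteq> 0"
  have c: "continuous_on UNIV (\<lambda>g. rep_mat s g i i * cnj (rep_mat ?r g j j))" for i j
    by (intro continuous_intros cont_unitary_repD(3) ru s)
  then have c': "continuous_on UNIV (\<lambda>g. \<Sum>j<rep_dim ?r. rep_mat s g i i * cnj (rep_mat ?r g j j))" for i
    by (intro continuous_on_sum)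
  have "fmult s \<beta> = (\<Sum>i<rep_dim s. \<Sum>j<rep_dim ?r. mean (\<lambda>g. rep_mat s g i i * cnj (rep_mat ?r g j j)))"
    unfolding fmult_def chr_def cnj_sum sum_product by (simp only: mean_sum[OF c'] mean_sum[OF c])
  with ne obtain i j where ij: "i < rep_dim s" "j < rep_dim ?r" "coeff_mean s i ?r j i j \<noteq> 0"
    unfolding coeff_mean_def by (metis (no_types, lifting) lessThan_iff sum.neutral)
  then show "\<exists>T. intertwiner ?r s T \<and> T \<noteq> (\<lambda>_ _. 0)"
    using coeff_mean_intertwiner[OF ru s ij(1,2)] by (metis (no_types))
next
  let ?r = "repr \<beta>"
  note r = dual_cases(1)[OF \<beta>] and ru = dual_cont_unitary[OF \<beta>]
  assume "\<exists>T. intertwiner ?r s T \<and> T \<noteq> (\<lambda>_ _. 0)"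
  then obtain T i j where T: "intertwiner ?r s T" "T i j \<noteq> 0" by (auto simp: fun_eq_iff)
  then have ij: "i < rep_dim s" "j < rep_dim ?r" using intertwiner_outside by metis+
  show "fmult s \<beta> \<noteq> 0"
  proof
    assume 0: "fmult s \<beta> = 0"
    obtain rs :: "'g mrep list" where rs: "\<forall>r\<in>set rs. irreducible_rep r" "\<And>g. chr s g = (\<Sum>r\<leftarrow>rs. chr r g)"
      and orth: "\<And>t k l i j. cont_unitary_rep t \<Longrightarrow> (\<forall>r\<in>set rs. \<forall>a b. mean (\<lambda>g. rep_mat r g a b * cnj (rep_mat t g k l)) = 0)
      \<Longrightarrow> mean (\<lambda>g. rep_mat s g i j * cnj (rep_mat t g k l)) = 0"
      using decomposition[OF s] by blast
    have count: "(\<Sum>r\<leftarrow>rs. if P r then 1 else 0) = (of_nat (length (filter P rs)) :: complex)" for P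
      by (induction rs) auto
    have "filter (\<lambda>r. chr ?r = chr r) rs = []"
      using 0 unfolding fmult_sum_list[OF rs \<beta>] count by simp
    then have "chr ?r \<noteq> chr q" if "q \<in> set rs" for q
      using that by (auto simp: filter_empty_conv)
    then have "mean (\<lambda>g. rep_mat q g a b * cnj (rep_mat ?r g k l)) = 0" if "q \<in> set rs" for q a b k l
      using that rs(1) rep_equiv_iff_chr[OF r] by (intro schur_orthogonality_inequivalent r) auto
    then have z: "mean (\<lambda>g. rep_mat s g a b * cnj (rep_mat ?r g k l)) = 0" for a b k l
      by (intro orth[OF ru]) blast
    have d: "0 < rep_dim ?r" using cont_unitary_repD(1)[OF ru] by simp
    have cr: "continuous_on UNIV (\<lambda>g. rep_mat ?r g k 0 * cnj (rep_mat ?r g j 0))" for k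
      by (intro continuous_intros cont_unitary_repD(3) ru)
    have cs: "continuous_on UNIV (\<lambda>g. rep_mat s g i k * cnj (rep_mat ?r g j 0))" for k
      by (intro continuous_intros cont_unitary_repD(3) ru s)
    \<comment> \<open>The entry \<open>(i, 0)\<close> of the intertwining relation is multiplied by
      the conjugate of the entry \<open>(j, 0)\<close> of \<open>?r\<close> and averaged: Schur
      orthogonality isolates \<open>T i j\<close> on one side, and the other side vanishes by
      \<open>z\<close>.\<close>
    have "T i j * (1 / of_nat (rep_dim ?r))
      = (\<Sum>k<rep_dim ?r. T i k * mean (\<lambda>g. rep_mat ?r g k 0 * cnj (rep_mat ?r g j 0)))"
    proof -
      have "(\<Sum>k<rep_dim ?r. T i k * mean (\<lambda>g. rep_mat ?r g k 0 * cnj (rep_mat ?r g j 0)))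
        = (\<Sum>k<rep_dim ?r. if k = j then T i j * (1 / of_nat (rep_dim ?r)) else 0)"
        using ij d by (intro sum.cong) (auto simp: schur_orthogonality[OF r])
      then show ?thesis using ij by simp
    qed
    also have "\<dots> = mean (\<lambda>g. \<Sum>k<rep_dim ?r. T i k * (rep_mat ?r g k 0 * cnj (rep_mat ?r g j 0)))"
      by (rule mean_sum_cmult[symmetric]) (rule cr)
    also have "\<dots> = mean (\<lambda>g. (\<Sum>k<rep_dim ?r. T i k * rep_mat ?r g k 0) * cnj (rep_mat ?r g j 0))"
      by (simp add: sum_distrib_right mult.assoc)
    also have "\<dots> = mean (\<lambda>g. \<Sum>k<rep_dim s. (rep_mat s g i k * cnj (rep_mat ?r g j 0)) * T k 0)"
      using ij d by (simp add: intertwinerD[OF T(1)] sum_distrib_left sum_distrib_right ac_simps)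
    also have "\<dots> = (\<Sum>k<rep_dim s. mean (\<lambda>g. rep_mat s g i k * cnj (rep_mat ?r g j 0)) * T k 0)"
      by (rule mean_sum_multc) (rule cs)
    also have "\<dots> = 0" unfolding z by simp
    finally show False using T(2) d by simp
  qed
qed

definition fusion :: "'g mrep set \<Rightarrow> 'g mrep set \<Rightarrow> 'g mrep set \<Rightarrow> real" where
  "fusion \<beta> \<alpha> \<gamma> = Re (fmult (rep_tensor (repr \<alpha>) (repr \<gamma>)) \<beta>)"

lemma fusion_nonneg: "\<alpha> \<in> dual \<Longrightarrow> \<beta> \<in> dual \<Longrightarrow> \<gamma> \<in> dual \<Longrightarrow> fusion \<beta> \<alpha> \<gamma> \<ge> 0"
  unfolding fusion_def
  by (rule chr_expansion[OF cont_unitary_tensor[OF dual_cont_unitary dual_cont_unitary], of \<alpha> \<gamma>]) blast+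

lemma fusion_of_real:
  "\<alpha> \<in> dual \<Longrightarrow> \<beta> \<in> dual \<Longrightarrow> \<gamma> \<in> dual \<Longrightarrow>
    of_real (fusion \<beta> \<alpha> \<gamma>) = fmult (rep_tensor (repr \<alpha>) (repr \<gamma>)) \<beta>"
  unfolding fusion_def
  by (rule chr_expansion[OF cont_unitary_tensor[OF dual_cont_unitary dual_cont_unitary], of \<alpha> \<gamma>]) metis+

lemma fusion_nonzero_iff:
  assumes "\<alpha> \<in> dual" "\<beta> \<in> dual" "\<gamma> \<in> dual"
  shows "fusion \<beta> \<alpha> \<gamma> \<noteq> 0 \<longleftrightarrow> Nmult \<beta> \<alpha> \<gamma> > 0"
  unfolding Nmult_def
  using fmult_nonzero_iff[OF cont_unitary_tensor[OF dual_cont_unitary dual_cont_unitary] assms(2), OF assms(1,3)]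
    fusion_of_real[OF assms] by (metis of_real_eq_0_iff)

lemma fusion_expansion:
  assumes "\<alpha> \<in> dual" "\<gamma> \<in> dual"
  obtains B where "finite B" "B \<subseteq> dual" "\<And>\<beta>. \<beta> \<in> dual - B \<Longrightarrow> fusion \<beta> \<alpha> \<gamma> = 0"
    "\<And>g. chr (repr \<alpha>) g * chr (repr \<gamma>) g = (\<Sum>\<beta>\<in>B. of_real (fusion \<beta> \<alpha> \<gamma>) * chr (repr \<beta>) g)"
proof (rule chr_expansion[OF cont_unitary_tensor[OF dual_cont_unitary dual_cont_unitary, OF assms]])
  fix B assume B: "finite B" "B \<subseteq> dual"
    and 0: "\<And>\<beta>. \<beta> \<in> dual - B \<Longrightarrow> fmult (rep_tensor (repr \<alpha>) (repr \<gamma>)) \<beta> = 0"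
    and e: "\<And>g. chr (rep_tensor (repr \<alpha>) (repr \<gamma>)) g
      = (\<Sum>\<beta>\<in>B. fmult (rep_tensor (repr \<alpha>) (repr \<gamma>)) \<beta> * chr (repr \<beta>) g)"
  have "chr (repr \<alpha>) g * chr (repr \<gamma>) g = (\<Sum>\<beta>\<in>B. of_real (fusion \<beta> \<alpha> \<gamma>) * chr (repr \<beta>) g)" for g
    unfolding chr_tensor[symmetric] e using B(2) assms
    by (intro sum.cong refl) (auto simp: fusion_of_real)
  then show thesis using that[OF B] 0 by (simp add: fusion_def)
qed

text \<open>Frobenius reciprocity: both multiplicities are the mean of the same product of three
  characters, up to conjugation.\<close>

lemma fusion_reciprocity:
  assumes "\<beta> \<in> dual" "\<gamma> \<in> dual"
  obtains A where "finite A" "A \<subseteq> dual" "\<And>\<alpha>. \<alpha> \<in> dual - A \<Longrightarrow> fusion \<beta> \<alpha> \<gamma> = 0"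
    "(\<Sum>\<alpha>\<in>A. real (ddim \<alpha>) * fusion \<beta> \<alpha> \<gamma>) = real (ddim \<beta>) * real (ddim \<gamma>)"
proof -
  note u = dual_cont_unitary[OF assms(1)] dual_cont_unitary[OF assms(2)]
  let ?s = "rep_tensor (repr \<beta>) (rep_conj (repr \<gamma>))"
  have s: "cont_unitary_rep ?s" by (intro cont_unitary_tensor cont_unitary_conj u)
  have eq: "fmult ?s \<alpha> = of_real (fusion \<beta> \<alpha> \<gamma>)" if \<alpha>: "\<alpha> \<in> dual" for \<alpha>
  proof -
    have c: "continuous_on UNIV (\<lambda>g. chr (rep_tensor (repr \<alpha>) (repr \<gamma>)) g * cnj (chr (repr \<beta>) g))"
      by (intro continuous_intros continuous_on_chr cont_unitary_tensor u dual_cont_unitary[OF \<alpha>])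
    have "fmult ?s \<alpha> = cnj (fmult (rep_tensor (repr \<alpha>) (repr \<gamma>)) \<beta>)"
      unfolding fmult_def mean_cnj[OF c, symmetric] by (simp add: chr_tensor chr_conj ac_simps)
    then show ?thesis using fusion_of_real[OF \<alpha> assms] by (metis complex_cnj_complex_of_real)
  qed
  show ?thesis
  proof (rule chr_expansion[OF s])
    fix A assume A: "finite A" "A \<subseteq> dual"
      and 0: "\<And>\<alpha>. \<alpha> \<in> dual - A \<Longrightarrow> fmult ?s \<alpha> = 0"
      and e: "\<And>g. chr ?s g = (\<Sum>\<alpha>\<in>A. fmult ?s \<alpha> * chr (repr \<alpha>) g)"
    have "complex_of_real (real (ddim \<beta>) * real (ddim \<gamma>)) = chr ?s 0"
      using s by (simp add: chr_zero ddim_def)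
    also have "\<dots> = (\<Sum>\<alpha>\<in>A. of_real (real (ddim \<alpha>) * fusion \<beta> \<alpha> \<gamma>))"
      unfolding e using A(2)
      by (intro sum.cong refl) (auto simp: eq chr_zero dual_cont_unitary ddim_def subset_iff)
    finally have "(\<Sum>\<alpha>\<in>A. real (ddim \<alpha>) * fusion \<beta> \<alpha> \<gamma>) = real (ddim \<beta>) * real (ddim \<gamma>)"
      unfolding of_real_sum[symmetric] of_real_eq_iff by simp
    moreover have "fusion \<beta> \<alpha> \<gamma> = 0" if "\<alpha> \<in> dual - A" for \<alpha>
      using 0[OF that] eq[of \<alpha>] that by simp
    ultimately show thesis using that[OF A] by blast
  qed
qed

end

section \<open>The kernels of a Folner sequence\<close>

context compact_metric_group
begin

text \<open>The expansion of the product of two characters, evaluated at \<open>0\<close>, gives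
  equality over all constituents; nonnegativity then allows any finite \<open>B\<close>.\<close>

lemma fusion_row_le:
  assumes "\<alpha> \<in> dual" "\<gamma> \<in> dual" "finite B" "B \<subseteq> dual"
  shows "(\<Sum>\<beta>\<in>B. fusion \<beta> \<alpha> \<gamma> * ddim \<beta>) \<le> real (ddim \<alpha>) * real (ddim \<gamma>)"
proof (rule fusion_expansion[OF assms(1,2)])
  fix A assume A: "finite A" "A \<subseteq> dual" and 0: "\<And>\<beta>. \<beta> \<in> dual - A \<Longrightarrow> fusion \<beta> \<alpha> \<gamma> = 0"
    and e: "\<And>g. chr (repr \<alpha>) g * chr (repr \<gamma>) g = (\<Sum>\<beta>\<in>A. of_real (fusion \<beta> \<alpha> \<gamma>) * chr (repr \<beta>) g)"
  have "complex_of_real (real (ddim \<alpha>) * real (ddim \<gamma>)) = chr (repr \<alpha>) 0 * chr (repr \<gamma>) 0"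
    using assms by (simp add: chr_zero dual_cont_unitary ddim_def)
  also have "\<dots> = of_real (\<Sum>\<beta>\<in>A. fusion \<beta> \<alpha> \<gamma> * ddim \<beta>)"
    unfolding e of_real_sum using A(2)
    by (intro sum.cong refl) (auto simp: chr_zero dual_cont_unitary ddim_def subset_iff)
  finally have eq: "real (ddim \<alpha>) * real (ddim \<gamma>) = (\<Sum>\<beta>\<in>A. fusion \<beta> \<alpha> \<gamma> * ddim \<beta>)"
    unfolding of_real_eq_iff .
  have "(\<Sum>\<beta>\<in>B. fusion \<beta> \<alpha> \<gamma> * ddim \<beta>) = (\<Sum>\<beta>\<in>B \<inter> A. fusion \<beta> \<alpha> \<gamma> * ddim \<beta>)"
    using assms(3,4) 0 by (intro sum.mono_neutral_right) auto
  also have "\<dots> \<le> (\<Sum>\<beta>\<in>A. fusion \<beta> \<alpha> \<gamma> * ddim \<beta>)"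
    using A assms by (intro sum_mono2) (auto intro!: mult_nonneg_nonneg fusion_nonneg)
  finally show ?thesis unfolding eq .
qed

text \<open>Summation by parts: by reciprocity \<open>d\<^sub>\<gamma> \<Sum>\<^bsub>\<beta>\<in>F\<^esub> d\<^sub>\<beta> \<chi>\<^sub>\<beta>\<close> and
  \<open>\<chi>\<^sub>\<gamma> \<Sum>\<^bsub>\<alpha>\<in>F\<^esub> d\<^sub>\<alpha> \<chi>\<^sub>\<alpha>\<close> are sums of the same terms \<open>d\<^sub>\<alpha> N \<chi>\<^sub>\<beta>\<close>, over \<open>\<beta> \<in> F\<close> and
  \<open>\<alpha> \<in> F\<close> respectively, so only boundary terms survive in their difference.\<close>

lemma boundary_bound:
  fixes F :: "'g mrep set set"
  assumes F: "finite F" "F \<subseteq> dual" and \<gamma>: "\<gamma> \<in> dual"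
  shows "cmod (chr (repr \<gamma>) g - of_nat (ddim \<gamma>)) * cmod (\<Sum>\<alpha>\<in>F. of_nat (ddim \<alpha>) * chr (repr \<alpha>) g)
    \<le> ddim \<gamma> * wcard (boundary {\<gamma>} F)"
proof -
  have "\<forall>\<alpha>\<in>F. \<exists>B. finite B \<and> B \<subseteq> dual \<and> (\<forall>\<beta>\<in>dual - B. fusion \<beta> \<alpha> \<gamma> = 0) \<and>
    (\<forall>g. chr (repr \<alpha>) g * chr (repr \<gamma>) g = (\<Sum>\<beta>\<in>B. of_real (fusion \<beta> \<alpha> \<gamma>) * chr (repr \<beta>) g))"
  proof
    fix \<alpha> assume "\<alpha> \<in> F"
    then have "\<alpha> \<in> dual" using F(2) by blast
    then show "\<exists>B. finite B \<and> B \<subseteq> dual \<and> (\<forall>\<beta>\<in>dual - B. fusion \<beta> \<alpha> \<gamma> = 0) \<and>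
      (\<forall>g. chr (repr \<alpha>) g * chr (repr \<gamma>) g = (\<Sum>\<beta>\<in>B. of_real (fusion \<beta> \<alpha> \<gamma>) * chr (repr \<beta>) g))"
      by (rule fusion_expansion[OF _ \<gamma>]) blast
  qed
  from bchoice[OF this] obtain Bf where Bf0: "\<forall>\<alpha>\<in>F. finite (Bf \<alpha>) \<and> Bf \<alpha> \<subseteq> dual \<and>
    (\<forall>\<beta>\<in>dual - Bf \<alpha>. fusion \<beta> \<alpha> \<gamma> = 0) \<and>
    (\<forall>g. chr (repr \<alpha>) g * chr (repr \<gamma>) g = (\<Sum>\<beta>\<in>Bf \<alpha>. of_real (fusion \<beta> \<alpha> \<gamma>) * chr (repr \<beta>) g))" ..
  then have Bf: "\<And>\<alpha>. \<alpha> \<in> F \<Longrightarrow> finite (Bf \<alpha>)" "\<And>\<alpha>. \<alpha> \<in> F \<Longrightarrow> Bf \<alpha> \<subseteq> dual"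
    "\<And>\<alpha> \<beta>. \<alpha> \<in> F \<Longrightarrow> \<beta> \<in> dual - Bf \<alpha> \<Longrightarrow> fusion \<beta> \<alpha> \<gamma> = 0"
    "\<And>\<alpha> g. \<alpha> \<in> F \<Longrightarrow> chr (repr \<alpha>) g * chr (repr \<gamma>) g = (\<Sum>\<beta>\<in>Bf \<alpha>. of_real (fusion \<beta> \<alpha> \<gamma>) * chr (repr \<beta>) g)"
    by blast+
  have "\<forall>\<beta>\<in>F. \<exists>A. finite A \<and> A \<subseteq> dual \<and> (\<forall>\<alpha>\<in>dual - A. fusion \<beta> \<alpha> \<gamma> = 0) \<and>
    (\<Sum>\<alpha>\<in>A. real (ddim \<alpha>) * fusion \<beta> \<alpha> \<gamma>) = real (ddim \<beta>) * real (ddim \<gamma>)"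
  proof
    fix \<beta> assume "\<beta> \<in> F"
    then have "\<beta> \<in> dual" using F(2) by blast
    then show "\<exists>A. finite A \<and> A \<subseteq> dual \<and> (\<forall>\<alpha>\<in>dual - A. fusion \<beta> \<alpha> \<gamma> = 0) \<and>
      (\<Sum>\<alpha>\<in>A. real (ddim \<alpha>) * fusion \<beta> \<alpha> \<gamma>) = real (ddim \<beta>) * real (ddim \<gamma>)"
      by (rule fusion_reciprocity[OF _ \<gamma>]) blast
  qed
  from bchoice[OF this] obtain Af where Af0: "\<forall>\<beta>\<in>F. finite (Af \<beta>) \<and> Af \<beta> \<subseteq> dual \<and>
    (\<forall>\<alpha>\<in>dual - Af \<beta>. fusion \<beta> \<alpha> \<gamma> = 0) \<and>
    (\<Sum>\<alpha>\<in>Af \<beta>. real (ddim \<alpha>) * fusion \<beta> \<alpha> \<gamma>) = real (ddim \<beta>) * real (ddim \<gamma>)" ..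
  then have Af: "\<And>\<beta>. \<beta> \<in> F \<Longrightarrow> finite (Af \<beta>)" "\<And>\<beta>. \<beta> \<in> F \<Longrightarrow> Af \<beta> \<subseteq> dual"
    "\<And>\<alpha> \<beta>. \<beta> \<in> F \<Longrightarrow> \<alpha> \<in> dual - Af \<beta> \<Longrightarrow> fusion \<beta> \<alpha> \<gamma> = 0"
    "\<And>\<beta>. \<beta> \<in> F \<Longrightarrow> (\<Sum>\<alpha>\<in>Af \<beta>. real (ddim \<alpha>) * fusion \<beta> \<alpha> \<gamma>) = real (ddim \<beta>) * real (ddim \<gamma>)"
    by blast+
  \<comment> \<open>A single finite set containing \<open>F\<close> and every class related to it by
    a nonzero coefficient in either position, so that both double sums range over it.\<close>
  define B where "B = F \<union> (\<Union>\<alpha>\<in>F. Bf \<alpha>) \<union> (\<Union>\<beta>\<in>F. Af \<beta>)"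
  have "finite B" using F(1) Bf(1) Af(1) unfolding B_def by blast
  moreover have "B \<subseteq> dual" using F(2) Bf(2) Af(2) unfolding B_def by blast
  moreover have "F \<subseteq> B" unfolding B_def by blast
  ultimately have B: "finite B" "B \<subseteq> dual" "F \<subseteq> B" .
  define E where "E = boundary {\<gamma>} F"
  have bd: "E \<subseteq> B"
  proof
    fix \<alpha> assume \<alpha>: "\<alpha> \<in> E"
    show "\<alpha> \<in> B"
    proof (cases "\<alpha> \<in> F")
      case False
      then obtain \<beta> where \<beta>: "\<alpha> \<in> dual" "\<beta> \<in> F" "Nmult \<beta> \<alpha> \<gamma> > 0"
        using \<alpha> unfolding E_def boundary_def by blast
      then have "fusion \<beta> \<alpha> \<gamma> \<noteq> 0" using fusion_nonzero_iff[of \<alpha> \<beta> \<gamma>] F(2) \<gamma> by blast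
      then show ?thesis using Af(3)[OF \<beta>(2)] \<beta>(1,2) unfolding B_def by blast
    qed (simp add: B_def)
  qed
  define t where "t \<alpha> \<beta> = complex_of_real (real (ddim \<alpha>) * fusion \<beta> \<alpha> \<gamma>) * chr (repr \<beta>) g" for \<alpha> \<beta>
  \<comment> \<open>The cost allotted to a class: a boundary class pays the full row bound, any
    other class pays nothing because all its coefficients across the border of \<open>F\<close>
    vanish.\<close>
  define w where "w \<alpha> = (if \<alpha> \<in> E then real (ddim \<gamma>) * (real (ddim \<alpha>))\<^sup>2 else 0)" for \<alpha>
  let ?s = "\<Sum>\<alpha>\<in>F. of_nat (ddim \<alpha>) * chr (repr \<alpha>) g"
  have s1: "chr (repr \<gamma>) g * ?s = (\<Sum>\<alpha>\<in>F. \<Sum>\<beta>\<in>B. t \<alpha> \<beta>)"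
    unfolding sum_distrib_left
  proof (rule sum.cong[OF refl])
    fix \<alpha> assume \<alpha>: "\<alpha> \<in> F"
    have "chr (repr \<gamma>) g * (of_nat (ddim \<alpha>) * chr (repr \<alpha>) g)
      = of_nat (ddim \<alpha>) * (chr (repr \<alpha>) g * chr (repr \<gamma>) g)" by simp
    also have "\<dots> = (\<Sum>\<beta>\<in>Bf \<alpha>. t \<alpha> \<beta>)"
      unfolding Bf(4)[OF \<alpha>] sum_distrib_left by (simp add: t_def mult.assoc)
    also have "\<dots> = (\<Sum>\<beta>\<in>B. t \<alpha> \<beta>)"
      using B(1,2) \<alpha> Bf(3)[OF \<alpha>] by (intro sum.mono_neutral_left) (auto simp: B_def t_def)
    finally show "chr (repr \<gamma>) g * (of_nat (ddim \<alpha>) * chr (repr \<alpha>) g) = (\<Sum>\<beta>\<in>B. t \<alpha> \<beta>)" .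
  qed
  have s2: "of_nat (ddim \<gamma>) * ?s = (\<Sum>\<alpha>\<in>B. \<Sum>\<beta>\<in>F. t \<alpha> \<beta>)"
    unfolding sum_distrib_left sum.swap[of _ F]
  proof (rule sum.cong[OF refl])
    fix \<beta> assume \<beta>: "\<beta> \<in> F"
    have "of_nat (ddim \<gamma>) * (of_nat (ddim \<beta>) * chr (repr \<beta>) g)
      = complex_of_real (\<Sum>\<alpha>\<in>Af \<beta>. real (ddim \<alpha>) * fusion \<beta> \<alpha> \<gamma>) * chr (repr \<beta>) g"
      unfolding Af(4)[OF \<beta>] by simp
    also have "(\<Sum>\<alpha>\<in>Af \<beta>. real (ddim \<alpha>) * fusion \<beta> \<alpha> \<gamma>) = (\<Sum>\<alpha>\<in>B. real (ddim \<alpha>) * fusion \<beta> \<alpha> \<gamma>)"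
      using B(1,2) \<beta> Af(3)[OF \<beta>] by (intro sum.mono_neutral_left) (auto simp: B_def)
    finally show "of_nat (ddim \<gamma>) * (of_nat (ddim \<beta>) * chr (repr \<beta>) g) = (\<Sum>\<alpha>\<in>B. t \<alpha> \<beta>)"
      by (simp add: t_def sum_distrib_right)
  qed
  have split: "(\<Sum>x\<in>B. f x) = (\<Sum>x\<in>F. f x) + (\<Sum>x\<in>B - F. f x)" for f :: "_ \<Rightarrow> complex"
    using B(1,3) by (metis add.commute sum.subset_diff)
  have diff: "(chr (repr \<gamma>) g - of_nat (ddim \<gamma>)) * ?s = (\<Sum>\<alpha>\<in>F. \<Sum>\<beta>\<in>B - F. t \<alpha> \<beta>) - (\<Sum>\<alpha>\<in>B - F. \<Sum>\<beta>\<in>F. t \<alpha> \<beta>)"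
    unfolding left_diff_distrib s1 s2
    by (subst split[of "\<lambda>\<alpha>. \<Sum>\<beta>\<in>F. t \<alpha> \<beta>"]) (simp add: split sum.distrib)
  have bound: "cmod (\<Sum>\<beta>\<in>C. t \<alpha> \<beta>) \<le> w \<alpha>"
    if that: "\<alpha> \<in> B" "C \<subseteq> B" and N: "\<And>\<beta>. \<alpha> \<notin> E \<Longrightarrow> \<beta> \<in> C \<Longrightarrow> Nmult \<beta> \<alpha> \<gamma> = 0" for \<alpha> C
  proof (cases "\<alpha> \<in> E")
    case True
    have \<alpha>: "\<alpha> \<in> dual" and C: "finite C" "C \<subseteq> dual" using that B finite_subset by blast+
    have "cmod (\<Sum>\<beta>\<in>C. t \<alpha> \<beta>) \<le> (\<Sum>\<beta>\<in>C. real (ddim \<alpha>) * (fusion \<beta> \<alpha> \<gamma> * ddim \<beta>))"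
    proof (rule sum_norm_le)
      fix \<beta> assume "\<beta> \<in> C"
      then have \<beta>: "\<beta> \<in> dual" using C by blast
      have "cmod (t \<alpha> \<beta>) = real (ddim \<alpha>) * (fusion \<beta> \<alpha> \<gamma> * cmod (chr (repr \<beta>) g))"
        using fusion_nonneg[OF \<alpha> \<beta> \<gamma>] by (simp add: t_def norm_mult)
      also have "\<dots> \<le> real (ddim \<alpha>) * (fusion \<beta> \<alpha> \<gamma> * ddim \<beta>)"
        using fusion_nonneg[OF \<alpha> \<beta> \<gamma>] cmod_chr_le[OF dual_cont_unitary[OF \<beta>], of g]
        by (intro mult_left_mono) (auto simp: ddim_def)
      finally show "cmod (t \<alpha> \<beta>) \<le> real (ddim \<alpha>) * (fusion \<beta> \<alpha> \<gamma> * ddim \<beta>)" .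
    qed
    also have "\<dots> = real (ddim \<alpha>) * (\<Sum>\<beta>\<in>C. fusion \<beta> \<alpha> \<gamma> * ddim \<beta>)" by (simp add: sum_distrib_left)
    also have "\<dots> \<le> real (ddim \<alpha>) * (real (ddim \<alpha>) * real (ddim \<gamma>))"
      by (intro mult_left_mono fusion_row_le \<alpha> \<gamma> C) simp
    finally show ?thesis using True by (simp add: w_def power2_eq_square ac_simps)
  next
    case False
    have "fusion \<beta> \<alpha> \<gamma> = 0" if \<beta>: "\<beta> \<in> C" for \<beta>
      using fusion_nonzero_iff[of \<alpha> \<beta> \<gamma>] \<open>\<alpha> \<in> B\<close> \<open>C \<subseteq> B\<close> B(2) \<gamma> \<beta> N[OF False \<beta>] by auto
    then have "(\<Sum>\<beta>\<in>C. t \<alpha> \<beta>) = 0" by (intro sum.neutral) (simp add: t_def)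
    then show ?thesis by (simp add: w_def)
  qed
  have 1: "cmod (\<Sum>\<alpha>\<in>F. \<Sum>\<beta>\<in>B - F. t \<alpha> \<beta>) \<le> (\<Sum>\<alpha>\<in>F. w \<alpha>)"
  proof (intro sum_norm_le bound)
    show "Nmult \<beta> \<alpha> \<gamma> = 0" if "\<alpha> \<in> F" "\<alpha> \<notin> E" "\<beta> \<in> B - F" for \<alpha> \<beta>
      using that B(2) unfolding E_def boundary_def by auto
  qed (use B in auto)
  have 2: "cmod (\<Sum>\<alpha>\<in>B - F. \<Sum>\<beta>\<in>F. t \<alpha> \<beta>) \<le> (\<Sum>\<alpha>\<in>B - F. w \<alpha>)"
  proof (intro sum_norm_le bound)
    show "Nmult \<beta> \<alpha> \<gamma> = 0" if "\<alpha> \<in> B - F" "\<alpha> \<notin> E" "\<beta> \<in> F" for \<alpha> \<beta>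
      using that B(2) unfolding E_def boundary_def by auto
  qed (use B in auto)
  have "cmod (chr (repr \<gamma>) g - of_nat (ddim \<gamma>)) * cmod ?s \<le> (\<Sum>\<alpha>\<in>F. w \<alpha>) + (\<Sum>\<alpha>\<in>B - F. w \<alpha>)"
    unfolding norm_mult[symmetric] diff using 1 2 norm_triangle_ineq4 by (meson add_mono order.trans)
  also have "\<dots> = (\<Sum>\<alpha>\<in>B. w \<alpha>)" using B(1,3) by (metis add.commute sum.subset_diff)
  also have "\<dots> = (\<Sum>\<alpha>\<in>E. w \<alpha>)"
    using B(1) bd by (intro sum.mono_neutral_right) (auto simp: w_def)
  also have "\<dots> = ddim \<gamma> * wcard E" by (simp add: w_def wcard_def sum_distrib_left)
  finally show ?thesis unfolding E_def .
qed

text \<open>The character of a representation is a combination of irreducible ones; if these all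
  agreed at \<open>g\<close> and \<open>0\<close>, so would it.\<close>

lemma dual_separates:
  fixes g :: 'g
  assumes "g \<noteq> 0"
  obtains \<gamma> where "\<gamma> \<in> dual" "chr (repr \<gamma>) g \<noteq> of_nat (ddim \<gamma>)"
proof -
  obtain r :: "'g mrep" where r: "cont_unitary_rep r" "chr r g \<noteq> of_nat (rep_dim r)"
    using exists_nontrivial_rep[OF assms] by blast
  obtain B where B: "B \<subseteq> dual" "\<And>g. chr r g = (\<Sum>\<beta>\<in>B. fmult r \<beta> * chr (repr \<beta>) g)"
    by (rule chr_expansion[OF r(1)]) (rule that)
  have "\<exists>\<gamma>\<in>B. chr (repr \<gamma>) g \<noteq> chr (repr \<gamma>) 0"
  proof (rule ccontr)
    assume "\<not> ?thesis"
    then have "chr r g = chr r 0" unfolding B(2) by (intro sum.cong) auto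
    then show False using r(2) chr_zero[OF r(1)] by simp
  qed
  then show ?thesis using that B(1) chr_zero[OF dual_cont_unitary] unfolding ddim_def by (metis subsetD)
qed

section \<open>Pointwise limit and uniform bound of the kernels\<close>

lemma ddim_pos: "\<alpha> \<in> dual \<Longrightarrow> ddim (\<alpha> :: 'g mrep set) \<ge> 1"
  unfolding ddim_def by (rule cont_unitary_repD(1)[OF dual_cont_unitary])

lemma wcard_pos:
  assumes "finite F" "F \<noteq> {}" "F \<subseteq> (dual :: 'g mrep set set)"
  shows "wcard F > 0"
  unfolding wcard_def using assms ddim_pos by (intro sum_pos) (fastforce simp: subset_iff)+

lemma folner_kernel_tendsto:
  fixes F :: "nat \<Rightarrow> 'g mrep set set"
  assumes F: "right_folner F"
  shows "(\<lambda>n. complex_of_real (1 / wcard (F n)) * (\<Sum>\<alpha>\<in>F n. of_nat (ddim \<alpha>) * chr (repr \<alpha>) g))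
    \<longlonglongrightarrow> (if g = 0 then 1 else 0)"
proof (cases "g = 0")
  case True
  have "(\<Sum>\<alpha>\<in>F n. of_nat (ddim \<alpha>) * chr (repr \<alpha>) g) = of_real (wcard (F n))" for n
    unfolding True wcard_def of_real_sum using F
    by (intro sum.cong refl)
      (auto simp: chr_zero dual_cont_unitary ddim_def power2_eq_square right_folner_def subset_iff)
  moreover have "wcard (F n) \<noteq> 0" for n
    using wcard_pos[of "F n"] F by (auto simp: right_folner_def)
  ultimately show ?thesis using True by simp
next
  case False
  then obtain \<gamma> where \<gamma>: "\<gamma> \<in> dual" "chr (repr \<gamma>) g \<noteq> of_nat (ddim \<gamma>)" by (rule dual_separates)
  define c where "c = cmod (chr (repr \<gamma>) g - of_nat (ddim \<gamma>))"
  have c: "c > 0" using \<gamma>(2) by (simp add: c_def)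
  have lim: "(\<lambda>n. ddim \<gamma> / c * (wcard (boundary {\<gamma>} (F n)) / wcard (F n))) \<longlonglongrightarrow> 0"
    using F \<gamma>(1) by (intro tendsto_mult_right_zero) (auto simp: right_folner_def)
  have "(\<lambda>n. complex_of_real (1 / wcard (F n)) * (\<Sum>\<alpha>\<in>F n. of_nat (ddim \<alpha>) * chr (repr \<alpha>) g)) \<longlonglongrightarrow> 0"
  proof (rule Lim_null_comparison[OF always_eventually lim], rule allI)
    fix n
    have Fn: "finite (F n)" "F n \<noteq> {}" "F n \<subseteq> dual" using F by (auto simp: right_folner_def)
    note w = wcard_pos[OF Fn]
    have "cmod (\<Sum>\<alpha>\<in>F n. of_nat (ddim \<alpha>) * chr (repr \<alpha>) g) \<le> ddim \<gamma> * wcard (boundary {\<gamma>} (F n)) / c"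
      using boundary_bound[OF Fn(1,3) \<gamma>(1), of g] c
      by (simp add: c_def[symmetric] pos_le_divide_eq mult.commute)
    from divide_right_mono[OF this, of "wcard (F n)"]
    show "norm (complex_of_real (1 / wcard (F n)) * (\<Sum>\<alpha>\<in>F n. of_nat (ddim \<alpha>) * chr (repr \<alpha>) g))
      \<le> ddim \<gamma> / c * (wcard (boundary {\<gamma>} (F n)) / wcard (F n))"
      using w by (simp add: norm_mult norm_divide mult.commute)
  qed
  then show ?thesis using False by simp
qed

lemma folner_kernel_bound:
  fixes F :: "nat \<Rightarrow> 'g mrep set set"
  assumes F: "right_folner F"
  shows "cmod (complex_of_real (1 / wcard (F n)) * (\<Sum>\<alpha>\<in>F n. of_nat (ddim \<alpha>) * chr (repr \<alpha>) g)) \<le> 1"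
proof -
  have Fn: "finite (F n)" "F n \<noteq> {}" "F n \<subseteq> dual" using F by (auto simp: right_folner_def)
  note w = wcard_pos[OF Fn]
  have "cmod (\<Sum>\<alpha>\<in>F n. of_nat (ddim \<alpha>) * chr (repr \<alpha>) g) \<le> wcard (F n)"
    unfolding wcard_def
  proof (rule sum_norm_le)
    fix \<alpha> assume "\<alpha> \<in> F n"
    then have "cmod (chr (repr \<alpha>) g) \<le> ddim \<alpha>"
      unfolding ddim_def using Fn(3) by (intro cmod_chr_le dual_cont_unitary) auto
    then show "cmod (of_nat (ddim \<alpha>) * chr (repr \<alpha>) g) \<le> (real (ddim \<alpha>))\<^sup>2"
      by (simp add: norm_mult power2_eq_square mult_left_mono)
  qed
  then show ?thesis using w by (simp add: norm_mult norm_divide)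
qed

end

text \<open>The trace of the matrix of \<open>x\<close> times the adjoint of that of
  \<open>y\<close>; this is how the double sums over \<open>i\<close>, \<open>j\<close> become
  translates of characters.\<close>

lemma chr_diff:
  assumes r: "cont_unitary_rep r"
  shows "(\<Sum>i<rep_dim r. \<Sum>j<rep_dim r. rep_mat r x i j * cnj (rep_mat r y i j)) = chr r (x - y)"
proof -
  have "(\<Sum>j<rep_dim r. rep_mat r (x - y + y) i j * cnj (rep_mat r y i j)) = rep_mat r (x - y) i i"
    if "i < rep_dim r" for i
    using rep_mat_neg_mult[OF r that that, of "x - y" y] .
  then show ?thesis unfolding chr_def by (intro sum.cong refl) simp
qed

section \<open>Fourier coefficients of measures\<close>

text \<open>The atom function lives on a countable set. Over a finite set of points its integral is
  the sum of the squared masses; exhausting the atoms by finite sets gives one inequality,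
  monotonicity the other.\<close>

lemma square_atoms:
  fixes M :: "'a::t1_space measure"
  assumes M: "sets M = sets borel" and fin: "finite_measure M"
  shows "(\<lambda>x. (measure M {x})\<^sup>2) summable_on UNIV"
    and "(\<Sum>\<^sub>\<infinity>x. (measure M {x})\<^sup>2) = (\<integral>x. measure M {x} \<partial>M)"
    and "(\<lambda>x. measure M {x}) \<in> borel_measurable M"
proof -
  interpret finite_measure M by fact
  define m where "m x = measure M {x}" for x
  have sing: "{x} \<in> sets M" for x using M by simp
  have space: "space M = UNIV" using sets_eq_imp_space_eq[OF M] by simp
  define A where "A = insert undefined {x. m x \<noteq> 0}"
  have A: "countable A" "A \<noteq> {}" using countable_support unfolding A_def m_def by auto
  have mz: "m x = 0" if "x \<notin> A" for x using that unfolding A_def by auto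
  \<comment> \<open>A finite measure has countably many atoms, so \<open>m\<close> differs from the
    zero function only on countably many measurable singletons.\<close>
  have m_meas: "m \<in> borel_measurable M"
    by (rule measurable_discrete_difference[where f = "\<lambda>_. 0", OF borel_measurable_const A(1)])
      (simp_all add: mz sing)
  then show "(\<lambda>x. measure M {x}) \<in> borel_measurable M" unfolding m_def[abs_def] .
  have m_bound: "0 \<le> m x" "m x \<le> measure M (space M)" for x
    unfolding m_def by (auto intro: bounded_measure)
  have int_m: "integrable M m"
    by (rule integrable_const_bound[of _ "measure M (space M)"]) (use m_bound m_meas in auto)
  have part: "integrable M (\<lambda>x. m x * indicator C x)" "(\<integral>x. m x * indicator C x \<partial>M) = (\<Sum>c\<in>C. (m c)\<^sup>2)"
    if "finite C" for C
  proof -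
    have eq: "m x * indicator C x = (\<Sum>c\<in>C. m c * indicator {c} x)" for x
      using that by (auto simp: indicator_def if_distrib[of "\<lambda>t. _ * t"] cong: if_cong)
    have i: "integrable M (\<lambda>x. m c * indicator {c} x)" for c
      using sing by (intro integrable_mult_right integrable_real_indicator)
        (simp_all add: less_top[symmetric])
    show "integrable M (\<lambda>x. m x * indicator C x)" unfolding eq by (intro Bochner_Integration.integrable_sum i)
    have "(\<integral>x. m x * indicator C x \<partial>M) = (\<Sum>c\<in>C. \<integral>x. m c * indicator {c} x \<partial>M)"
      unfolding eq by (rule Bochner_Integration.integral_sum) (rule i)
    also have "\<dots> = (\<Sum>c\<in>C. (m c)\<^sup>2)"
      using sing by (intro sum.cong refl) (simp add: m_def power2_eq_square space)
    finally show "(\<integral>x. m x * indicator C x \<partial>M) = (\<Sum>c\<in>C. (m c)\<^sup>2)" .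
  qed
  have upper: "(\<Sum>c\<in>C. (m c)\<^sup>2) \<le> (\<integral>x. m x \<partial>M)" if "finite C" for C
    unfolding part(2)[OF that, symmetric]
    using m_bound by (intro integral_mono part(1)[OF that] int_m) (auto simp: indicator_def)
  have summable: "(\<lambda>x. (m x)\<^sup>2) summable_on UNIV"
    using upper by (intro nonneg_bdd_above_summable_on bdd_aboveI2[where M = "\<integral>x. m x \<partial>M"]) auto
  then show "(\<lambda>x. (measure M {x})\<^sup>2) summable_on UNIV" unfolding m_def .
  define C where "C n = from_nat_into A ` {..<n::nat}" for n
  have "(\<lambda>n. \<integral>x. m x * indicator (C n) x \<partial>M) \<longlonglongrightarrow> (\<integral>x. m x \<partial>M)"
  proof (rule integral_dominated_convergence[where w = m])
    show "AE x in M. (\<lambda>n. m x * indicator (C n) x) \<longlonglongrightarrow> m x"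
    proof (rule AE_I2)
      fix x
      show "(\<lambda>n. m x * indicator (C n) x) \<longlonglongrightarrow> m x"
      proof (cases "x \<in> A")
        case True
        then obtain k where k: "x = from_nat_into A k" using from_nat_into_surj[OF A(1)] by metis
        have "\<forall>\<^sub>F n in sequentially. m x * indicator (C n) x = m x"
          unfolding eventually_sequentially by (intro exI[of _ "Suc k"]) (auto simp: C_def k)
        then show ?thesis by (rule tendsto_eventually)
      qed (simp add: mz)
    qed
    show "AE x in M. norm (m x * indicator (C n) x) \<le> m x" for n
      using m_bound by (intro AE_I2) (auto simp: indicator_def)
    show "(\<lambda>x. m x * indicator (C n) x) \<in> borel_measurable M" for n
      by (rule borel_measurable_integrable[OF part(1)]) (simp add: C_def)
  qed (use m_meas int_m in auto)
  then have lim: "(\<lambda>n. \<Sum>c\<in>C n. (m c)\<^sup>2) \<longlonglongrightarrow> (\<integral>x. m x \<partial>M)"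
    by (subst (asm) part(2)) (auto simp: C_def)
  have "(\<integral>x. m x \<partial>M) \<le> (\<Sum>\<^sub>\<infinity>x. (m x)\<^sup>2)"
    by (rule LIMSEQ_le_const2[OF lim]) (auto intro!: finite_sum_le_infsum summable simp: C_def)
  moreover have "(\<Sum>\<^sub>\<infinity>x. (m x)\<^sup>2) \<le> (\<integral>x. m x \<partial>M)"
    using summable upper by (intro infsum_le_finite_sums) auto
  ultimately show "(\<Sum>\<^sub>\<infinity>x. (measure M {x})\<^sup>2) = (\<integral>x. measure M {x} \<partial>M)"
    unfolding m_def by simp
qed

section \<open>Fourier sums as integrals of the kernels\<close>

context compact_metric_group
begin

lemma integrable_continuous:
  fixes f :: "'g \<Rightarrow> complex"
  assumes "sets \<mu> = sets borel" "finite_measure \<mu>" "continuous_on UNIV f"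
  shows "integrable \<mu> f"
proof -
  interpret finite_measure \<mu> by fact
  obtain B where "\<And>x. cmod (f x) \<le> B" using bounded_cont[OF assms(3)] by blast
  moreover have "f \<in> borel_measurable \<mu>"
    using borel_measurable_continuous_onI[OF assms(3)] measurable_cong_sets[OF assms(1) refl] by blast
  ultimately show ?thesis by (intro integrable_const_bound[of _ B]) auto
qed

lemma folner_fourier_sum:
  fixes F :: "nat \<Rightarrow> 'g mrep set set"
  assumes F: "right_folner F" and \<mu>: "sets \<mu> = sets borel" "finite_measure \<mu>"
  shows "complex_of_real (1 / wcard (F n)) *
      (\<Sum>\<alpha>\<in>F n. of_nat (ddim \<alpha>) *
        (\<Sum>i<ddim \<alpha>. \<Sum>j<ddim \<alpha>. integral\<^sup>L \<mu> (ucoef \<alpha> i j) * cnj (ucoef \<alpha> i j y)))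
    = (\<integral>x. complex_of_real (1 / wcard (F n)) * (\<Sum>\<alpha>\<in>F n. of_nat (ddim \<alpha>) * chr (repr \<alpha>) (x - y)) \<partial>\<mu>)"
proof -
  have u: "cont_unitary_rep (repr \<alpha>)" if "\<alpha> \<in> F n" for \<alpha>
    using that F by (intro dual_cont_unitary) (auto simp: right_folner_def)
  have i: "integrable \<mu> (ucoef \<alpha> i j)" if "\<alpha> \<in> F n" for \<alpha> i j
    unfolding ucoef_def by (intro integrable_continuous \<mu> cont_unitary_repD(3) u that)
  have eq: "(\<Sum>i<ddim \<alpha>. \<Sum>j<ddim \<alpha>. ucoef \<alpha> i j x * cnj (ucoef \<alpha> i j y)) = chr (repr \<alpha>) (x - y)"
    if "\<alpha> \<in> F n" for \<alpha> x
    using chr_diff[OF u[OF that], of x y] by (simp add: ucoef_def ddim_def)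
  have chr_int: "(\<Sum>i<ddim \<alpha>. \<Sum>j<ddim \<alpha>. integral\<^sup>L \<mu> (ucoef \<alpha> i j) * cnj (ucoef \<alpha> i j y))
    = (\<integral>x. chr (repr \<alpha>) (x - y) \<partial>\<mu>)" if "\<alpha> \<in> F n" for \<alpha>
    unfolding eq[OF that, symmetric] using i[OF that]
    by (simp add: Bochner_Integration.integral_sum Bochner_Integration.integrable_sum)
  have ci: "integrable \<mu> (\<lambda>x. chr (repr \<alpha>) (x - y))" if "\<alpha> \<in> F n" for \<alpha>
    unfolding eq[OF that, symmetric] using i[OF that] by (intro Bochner_Integration.integrable_sum integrable_mult_left) 
  have "(\<Sum>\<alpha>\<in>F n. of_nat (ddim \<alpha>) *
        (\<Sum>i<ddim \<alpha>. \<Sum>j<ddim \<alpha>. integral\<^sup>L \<mu> (ucoef \<alpha> i j) * cnj (ucoef \<alpha> i j y)))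
    = (\<Sum>\<alpha>\<in>F n. \<integral>x. of_nat (ddim \<alpha>) * chr (repr \<alpha>) (x - y) \<partial>\<mu>)"
    by (intro sum.cong refl) (simp add: chr_int)
  also have "\<dots> = (\<integral>x. (\<Sum>\<alpha>\<in>F n. of_nat (ddim \<alpha>) * chr (repr \<alpha>) (x - y)) \<partial>\<mu>)"
    by (rule Bochner_Integration.integral_sum[symmetric]) (intro integrable_mult_right ci)
  finally show ?thesis by simp
qed

end

theorem theorem4p1:
  fixes F :: "nat \<Rightarrow> ('g::{topological_group_add, metric_space}) mrep set set"
    and y :: 'g
    and \<mu> :: "'g measure"
  assumes "compact (UNIV :: 'g set)"
    and "right_folner F"
    and "sets \<mu> = sets borel"
    and "finite_measure \<mu>"
  shows "((\<lambda>n. complex_of_real (1 / wcard (F n)) *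
            (\<Sum>\<alpha>\<in>F n. of_nat (ddim \<alpha>) *
               (\<Sum>i<ddim \<alpha>. \<Sum>j<ddim \<alpha>.
                  (integral\<^sup>L \<mu> (ucoef \<alpha> i j)) * cnj (ucoef \<alpha> i j y))))
         \<longlonglongrightarrow> complex_of_real (measure \<mu> {y}))
    \<and> ((\<lambda>n. (1 / wcard (F n)) *
            (\<Sum>\<alpha>\<in>F n. real (ddim \<alpha>) *
               (\<Sum>i<ddim \<alpha>. \<Sum>j<ddim \<alpha>. (cmod (integral\<^sup>L \<mu> (ucoef \<alpha> i j)))^2)))
         \<longlonglongrightarrow> (\<Sum>\<^sub>\<infinity>x\<in>UNIV. (measure \<mu> {x})^2))
    \<and> ((\<forall>x. measure \<mu> {x} = 0) \<longleftrightarrow>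
         (\<lambda>n. (1 / wcard (F n)) *
            (\<Sum>\<alpha>\<in>F n. real (ddim \<alpha>) *
               (\<Sum>i<ddim \<alpha>. \<Sum>j<ddim \<alpha>. (cmod (integral\<^sup>L \<mu> (ucoef \<alpha> i j)))^2)))
         \<longlonglongrightarrow> 0)"
proof -
  interpret compact_metric_group "TYPE('g)" by unfold_locales (rule assms)
  interpret finite_measure \<mu> by fact
  note F = assms(2) and \<mu> = assms(3,4)
  have space: "space \<mu> = UNIV" using sets_eq_imp_space_eq[OF \<mu>(1)] by simp
  have sing: "{x} \<in> sets \<mu>" for x using \<mu>(1) by simp
  define K where "K n g = complex_of_real (1 / wcard (F n)) * (\<Sum>\<alpha>\<in>F n. of_nat (ddim \<alpha>) * chr (repr \<alpha>) g)" for n g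
  define a where "a n y = complex_of_real (1 / wcard (F n)) *
            (\<Sum>\<alpha>\<in>F n. of_nat (ddim \<alpha>) *
               (\<Sum>i<ddim \<alpha>. \<Sum>j<ddim \<alpha>.
                  (integral\<^sup>L \<mu> (ucoef \<alpha> i j)) * cnj (ucoef \<alpha> i j y)))" for n y
  define D where "D n = (1 / wcard (F n)) *
            (\<Sum>\<alpha>\<in>F n. real (ddim \<alpha>) *
               (\<Sum>i<ddim \<alpha>. \<Sum>j<ddim \<alpha>. (cmod (integral\<^sup>L \<mu> (ucoef \<alpha> i j)))^2))" for n
  have u: "cont_unitary_rep (repr \<alpha>)" if "\<alpha> \<in> F n" for \<alpha> n
    using that F by (intro dual_cont_unitary) (auto simp: right_folner_def)
  have cu: "continuous_on UNIV (ucoef \<alpha> i j)" if "\<alpha> \<in> F n" for \<alpha> i j n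
    unfolding ucoef_def by (intro cont_unitary_repD(3) u[OF that])
  have cK: "continuous_on UNIV (K n)" for n
    unfolding K_def by (intro continuous_intros continuous_on_chr u)
  have aK: "a n y = (\<integral>x. K n (x - y) \<partial>\<mu>)" for n y
    unfolding a_def K_def by (rule folner_fourier_sum[OF F \<mu>])
  have K_int: "integrable \<mu> (\<lambda>x. K n (x - y))" for n y
    by (intro integrable_continuous \<mu> continuous_on_compose2[OF cK] continuous_intros) auto
  have K_le: "cmod (K n g) \<le> 1" for n g
    unfolding K_def by (rule folner_kernel_bound[OF F])
  have a_lim: "(\<lambda>n. a n y) \<longlonglongrightarrow> complex_of_real (measure \<mu> {y})" for y
  proof -
    have "(\<lambda>n. \<integral>x. K n (x - y) \<partial>\<mu>) \<longlonglongrightarrow> (\<integral>x. complex_of_real (indicator {y} x) \<partial>\<mu>)"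
    proof (rule integral_dominated_convergence[where w = "\<lambda>_. 1"])
      show "AE x in \<mu>. (\<lambda>n. K n (x - y)) \<longlonglongrightarrow> complex_of_real (indicator {y} x)"
      proof (rule AE_I2)
        fix x
        have "(if x - y = 0 then 1 else 0) = complex_of_real (indicator {y} x)"
          by (simp add: indicator_def)
        then show "(\<lambda>n. K n (x - y)) \<longlonglongrightarrow> complex_of_real (indicator {y} x)"
          using folner_kernel_tendsto[OF F, of "x - y"] unfolding K_def by simp
      qed
      show "(\<lambda>x. complex_of_real (indicator {y} x)) \<in> borel_measurable \<mu>"
        using sing by measurable
    qed (use K_int K_le in auto)
    also have "(\<integral>x. complex_of_real (indicator {y} x) \<partial>\<mu>) = complex_of_real (measure \<mu> {y})"
      using space by simp
    finally show ?thesis unfolding aK .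
  qed
  have a_cont: "continuous_on UNIV (a n)" for n
    unfolding a_def by (intro continuous_intros cu) auto
  \<comment> \<open>The total mass dominates the sequence \<open>a n\<close> when it is integrated
    over its argument for the second limit.\<close>
  have a_le: "cmod (a n y) \<le> measure \<mu> (space \<mu>)" for n y
  proof -
    have "cmod (a n y) \<le> (\<integral>x. cmod (K n (x - y)) \<partial>\<mu>)" unfolding aK by (rule integral_norm_bound)
    also have "\<dots> \<le> (\<integral>x. 1 \<partial>\<mu>)"
      using K_le by (intro integral_mono integrable_norm K_int) auto
    finally show ?thesis by simp
  qed
  \<comment> \<open>Integrating the conjugate coefficient against \<mu> as well gives the conjugate
    of its mean, so each term becomes a squared modulus. The sums are finite, so linearity is all
    that is used.\<close>
  have aD: "(\<integral>y. a n y \<partial>\<mu>) = of_real (D n)" for n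
  proof -
    have i: "integrable \<mu> (ucoef \<alpha> i j)" if "\<alpha> \<in> F n" for \<alpha> i j
      by (intro integrable_continuous \<mu> cu[OF that])
    have 1: "integrable \<mu> (\<lambda>y. c * cnj (ucoef \<alpha> i j y))" if "\<alpha> \<in> F n" for \<alpha> i j c
      using i[OF that] by simp
    have 2: "integrable \<mu> (\<lambda>y. \<Sum>j<ddim \<alpha>. integral\<^sup>L \<mu> (ucoef \<alpha> i j) * cnj (ucoef \<alpha> i j y))" if "\<alpha> \<in> F n" for \<alpha> i
      by (intro Bochner_Integration.integrable_sum 1[OF that])
    have 3: "integrable \<mu> (\<lambda>y. \<Sum>i<ddim \<alpha>. \<Sum>j<ddim \<alpha>. integral\<^sup>L \<mu> (ucoef \<alpha> i j) * cnj (ucoef \<alpha> i j y))" if "\<alpha> \<in> F n" for \<alpha>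
      by (intro Bochner_Integration.integrable_sum 2[OF that])
    have "(\<integral>y. (\<Sum>i<ddim \<alpha>. \<Sum>j<ddim \<alpha>. integral\<^sup>L \<mu> (ucoef \<alpha> i j) * cnj (ucoef \<alpha> i j y)) \<partial>\<mu>)
       = of_real (\<Sum>i<ddim \<alpha>. \<Sum>j<ddim \<alpha>. (cmod (integral\<^sup>L \<mu> (ucoef \<alpha> i j)))^2)" if "\<alpha> \<in> F n" for \<alpha>
      by (simp add: Bochner_Integration.integral_sum[OF 2[OF that]] Bochner_Integration.integral_sum[OF 1[OF that]]
          complex_norm_square del: of_real_power)
    then have "(\<integral>y. (\<Sum>\<alpha>\<in>F n. of_nat (ddim \<alpha>) *
        (\<Sum>i<ddim \<alpha>. \<Sum>j<ddim \<alpha>. integral\<^sup>L \<mu> (ucoef \<alpha> i j) * cnj (ucoef \<alpha> i j y))) \<partial>\<mu>)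
       = of_real (\<Sum>\<alpha>\<in>F n. real (ddim \<alpha>) * (\<Sum>i<ddim \<alpha>. \<Sum>j<ddim \<alpha>. (cmod (integral\<^sup>L \<mu> (ucoef \<alpha> i j)))^2))"
      by (subst Bochner_Integration.integral_sum) (auto intro!: integrable_mult_right 3)
    then show ?thesis unfolding a_def D_def by simp
  qed
  have "(\<lambda>n. \<integral>y. a n y \<partial>\<mu>) \<longlonglongrightarrow> (\<integral>y. complex_of_real (measure \<mu> {y}) \<partial>\<mu>)"
  proof (rule integral_dominated_convergence[where w = "\<lambda>_. measure \<mu> (space \<mu>)"])
    show "(\<lambda>y. complex_of_real (measure \<mu> {y})) \<in> borel_measurable \<mu>"
      using square_atoms(3)[OF \<mu>] by measurable
    show "a n \<in> borel_measurable \<mu>" for n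
      by (rule borel_measurable_integrable[OF integrable_continuous[OF \<mu> a_cont]])
  qed (use a_lim a_le in auto)
  then have "(\<lambda>n. complex_of_real (D n)) \<longlonglongrightarrow> of_real (\<Sum>\<^sub>\<infinity>x. (measure \<mu> {x})\<^sup>2)"
    unfolding aD square_atoms(2)[OF \<mu>] by simp
  then have D_lim: "D \<longlonglongrightarrow> (\<Sum>\<^sub>\<infinity>x. (measure \<mu> {x})\<^sup>2)" unfolding tendsto_of_real_iff .
  have "(\<forall>x. measure \<mu> {x} = 0) \<longleftrightarrow> D \<longlonglongrightarrow> 0"
  proof
    assume "\<forall>x. measure \<mu> {x} = 0"
    then show "D \<longlonglongrightarrow> 0" using D_lim by simp
  next
    assume "D \<longlonglongrightarrow> 0"
    then have "(\<Sum>\<^sub>\<infinity>x. (measure \<mu> {x})\<^sup>2) = 0" using D_lim LIMSEQ_unique by blast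
    then have "(measure \<mu> {x})\<^sup>2 \<le> 0" for x
      using finite_sum_le_infsum[OF square_atoms(1)[OF \<mu>], of "{x}"] by simp
    then show "\<forall>x. measure \<mu> {x} = 0" by simp
  qed
  then show ?thesis
    using a_lim[of y] D_lim unfolding a_def D_def by blast
qed

end
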